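(* Let $\beta>1$ be a non-integer, let $J\subset\{0,1,\dots,[\beta]\}$ with $|J|>1$, suppose that $X_{\beta,0}(J)$ is infinite, and let $H:J\to\mathbb R_+=(0,\infty)$. Then: (1) there are a unique $\lambda>0$ and a unique $(\tfrac1{\lambda H},T)$-conformal probability measure $\mu_{J,H}$ on $X_\beta(J)$; (2) $\mu_{J,H}$ is an $(S,\widetilde\alpha)$-product measure, and is $\mathcal E(X_\beta)$-invariant and ergodic.
   Context: $[\cdot]$ is the integer part. For $x\in[0,1]$ let $T_\beta x=\{\beta x\}$ (fractional part) and $\pi_\beta(x)=(\varepsilon_1,\varepsilon_2,\dots)$, $\varepsilon_n=[\beta T_\beta^{n-1}x]$. Let $\omega=\omega_\beta$ be $\pi_\beta(1)$, except that if $\pi_\beta(1)=(\eta_1,\dots,\eta_q,0,0,\dots)$ with $\eta_q\neq0$, then $\omega_\beta$ is the periodic sequence with period $(\eta_1,\dots,\eta_{q-1},\eta_q-1)$. The $\beta$-shift is $$X_\beta=\{y\in\{0,\dots,[\beta]\}^{\mathbb N}: (y_k,y_{k+1},\dots)\preceq\omega_\beta\ \forall k\ge1\}$$ with $\preceq$ the lexicographic order (equivalently, the closure of $\pi_\beta([0,1))$), $T$ is the left shift, $\alpha=\{[j]\}$ is the partition by first coordinate, and $\alpha_n$ is the set of nonempty cylinders $[a_1,\dots,a_n]=\{x\in X_\beta: x_i=a_i, 1\le i\le n\}$. Let $\Gamma=\{x\in X_\beta:\exists n\ge1,\ (x_n,x_{n+1},\dots)=\omega_\beta\}$ and $X_{\beta,0}=X_\beta\setminus\Gamma$.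 For $x\in X_{\beta,0}$ put $\psi(x)=\min\{N\ge1: T^N[x_1,\dots,x_N]=X_\beta\}$ (finite), $S(x)=T^{\psi(x)}x\in X_{\beta,0}$, and $\widetilde\alpha=\{a\cap X_{\beta,0}: a\in\alpha_n,\ n\ge1,\ a\cap X_{\beta,0}\ne\emptyset,\ \psi\equiv n\text{ on }a\cap X_{\beta,0}\}$, a partition of $X_{\beta,0}$ each of whose elements is mapped by $S$ bijectively onto $X_{\beta,0}$. $X_{\beta,0}(J)=X_{\beta,0}\cap J^{\mathbb N}$ and, when $X_{\beta,0}(J)$ is infinite, $X_\beta(J)=X_\beta\cap J^{\mathbb N}$, which is then the closure of $X_{\beta,0}(J)$. A probability measure $\mu$ on $X_\beta(J)$ is $(\frac1{\lambda H},T)$-conformal if $\frac{d\mu\circ T}{d\mu}(x)=\frac1{\lambda H(x_1)}$ a.e., i.e. $\mu(TB)=\int_B\frac{1}{\lambda H(x_1)}d\mu(x)$ for every Borel $B\subset X_\beta(J)$ contained in a single $[j]$. An $(S,\widetilde\alpha)$-product measure is a probability measure $\mu$ giving full mass to $X_{\beta,0}$ with $\mu(\bigcap_{j=0}^nS^{-j}A_j)=\prod_{j=0}^n\mu(A_j)$ for all $n\ge0$, $A_0,\dots,A_n\in\widetilde\alpha$. $\mathcal E(X_\beta)$ is the set of $(x,y)\in X_\beta^2$ such that $y$ is obtained from $x$ by permuting finitely many coordinates. $\mu$ (viewed as a measure on $X_\beta$) is $\mathcal E(X_\beta)$-invariant if $\mu(\kappa(C))=\mu(C)$ for every bi-measurable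 bijection $\kappa:A\to B$ of Borel sets with $(x,\kappa x)\in\mathcal E(X_\beta)$ for all $x\in A$ and all Borel $C\subseteq A$; it is ergodic if every Borel union of $\mathcal E(X_\beta)$-classes is null or conull. *)

theory Defs
  imports "HOL-Probability.Probability" "HOL-Library.Fun_Lexorder"
begin

text \<open>Sequences are functions on \<^typ>\<open>nat\<close> with the library's product topology (\<^typ>\<open>nat\<close> being
  discrete) and its Borel sets. They are indexed from 0, so the \<open>n\<close>-th coordinate
  (\<open>n \<ge> 1\<close>) of the mathematical sequence is \<open>x (n - 1)\<close>.\<close>

definition beta_map :: "real \<Rightarrow> real \<Rightarrow> real" where
  "beta_map \<beta> x = frac (\<beta> * x)"

definition beta_expansion :: "real \<Rightarrow> real \<Rightarrow> nat \<Rightarrow> nat" where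
  "beta_expansion \<beta> x n = nat \<lfloor>\<beta> * (beta_map \<beta> ^^ n) x\<rfloor>"

definition finite_expansion :: "(nat \<Rightarrow> nat) \<Rightarrow> nat \<Rightarrow> bool" where
  "finite_expansion \<eta> q \<longleftrightarrow> 1 \<le> q \<and> \<eta> (q - 1) \<noteq> 0 \<and> (\<forall>n\<ge>q. \<eta> n = 0)"

text \<open>The \<open>THE\<close> is well defined: \<open>q - 1\<close> is the position of the last nonzero digit.\<close>

definition omega :: "real \<Rightarrow> nat \<Rightarrow> nat" where
  "omega \<beta> =
    (let \<eta> = beta_expansion \<beta> 1 in
     if \<exists>q. finite_expansion \<eta> q then
       (let q = (THE q. finite_expansion \<eta> q) in
        (\<lambda>n. if n mod q = q - 1 then \<eta> (q - 1) - 1 else \<eta> (n mod q)))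
     else \<eta>)"

definition shift :: "(nat \<Rightarrow> nat) \<Rightarrow> nat \<Rightarrow> nat" where
  "shift x = (\<lambda>n. x (Suc n))"

definition lex_le :: "(nat \<Rightarrow> nat) \<Rightarrow> (nat \<Rightarrow> nat) \<Rightarrow> bool" where
  "lex_le x y \<longleftrightarrow> x = y \<or> less_fun x y"

definition beta_shift :: "real \<Rightarrow> (nat \<Rightarrow> nat) set" where
  "beta_shift \<beta> = {y. (\<forall>n. y n \<le> nat \<lfloor>\<beta>\<rfloor>) \<and> (\<forall>k. lex_le ((shift ^^ k) y) (omega \<beta>))}"

definition Gamma_set :: "real \<Rightarrow> (nat \<Rightarrow> nat) set" where
  "Gamma_set \<beta> = {x \<in> beta_shift \<beta>. \<exists>n. (shift ^^ n) x = omega \<beta>}"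

definition beta_shift0 :: "real \<Rightarrow> (nat \<Rightarrow> nat) set" where
  "beta_shift0 \<beta> = beta_shift \<beta> - Gamma_set \<beta>"

definition beta_shift_on :: "real \<Rightarrow> nat set \<Rightarrow> (nat \<Rightarrow> nat) set" where
  "beta_shift_on \<beta> J = beta_shift \<beta> \<inter> {x. \<forall>n. x n \<in> J}"

definition beta_shift0_on :: "real \<Rightarrow> nat set \<Rightarrow> (nat \<Rightarrow> nat) set" where
  "beta_shift0_on \<beta> J = beta_shift0 \<beta> \<inter> {x. \<forall>n. x n \<in> J}"

definition cylinder :: "real \<Rightarrow> nat list \<Rightarrow> (nat \<Rightarrow> nat) set" where
  "cylinder \<beta> w = {x \<in> beta_shift \<beta>. \<forall>i<length w. x i = w ! i}"

definition alpha :: "real \<Rightarrow> nat \<Rightarrow> (nat \<Rightarrow> nat) set set" where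
  "alpha \<beta> n = {cylinder \<beta> w | w. length w = n \<and> cylinder \<beta> w \<noteq> {}}"

text \<open>\<open>psi\<close> and \<open>induced_shift\<close> are only meaningful on \<^term>\<open>beta_shift0 \<beta>\<close>, where the minimum exists.\<close>

definition psi :: "real \<Rightarrow> (nat \<Rightarrow> nat) \<Rightarrow> nat" where
  "psi \<beta> x = (LEAST N. 1 \<le> N \<and> (shift ^^ N) ` cylinder \<beta> (map x [0..<N]) = beta_shift \<beta>)"

definition induced_shift :: "real \<Rightarrow> (nat \<Rightarrow> nat) \<Rightarrow> nat \<Rightarrow> nat" where
  "induced_shift \<beta> x = (shift ^^ psi \<beta> x) x"

definition alpha_tilde :: "real \<Rightarrow> (nat \<Rightarrow> nat) set set" where
  "alpha_tilde \<beta> = {a \<inter> beta_shift0 \<beta> | a n. 1 \<le> n \<and> a \<in> alpha \<beta> n \<and> a \<inter> beta_shift0 \<beta> \<noteq> {} \<and>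
     (\<forall>x \<in> a \<inter> beta_shift0 \<beta>. psi \<beta> x = n)}"

text \<open>\<open>H\<close> is a total function, but only its values on \<open>J\<close> matter. In the identity below \<open>B\<close> ranges
  over the Borel subsets of the space that lie in a single first-coordinate cylinder.\<close>

definition conformal ::
  "real \<Rightarrow> nat set \<Rightarrow> (nat \<Rightarrow> real) \<Rightarrow> real \<Rightarrow> (nat \<Rightarrow> nat) measure \<Rightarrow> bool" where
  "conformal \<beta> J H c \<mu> \<longleftrightarrow>
     sets \<mu> = sets (restrict_space borel (beta_shift_on \<beta> J)) \<and> prob_space \<mu> \<and>
     (\<forall>j. \<forall>B \<in> sets \<mu>. (\<forall>x\<in>B. x 0 = j) \<longrightarrow>
        emeasure \<mu> (shift ` B) = (\<integral>\<^sup>+x\<in>B. ennreal (1 / (c * H (x 0))) \<partial>\<mu>))"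

text \<open>A measure on the subspace \<^term>\<open>beta_shift_on \<beta> J\<close>, viewed as a measure on \<^term>\<open>beta_shift \<beta>\<close>.\<close>

definition on_beta_shift :: "real \<Rightarrow> (nat \<Rightarrow> nat) measure \<Rightarrow> (nat \<Rightarrow> nat) measure" where
  "on_beta_shift \<beta> \<mu> = distr \<mu> (restrict_space borel (beta_shift \<beta>)) (\<lambda>x. x)"

definition product_measure :: "real \<Rightarrow> (nat \<Rightarrow> nat) measure \<Rightarrow> bool" where
  "product_measure \<beta> \<nu> \<longleftrightarrow> prob_space \<nu> \<and> emeasure \<nu> (beta_shift0 \<beta>) = 1 \<and>
     (\<forall>n A. (\<forall>j\<le>n. A j \<in> alpha_tilde \<beta>) \<longrightarrow>
        emeasure \<nu> (\<Inter>j\<le>n. {x \<in> beta_shift0 \<beta>. (induced_shift \<beta> ^^ j) x \<in> A j}) =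
        (\<Prod>j\<le>n. emeasure \<nu> (A j)))"

definition exchange_rel :: "(nat \<Rightarrow> nat) set \<Rightarrow> ((nat \<Rightarrow> nat) \<times> (nat \<Rightarrow> nat)) set" where
  "exchange_rel X = {(x, y). x \<in> X \<and> y \<in> X \<and> (\<exists>p F. finite F \<and> p permutes F \<and> y = x \<circ> p)}"

definition rel_invariant :: "'a measure \<Rightarrow> ('a \<times> 'a) set \<Rightarrow> bool" where
  "rel_invariant M E \<longleftrightarrow>
     (\<forall>A \<in> sets M. \<forall>B \<in> sets M. \<forall>\<kappa>.
        bij_betw \<kappa> A B \<and>
        \<kappa> \<in> restrict_space M A \<rightarrow>\<^sub>M restrict_space M B \<and>
        the_inv_into A \<kappa> \<in> restrict_space M B \<rightarrow>\<^sub>M restrict_space M A \<and>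
        (\<forall>x\<in>A. (x, \<kappa> x) \<in> E) \<longrightarrow>
        (\<forall>C \<in> sets M. C \<subseteq> A \<longrightarrow> emeasure M (\<kappa> ` C) = emeasure M C))"

definition rel_ergodic :: "'a measure \<Rightarrow> ('a \<times> 'a) set \<Rightarrow> bool" where
  "rel_ergodic M E \<longleftrightarrow>
     (\<forall>K \<subseteq> space M // E. \<Union>K \<in> sets M \<longrightarrow>
        emeasure M (\<Union>K) = 0 \<or> emeasure M (space M - \<Union>K) = 0)"

end

theory Submission
  imports Defs "HOL-Library.Omega_Words_Fun" "HOL-Combinatorics.Permutations"
begin

text \<open>
  Write \<open>\<omega>\<close> for \<^term>\<open>omega \<beta>\<close> and \<open>X\<close> for the \<open>\<beta>\<close>-shift. The only properties of \<open>\<omega>\<close> that matter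
  are that its letters are at most \<open>\<lfloor>\<beta>\<rfloor>\<close> and that every shift of \<open>\<omega>\<close> is at most \<open>\<omega>\<close>.

  \<^bold>\<open>Coding.\<close> A word \<open>u\<close> is called full if \<open>u \<frown> y \<in> X\<close> for all \<open>y \<in> X\<close>. Suffixes and concatenations of
  full words are full, so every full word is a product of minimal nonempty full words, the code words,
  and this factorisation is unique. A prefix of \<open>\<omega>\<close> with its last letter lowered is full, whereas a
  prefix of \<open>\<omega>\<close> itself is full only if it is a period of \<open>\<omega>\<close>. Hence the points outside \<open>\<Gamma>\<close> are
  infinite products of code words, and the induced shift removes the first factor. Let \<open>W\<close> be the
  set of code words over \<open>J\<close>; it has at least two elements, because there are infinitely many points
  over \<open>J\<close> outside \<open>\<Gamma>\<close>.

  \<^bold>\<open>The constant.\<close> Put \<open>wt c u = (\<Prod>a\<leftarrow>u. c * H a)\<close>. A conformal measure satisfies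
  \<open>\<mu> (u \<frown> B) = wt c u * \<mu> B\<close>. It does not charge \<open>\<Gamma>\<close> (\<open>emeasure_XJ_minus_X0J\<close>), so the weights of \<open>W\<close>
  sum to 1. This determines \<open>c\<close>, and then the masses of the cylinders of full words determine \<open>\<mu>\<close>
  (\<open>conformal_unique\<close>). That the sum takes the value 1 at all is clear if \<open>W\<close> is finite. If \<open>W\<close> is
  infinite, the sum is a power series in \<open>c\<close>, and the point is that it cannot stay below 1 on its disc
  of convergence (\<open>ex_total_weight_ge_1\<close>). If it did, it would still be less than 1 at the radius of
  convergence. The total weight of all words that arise from a prefix of \<open>\<omega>\<close> by lowering arbitrary
  letters to the least letter of \<open>J\<close> would then be bounded, by a renewal argument. As each letter that
  can be lowered enlarges this total weight by a fixed factor compared with the weight of the prefix, the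
  weights of the prefixes would decay exponentially, and the series would converge beyond its radius.

  \<^bold>\<open>Existence.\<close> Concatenating independent code words, drawn from \<open>W\<close> with their weights as
  probabilities, gives a measure. It is conformal because a code word without its first letter is again
  a full word (\<open>conformal_conformal_law\<close>).

  \<^bold>\<open>Product property, invariance, ergodicity.\<close> Cylinders of full words have multiplicative masses,
  which is the product property. The weight of a word does not depend on the order of its letters,
  which gives invariance, as a partial bijection inside the relation exchanges on countably many pieces
  one initial word for a rearrangement of it. For ergodicity let \<open>U\<close> be a saturated set and let \<open>r u\<close> be
  the mass of \<open>{y. u \<frown> y \<in> U}\<close>. The function \<open>r\<close> is harmonic for the random walk that appends code words, and
  \<open>r (u @ v @ w) = r (u @ w @ v)\<close> because \<open>U\<close> is saturated. By the Choquet--Deny argument \<open>r\<close> is constant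
  (\<open>harmonic_commuting_const\<close>), that is, \<open>U\<close> is independent of all cylinders of full words, and so
  of itself.
\<close>

text \<open>Words are prepended to sequences by \<^const>\<open>conc\<close>; the rewrite rules that take off single letters
  would break up the words considered here.\<close>

declare build_cons [simp del] build_append [simp del]

section \<open>The lexicographic order on sequences\<close>

lemma shift_funpow: "(shift ^^ n) x = suffix n x"
  by (induction n arbitrary: x) (simp_all add: funpow_swap1 shift_def suffix_def)

lemma ex_first_difference:
  fixes x y :: "nat \<Rightarrow> nat"
  assumes "x \<noteq> y"
  obtains n where "\<And>i. i < n \<Longrightarrow> x i = y i" "x n \<noteq> y n"
proof -
  from assms have "\<exists>n. x n \<noteq> y n" by auto
  then obtain n where "x n \<noteq> y n \<and> (\<forall>i<n. \<not> x i \<noteq> y i)"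
    using exists_least_iff[of "\<lambda>n. x n \<noteq> y n"] by blast
  then have "\<And>i. i < n \<Longrightarrow> x i = y i" "x n \<noteq> y n" by auto
  then show ?thesis by (rule that)
qed

lemma lex_le_iff: "lex_le x y \<longleftrightarrow> (\<forall>n. (\<forall>i<n. x i = y i) \<longrightarrow> x n \<le> y n)"
proof
  assume "lex_le x y"
  then show "\<forall>n. (\<forall>i<n. x i = y i) \<longrightarrow> x n \<le> y n"
    unfolding lex_le_def less_fun_def by (metis nat_le_linear nat_less_le not_less_iff_gr_or_eq)
next
  assume *: "\<forall>n. (\<forall>i<n. x i = y i) \<longrightarrow> x n \<le> y n"
  show "lex_le x y"
  proof (cases "x = y")
    case False
    then obtain n where "\<And>i. i < n \<Longrightarrow> x i = y i" "x n \<noteq> y n"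
      using ex_first_difference[of x y] by blast
    with * have "less_fun x y" unfolding less_fun_def by (metis nat_less_le)
    then show ?thesis by (simp add: lex_le_def)
  qed (simp add: lex_le_def)
qed

lemma lex_le_refl [simp]: "lex_le x x"
  by (simp add: lex_le_def)

lemma lex_le_trans: "lex_le x y \<Longrightarrow> lex_le y z \<Longrightarrow> lex_le x z"
  unfolding lex_le_def using less_fun_trans by blast

lemma lex_le_antisym: "lex_le x y \<Longrightarrow> lex_le y x \<Longrightarrow> x = y"
  unfolding lex_le_def using less_fun_asym by blast

lemma lex_le_conc_iff [simp]: "lex_le (u \<frown> x) (u \<frown> y) \<longleftrightarrow> lex_le x y"
proof
  assume *: "lex_le x y"
  show "lex_le (u \<frown> x) (u \<frown> y)"
    unfolding lex_le_iff
  proof (intro allI impI)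
    fix n assume eq: "\<forall>i<n. (u \<frown> x) i = (u \<frown> y) i"
    show "(u \<frown> x) n \<le> (u \<frown> y) n"
    proof (cases "n < length u")
      case False
      have "x i = y i" if "i < n - length u" for i
        using eq[rule_format, of "length u + i"] that by simp
      then have "x (n - length u) \<le> y (n - length u)"
        using * unfolding lex_le_iff by blast
      with False show ?thesis by simp
    qed simp
  qed
next
  assume *: "lex_le (u \<frown> x) (u \<frown> y)"
  show "lex_le x y"
    unfolding lex_le_iff
  proof (intro allI impI)
    fix n assume eq: "\<forall>i<n. x i = y i"
    have "(u \<frown> x) i = (u \<frown> y) i" if "i < length u + n" for i
      using eq that by (cases "i < length u") auto
    then have "(u \<frown> x) (length u + n) \<le> (u \<frown> y) (length u + n)"
      using * unfolding lex_le_iff by blast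
    then show "x n \<le> y n" by simp
  qed
qed

section \<open>The quasi-greedy expansion of 1\<close>

lemma beta_map_funpow_range:
  assumes "0 \<le> x" "x \<le> 1"
  shows "0 \<le> (beta_map \<beta> ^^ n) x \<and> (beta_map \<beta> ^^ n) x \<le> 1"
  by (cases n) (use assms in \<open>auto simp: beta_map_def frac_ge_0 intro: less_imp_le[OF frac_lt_1]\<close>)

lemma beta_expansion_le:
  assumes "\<beta> > 1" "0 \<le> x" "x \<le> 1"
  shows "beta_expansion \<beta> x n \<le> nat \<lfloor>\<beta>\<rfloor>"
proof -
  have "\<beta> * (beta_map \<beta> ^^ n) x \<le> \<beta>"
    using beta_map_funpow_range[OF assms(2,3), of n \<beta>] assms(1) by (simp add: mult_left_le)
  then show ?thesis unfolding beta_expansion_def by (intro nat_mono floor_mono)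
qed

lemma suffix_beta_expansion:
  "suffix k (beta_expansion \<beta> x) = beta_expansion \<beta> ((beta_map \<beta> ^^ k) x)"
  by (rule ext) (metis beta_expansion_def add.commute comp_apply funpow_add suffix_nth)

lemma beta_expansion_mono:
  assumes "\<beta> > 1" "0 \<le> x" "x \<le> y" "y \<le> 1"
  shows "lex_le (beta_expansion \<beta> x) (beta_expansion \<beta> y)"
  unfolding lex_le_iff
proof (intro allI impI)
  fix n assume eq: "\<forall>i<n. beta_expansion \<beta> x i = beta_expansion \<beta> y i"
  have "(beta_map \<beta> ^^ k) x \<le> (beta_map \<beta> ^^ k) y" if "k \<le> n" for k
    using that
  proof (induction k)
    case (Suc k)
    define a b where "a = (beta_map \<beta> ^^ k) x" and "b = (beta_map \<beta> ^^ k) y"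
    have "0 \<le> a" "0 \<le> b"
      using beta_map_funpow_range[of x k \<beta>] beta_map_funpow_range[of y k \<beta>] assms
      by (auto simp: a_def b_def)
    then have "0 \<le> \<beta> * a" "0 \<le> \<beta> * b" using assms(1) by auto
    moreover have "nat \<lfloor>\<beta> * a\<rfloor> = nat \<lfloor>\<beta> * b\<rfloor>"
      using eq Suc.prems unfolding beta_expansion_def a_def b_def by auto
    ultimately have "\<lfloor>\<beta> * a\<rfloor> = \<lfloor>\<beta> * b\<rfloor>" by (simp add: eq_nat_nat_iff)
    moreover have "\<beta> * a \<le> \<beta> * b" using Suc assms(1) by (simp add: a_def b_def)
    ultimately have "beta_map \<beta> a \<le> beta_map \<beta> b" by (simp add: beta_map_def frac_def)
    then show ?case by (simp add: a_def b_def)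
  qed (use assms in simp)
  from this[of n] show "beta_expansion \<beta> x n \<le> beta_expansion \<beta> y n"
    unfolding beta_expansion_def using assms(1) by (intro nat_mono floor_mono) simp
qed

lemma suffix_beta_expansion_1_le:
  assumes "\<beta> > 1"
  shows "lex_le (suffix k (beta_expansion \<beta> 1)) (beta_expansion \<beta> 1)"
  unfolding suffix_beta_expansion
  using beta_map_funpow_range[of 1 k \<beta>] assms by (intro beta_expansion_mono) auto

text \<open>Decrementing the last nonzero digit of a finite expansion and repeating keeps every shift
  below the sequence: a proper shift becomes strictly smaller within its first period.\<close>

lemma omega_le_and_suffix_le:
  assumes \<beta>: "\<beta> > 1"
  shows "omega \<beta> n \<le> nat \<lfloor>\<beta>\<rfloor>" and "lex_le (suffix k (omega \<beta>)) (omega \<beta>)"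
proof -
  define \<eta> where "\<eta> = beta_expansion \<beta> 1"
  have \<eta>_le: "\<eta> i \<le> nat \<lfloor>\<beta>\<rfloor>" for i using beta_expansion_le[OF \<beta>] by (simp add: \<eta>_def)
  have \<eta>_suffix: "lex_le (suffix i \<eta>) \<eta>" for i
    using suffix_beta_expansion_1_le[OF \<beta>] by (simp add: \<eta>_def)
  have "omega \<beta> n \<le> nat \<lfloor>\<beta>\<rfloor> \<and> lex_le (suffix k (omega \<beta>)) (omega \<beta>)"
  proof (cases "\<exists>q. finite_expansion \<eta> q")
    case False
    then have "omega \<beta> = \<eta>" unfolding omega_def \<eta>_def[symmetric] by (simp only: Let_def if_False)
    then show ?thesis using \<eta>_le \<eta>_suffix by simp
  next
    case True
    then obtain q where q: "finite_expansion \<eta> q" by auto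
    have "(THE q. finite_expansion \<eta> q) = q"
    proof (rule the_equality[where P="finite_expansion \<eta>", OF q])
      fix r assume "finite_expansion \<eta> r"
      with q show "r = q" unfolding finite_expansion_def
        by (metis One_nat_def Suc_leI Suc_pred less_le_trans linorder_neqE_nat zero_less_one not_less_eq_eq)
    qed
    with True have om: "omega \<beta> = (\<lambda>n. if n mod q = q - 1 then \<eta> (q - 1) - 1 else \<eta> (n mod q))"
      by (simp add: omega_def \<eta>_def[symmetric] Let_def)
    have q1: "q \<ge> 1" and last: "\<eta> (q - 1) \<noteq> 0" and zero: "\<And>n. n \<ge> q \<Longrightarrow> \<eta> n = 0"
      using q by (auto simp: finite_expansion_def)
    have "omega \<beta> n \<le> nat \<lfloor>\<beta>\<rfloor>" for n
      using \<eta>_le[of "q - 1"] \<eta>_le[of "n mod q"] by (auto simp: om)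
    moreover have "lex_le (suffix k (omega \<beta>)) (omega \<beta>)"
    proof -
      have periodic: "omega \<beta> (n mod q) = omega \<beta> n" for n by (simp add: om)
      define m where "m = k mod q"
      have mq: "m < q" using q1 by (simp add: m_def)
      have sm: "suffix k (omega \<beta>) = suffix m (omega \<beta>)"
        by (rule ext) (metis m_def mod_add_left_eq periodic suffix_nth)
      have below: "omega \<beta> i = \<eta> i" if "i < q - 1" for i using that by (simp add: om)
      have om_last: "omega \<beta> (q - 1) = \<eta> (q - 1) - 1" using q1 by (simp add: om)
      show ?thesis
      proof (cases "m = 0")
        case False
        show ?thesis unfolding sm lex_le_iff
        proof (intro allI impI)
          fix n assume eq: "\<forall>i<n. suffix m (omega \<beta>) i = omega \<beta> i"
          have eq\<eta>: "suffix m \<eta> i = \<eta> i" if "i < n" "m + i < q - 1" for i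
            using eq that below[of i] below[of "m + i"] by auto
          show "suffix m (omega \<beta>) n \<le> omega \<beta> n"
          proof (cases "m + n < q - 1")
            case True
            then have "suffix m \<eta> n \<le> \<eta> n" using \<eta>_suffix eq\<eta> unfolding lex_le_iff by simp
            with True show ?thesis using below[of n] below[of "m + n"] by simp
          next
            case False
            define j where "j = q - 1 - m"
            have j: "m + j = q - 1" "j \<le> n" "j < q - 1" using False mq \<open>m \<noteq> 0\<close> by (auto simp: j_def)
            have "suffix m \<eta> i = \<eta> i" if "i < j" for i using eq\<eta>[of i] that j by auto
            then have "\<eta> (q - 1) \<le> \<eta> j" using \<eta>_suffix[of m] j unfolding lex_le_iff
              by (metis suffix_nth)
            then have "suffix m (omega \<beta>) j < omega \<beta> j"
              using j last om_last below[of j] by simp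
            with eq j(2) show ?thesis by (cases "j = n") auto
          qed
        qed
      qed (simp add: sm)
    qed
    ultimately show ?thesis by simp
  qed
  then show "omega \<beta> n \<le> nat \<lfloor>\<beta>\<rfloor>" and "lex_le (suffix k (omega \<beta>)) (omega \<beta>)" by auto
qed

section \<open>Full words and code words\<close>

text \<open>\<open>X\<close> is the \<open>\<beta>\<close>-shift, \<open>X0\<close> the part of it outside \<open>\<Gamma>\<close>, and \<open>om\<close> the sequence \<open>\<omega>\<close>.\<close>

locale beta_shift_space =
  fixes \<beta> :: real
  assumes beta_gt_1: "\<beta> > 1"
begin

abbreviation X :: "(nat \<Rightarrow> nat) set" where "X \<equiv> beta_shift \<beta>"
abbreviation X0 :: "(nat \<Rightarrow> nat) set" where "X0 \<equiv> beta_shift0 \<beta>"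
abbreviation om :: "nat \<Rightarrow> nat" where "om \<equiv> omega \<beta>"

lemma mem_X_iff: "x \<in> X \<longleftrightarrow> (\<forall>n. x n \<le> nat \<lfloor>\<beta>\<rfloor>) \<and> (\<forall>k. lex_le (suffix k x) om)"
  by (simp add: beta_shift_def shift_funpow)

lemma om_in_X: "om \<in> X"
  using omega_le_and_suffix_le[OF beta_gt_1] by (simp add: mem_X_iff)

lemma suffix_in_X: "x \<in> X \<Longrightarrow> suffix n x \<in> X"
  by (simp add: mem_X_iff)

lemma conc_in_X_D: "u \<frown> x \<in> X \<Longrightarrow> x \<in> X"
  using suffix_in_X[of "u \<frown> x" "length u"] by simp

lemma X_le_om: "x \<in> X \<Longrightarrow> lex_le x om"
  using mem_X_iff[of x] by (metis suffix_0)

lemma mem_X0_iff: "x \<in> X0 \<longleftrightarrow> x \<in> X \<and> (\<forall>n. suffix n x \<noteq> om)"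
  by (auto simp: beta_shift0_def Gamma_set_def shift_funpow)

lemma X0_subset_X: "X0 \<subseteq> X"
  by (auto simp: mem_X0_iff)

lemma suffix_in_X0: "x \<in> X0 \<Longrightarrow> suffix n x \<in> X0"
  by (simp add: mem_X0_iff suffix_in_X)

text \<open>A word \<open>u\<close> is full when the \<open>length u\<close>-th power of the shift maps the cylinder of \<open>u\<close> onto the
  whole space. The empty word is full.\<close>

definition full :: "nat list \<Rightarrow> bool" where
  "full u \<longleftrightarrow> (\<forall>y\<in>X. u \<frown> y \<in> X)"

text \<open>The code words are the nonempty full words without a shorter nonempty full prefix: the words
  that one step of the induced shift reads off.\<close>

definition code :: "nat list set" where
  "code = {w. w \<noteq> [] \<and> full w \<and> (\<forall>k. 0 < k \<and> k < length w \<longrightarrow> \<not> full (take k w))}"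

lemma full_Nil [simp]: "full []"
  by (simp add: full_def)

lemma full_append: "full u \<Longrightarrow> full v \<Longrightarrow> full (u @ v)"
  unfolding full_def by (metis conc_conc)

lemma full_appendD: "full (u @ v) \<Longrightarrow> full v"
  unfolding full_def by (metis conc_conc conc_in_X_D)

lemma full_concD: "full u \<Longrightarrow> y \<in> X \<Longrightarrow> u \<frown> y \<in> X"
  by (simp add: full_def)

lemma code_full: "w \<in> code \<Longrightarrow> full w"
  by (simp add: code_def)

lemma code_nonempty: "w \<in> code \<Longrightarrow> w \<noteq> []"
  by (simp add: code_def)

lemma full_code_prefix:
  assumes "full u" "u \<noteq> []"
  obtains w v where "u = w @ v" "w \<in> code" "full v"
proof -
  define k where "k = (LEAST k. 0 < k \<and> full (take k u))"
  have ex: "0 < length u \<and> full (take (length u) u)" using assms by simp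
  have k: "0 < k" "full (take k u)" using LeastI[of "\<lambda>k. 0 < k \<and> full (take k u)", OF ex]
    by (auto simp: k_def)
  have kl: "k \<le> length u" unfolding k_def by (rule Least_le) (use ex in simp)
  have "\<not> full (take j u)" if "0 < j" "j < k" for j
    using not_less_Least[of j "\<lambda>k. 0 < k \<and> full (take k u)"] that by (auto simp: k_def)
  then have "take k u \<in> code"
    using k kl assms(2) by (auto simp: code_def min_def)
  moreover have "full (drop k u)" using assms(1) full_appendD[of "take k u" "drop k u"] by simp
  ultimately show ?thesis using that[of "take k u" "drop k u"] by simp
qed

lemma full_induct [consumes 1, case_names Nil append]:
  assumes "full u" "P []" "\<And>w v. w \<in> code \<Longrightarrow> full v \<Longrightarrow> P v \<Longrightarrow> P (w @ v)"
  shows "P u"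
  using assms(1)
proof (induction u rule: length_induct)
  case (1 u)
  show ?case
  proof (cases "u = []")
    case False
    obtain w v where "u = w @ v" "w \<in> code" "full v" by (rule full_code_prefix[OF "1.prems" False])
    moreover from this have "length v < length u" using code_nonempty by fastforce
    ultimately show ?thesis using 1 assms(3) by blast
  qed (simp add: assms(2))
qed

lemma code_prefix_free:
  assumes "w \<in> code" "w' \<in> code" "w \<frown> x = w' \<frown> x'"
  shows "w = w'"
proof -
  have *: "v = v'" if "v \<in> code" "v' \<in> code" "v \<frown> y = v' \<frown> y'" "length v \<le> length v'" for v v' y y'
  proof -
    have "v = take (length v) v'"
      using that(3,4) prefix_conc_length[of v y] by (metis prefix_conc_fst)
    moreover have "\<not> length v < length v'"
      using that(1,2) calculation unfolding code_def by force
    ultimately show ?thesis using that(4) by simp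
  qed
  show ?thesis
    using *[OF assms] *[OF assms(2,1) assms(3)[symmetric]] by (metis nat_le_linear)
qed

text \<open>Lowering the last letter of a prefix of \<open>om\<close> makes the word full: every later shift of a point of
  its cylinder that starts inside the word is already smaller than \<open>om\<close> within the word.\<close>

lemma full_prefix_snoc:
  assumes "a < om n"
  shows "full (prefix n om @ [a])"
  unfolding full_def
proof
  fix y assume y: "y \<in> X"
  define x where "x = (prefix n om @ [a]) \<frown> y"
  have x_lt: "x i = om i" if "i < n" for i using that by (simp add: x_def nth_append)
  have x_n: "x n = a" by (simp add: x_def nth_append)
  have x_suffix: "suffix (Suc n) x = y" unfolding x_def
    by (metis length_append_singleton minus_nat.diff_0 subsequence_length suffix_conc_length)
  have "x i \<le> nat \<lfloor>\<beta>\<rfloor>" for i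
  proof (cases i n rule: linorder_cases)
    case greater
    then have "x i = y (i - Suc n)" using x_suffix by (metis Suc_leI le_add_diff_inverse suffix_nth)
    then show ?thesis using y by (simp add: mem_X_iff)
  qed (use assms omega_le_and_suffix_le(1)[OF beta_gt_1] x_lt x_n in
       \<open>auto intro: order.trans[OF less_imp_le]\<close>)
  moreover have "lex_le (suffix k x) om" for k
  proof (cases "k \<le> n")
    case True
    show ?thesis unfolding lex_le_iff
    proof (intro allI impI)
      fix j assume eq: "\<forall>i<j. suffix k x i = om i"
      have om_k: "lex_le (suffix k om) om" using om_in_X by (simp add: mem_X_iff)
      have le: "om (k + i) \<le> om i" if "i \<le> j" "k + i \<le> n" for i
      proof -
        have "suffix k om i' = om i'" if "i' < i" for i'
          using eq[rule_format, of i'] x_lt[of "k + i'"] that \<open>i \<le> j\<close> \<open>k + i \<le> n\<close> by simp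
        then have "suffix k om i \<le> om i" using om_k unfolding lex_le_iff by blast
        then show ?thesis by simp
      qed
      show "suffix k x j \<le> om j"
      proof (cases "k + j" n rule: linorder_cases)
        case less then show ?thesis using le[of j] x_lt by simp
      next
        case equal then show ?thesis using le[of j] x_n assms by simp
      next
        case greater
        then have "suffix k x (n - k) = om (n - k)" using eq[rule_format, of "n - k"] True by simp
        moreover have "om n \<le> om (n - k)" using le[of "n - k"] greater True by simp
        ultimately show ?thesis using True x_n assms by simp
      qed
    qed
  next
    case False
    then have "suffix k x = suffix (k - Suc n) y" using x_suffix
      by (metis Suc_leI le_add_diff_inverse not_le suffix_suffix)
    then show ?thesis using y by (simp add: mem_X_iff)
  qed
  ultimately show "(prefix n om @ [a]) \<frown> y \<in> X" by (simp add: mem_X_iff x_def)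
qed

lemma ex_full_prefix:
  assumes "x \<in> X" "x \<noteq> om"
  obtains n where "prefix n x = prefix n om" "x n < om n" "full (prefix (Suc n) x)"
proof -
  obtain n where n: "\<And>i. i < n \<Longrightarrow> x i = om i" "x n \<noteq> om n"
    using ex_first_difference[OF assms(2)] by blast
  have "x n < om n" using X_le_om[OF assms(1)] n unfolding lex_le_iff by (metis nat_less_le)
  moreover have "prefix n x = prefix n om" using n by (auto intro: nth_equalityI)
  ultimately show ?thesis using that[of n] full_prefix_snoc[of "x n" n] by simp
qed

text \<open>So \<open>om\<close> has a nonempty full prefix only if it is purely periodic.\<close>

lemma full_prefix_om_iff: "full (prefix n om) \<longleftrightarrow> suffix n om = om"
proof
  assume "full (prefix n om)"
  then have "prefix n om \<frown> om \<in> X" using om_in_X by (simp add: full_def)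
  then have "lex_le (prefix n om \<frown> om) (prefix n om \<frown> suffix n om)"
    using X_le_om by (metis prefix_suffix)
  then have "lex_le om (suffix n om)" by (simp only: lex_le_conc_iff)
  moreover have "lex_le (suffix n om) om" using om_in_X by (simp add: mem_X_iff)
  ultimately show "suffix n om = om" using lex_le_antisym by blast
next
  assume eq: "suffix n om = om"
  show "full (prefix n om)" unfolding full_def
  proof
    fix y assume y: "y \<in> X"
    define x where "x = prefix n om \<frown> y"
    have "x i \<le> nat \<lfloor>\<beta>\<rfloor>" for i
      using y om_in_X by (cases "i < n") (auto simp: mem_X_iff x_def)
    moreover have "lex_le (suffix k x) om" for k
    proof (cases "k \<le> n")
      case True
      have "suffix k x = om [k \<rightarrow> n] \<frown> y" using True by (simp add: x_def)
      moreover have "lex_le (om [k \<rightarrow> n] \<frown> y) (om [k \<rightarrow> n] \<frown> om)" using X_le_om[OF y] by simp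
      moreover have "om [k \<rightarrow> n] \<frown> om = suffix k om" using eq True
        by (metis suffix_subseq_join)
      ultimately show ?thesis using om_in_X lex_le_trans by (metis mem_X_iff)
    next
      case False
      then show ?thesis using y by (simp add: x_def mem_X_iff)
    qed
    ultimately show "prefix n om \<frown> y \<in> X" by (simp add: mem_X_iff x_def)
  qed
qed

lemma full_conc_eq_om:
  assumes "full v" "y \<in> X" "v \<frown> y = om"
  shows "y = om"
proof -
  have "prefix (length v) om = v" using assms(3) by (metis prefix_conc_length)
  then have "suffix (length v) om = om" using assms(1) full_prefix_om_iff by metis
  then show ?thesis using assms(3) by (metis suffix_conc_length)
qed

lemma conc_in_X0:
  assumes "full u" "y \<in> X0"
  shows "u \<frown> y \<in> X0"
proof -
  have "suffix n (u \<frown> y) \<noteq> om" for n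
  proof (cases "n \<le> length u")
    case True
    have "full (drop n u)" using assms(1) full_appendD[of "take n u" "drop n u"] by simp
    then show ?thesis using full_conc_eq_om[of "drop n u" y] assms(2) True
      by (metis mem_X0_iff suffix_0 suffix_conc_fst)
  next
    case False then show ?thesis using assms(2) by (simp add: mem_X0_iff)
  qed
  then show ?thesis using assms full_concD by (simp add: mem_X0_iff)
qed

lemma ex_code_prefix:
  assumes "x \<in> X" "x \<noteq> om"
  obtains w y where "w \<in> code" "y \<in> X" "x = w \<frown> y"
proof -
  obtain n where "full (prefix (Suc n) x)" using ex_full_prefix[OF assms] by blast
  then obtain w v where wv: "prefix (Suc n) x = w @ v" "w \<in> code"
    using full_code_prefix by (metis nat.simps(3) le_zero_eq subsequence_empty)
  have "x = w \<frown> (v \<frown> suffix (Suc n) x)" using wv(1) by (metis conc_conc prefix_suffix)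
  with wv(2) assms(1) show ?thesis using that conc_in_X_D by metis
qed

lemma X0_code_prefix:
  assumes "x \<in> X0"
  obtains w y where "w \<in> code" "y \<in> X0" "x = w \<frown> y"
proof -
  have "x \<in> X" "x \<noteq> om" using assms by (auto simp: mem_X0_iff dest: spec[of _ 0])
  then obtain w y where "w \<in> code" "x = w \<frown> y" by (rule ex_code_prefix)
  moreover from this have "y \<in> X0" using suffix_in_X0[OF assms, of "length w"] by simp
  ultimately show ?thesis using that by blast
qed

lemma X0_long_full_prefix:
  assumes "x \<in> X0"
  shows "\<exists>m\<ge>n. full (prefix m x)"
proof (induction n)
  case (Suc n)
  then obtain m where m: "m \<ge> n" "full (prefix m x)" by blast
  obtain w y where w: "w \<in> code" "suffix m x = w \<frown> y"
    using X0_code_prefix[OF suffix_in_X0[OF assms]] by metis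
  have "prefix m x @ w = prefix (m + length w) x"
    using w(2) by (metis prefix_suffix conc_conc length_append prefix_conc_length subsequence_length minus_nat.diff_0)
  then have "full (prefix (m + length w) x)" using full_append[OF m(2) code_full[OF w(1)]] by simp
  moreover have "m + length w \<ge> Suc n" using m(1) code_nonempty[OF w(1)] by (cases w) auto
  ultimately show ?case by blast
qed (auto intro!: exI[of _ 0])

text \<open>All letters of a code word but the last follow \<open>om\<close>; the last one is either smaller than
  the letter of \<open>om\<close>, or it completes a period.\<close>

lemma code_cases:
  assumes "w \<in> code"
  obtains (lower) n a where "w = prefix n om @ [a]" "a < om n"
  | (period) "w = prefix (length w) om" "suffix (length w) om = om"
proof (cases "w = prefix (length w) om")
  case True
  then show ?thesis using period code_full[OF assms] full_prefix_om_iff by metis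
next
  case False
  define x where "x = w \<frown> om"
  have "x \<in> X" "x \<noteq> om"
    using False full_concD[OF code_full[OF assms] om_in_X] unfolding x_def
    by (metis prefix_conc_length)+
  then obtain n where n: "prefix n x = prefix n om" "x n < om n" "full (prefix (Suc n) x)"
    by (rule ex_full_prefix)
  have nl: "n < length w"
  proof (rule ccontr)
    assume "\<not> n < length w"
    then have "prefix (length w) x = prefix (length w) om"
      using n(1) by (metis linorder_not_less min.absorb1 add_0 subsequence_take)
    with False show False by (simp add: x_def)
  qed
  have "\<not> Suc n < length w"
  proof
    assume less: "Suc n < length w"
    have "prefix (Suc n) x = take (Suc n) w" unfolding x_def using less by (intro prefix_conc_fst) simp
    then have "full (take (Suc n) w)" using n(3) by simp
    with less assms show False unfolding code_def by blast
  qed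
  then have "length w = Suc n" using nl by simp
  then have "w = prefix n om @ [x n]" using n(1) prefix_conc_length[of w om] by (metis x_def subseq_to_Suc le0)
  then show ?thesis using lower n(2) by blast
qed

lemma snoc_in_code:
  assumes "a < om n" "\<And>k. 0 < k \<Longrightarrow> k \<le> n \<Longrightarrow> \<not> full (prefix k om)"
  shows "prefix n om @ [a] \<in> code"
  using assms full_prefix_snoc[of a n] by (auto simp: code_def)

end

section \<open>The normalising constant\<close>

text \<open>\<open>XJ\<close> and \<open>X0J\<close> are the parts of \<open>X\<close> and \<open>X0\<close> that consist of sequences over the alphabet \<open>J\<close>.\<close>

locale weighted_beta_shift = beta_shift_space \<beta> for \<beta> :: real +
  fixes J :: "nat set" and H :: "nat \<Rightarrow> real"
  assumes J_subset: "J \<subseteq> {0..nat \<lfloor>\<beta>\<rfloor>}"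
    and infinite_X0J: "infinite (beta_shift0_on \<beta> J)"
    and H_pos: "\<And>j. j \<in> J \<Longrightarrow> H j > 0"
begin

abbreviation XJ :: "(nat \<Rightarrow> nat) set" where "XJ \<equiv> beta_shift_on \<beta> J"
abbreviation X0J :: "(nat \<Rightarrow> nat) set" where "X0J \<equiv> beta_shift0_on \<beta> J"

text \<open>The code words over the alphabet \<open>J\<close>.\<close>

definition codeJ :: "nat list set" where
  "codeJ = code \<inter> lists J"

text \<open>The mass that a conformal measure with constant \<open>c\<close> gives to the cylinder of a full word over
  \<open>J\<close>.\<close>

definition wt :: "real \<Rightarrow> nat list \<Rightarrow> real" where
  "wt c u = prod_list (map (\<lambda>a. c * H a) u)"

lemma finite_J [simp]: "finite J"
  using J_subset finite_subset by blast

lemma mem_XJ_iff: "x \<in> XJ \<longleftrightarrow> x \<in> X \<and> range x \<subseteq> J"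
  by (auto simp: beta_shift_on_def)

lemma mem_X0J_iff: "x \<in> X0J \<longleftrightarrow> x \<in> X0 \<and> range x \<subseteq> J"
  by (auto simp: beta_shift0_on_def)

lemma X0J_subset_XJ: "X0J \<subseteq> XJ"
  using X0_subset_X by (auto simp: mem_XJ_iff mem_X0J_iff)

lemma conc_in_XJ: "full u \<Longrightarrow> u \<in> lists J \<Longrightarrow> y \<in> XJ \<Longrightarrow> u \<frown> y \<in> XJ"
  by (auto simp: mem_XJ_iff full_concD)

lemma conc_in_XJ_D: "u \<frown> y \<in> XJ \<Longrightarrow> u \<in> lists J \<and> y \<in> XJ"
  by (auto simp: mem_XJ_iff conc_in_X_D)

lemma codeJ_D: "w \<in> codeJ \<Longrightarrow> w \<in> code \<and> w \<in> lists J \<and> full w \<and> w \<noteq> []"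
  by (auto simp: codeJ_def code_full code_nonempty)

lemma X0J_nonempty: "X0J \<noteq> {}"
  using infinite_X0J by auto

lemma X0J_code_prefix:
  assumes "x \<in> X0J"
  obtains w y where "w \<in> codeJ" "y \<in> X0J" "x = w \<frown> y"
proof -
  have "x \<in> X0" using assms by (simp add: mem_X0J_iff)
  then obtain w y where "w \<in> code" "y \<in> X0" "x = w \<frown> y" by (rule X0_code_prefix)
  with assms that show ?thesis by (auto simp: mem_X0J_iff codeJ_def)
qed

lemma countable_codeJ [simp]: "countable codeJ"
  by simp

text \<open>With a single code word \<open>w\<close> over \<open>J\<close>, the only point of \<open>X0J\<close> would be the periodic sequence of
  period \<open>w\<close>.\<close>

lemma codeJ_two_elements: "\<exists>v\<in>codeJ. \<exists>w\<in>codeJ. v \<noteq> w"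
proof (rule ccontr)
  assume one: "\<not> ?thesis"
  have "x n = y n" if "x \<in> X0J" "y \<in> X0J" for x y n
    using that
  proof (induction n arbitrary: x y rule: less_induct)
    case (less n)
    obtain w x' where x: "w \<in> codeJ" "x' \<in> X0J" "x = w \<frown> x'" by (rule X0J_code_prefix[OF less.prems(1)])
    obtain w' y' where y: "w' \<in> codeJ" "y' \<in> X0J" "y = w' \<frown> y'" by (rule X0J_code_prefix[OF less.prems(2)])
    have "w = w'" using one x(1) y(1) by blast
    moreover have "n - length w < n" if "\<not> n < length w"
      using codeJ_D[OF x(1)] that by (cases w) auto
    ultimately show ?case using less.IH[of "n - length w" x' y'] x y by (cases "n < length w") auto
  qed
  note eq = this
  obtain z where z: "z \<in> X0J" using X0J_nonempty by blast
  have "X0J \<subseteq> {z}"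
  proof
    fix x assume "x \<in> X0J"
    then have "x = z" using eq z by (intro ext)
    then show "x \<in> {z}" by simp
  qed
  then show False using infinite_X0J finite_subset by blast
qed

lemma wt_Nil [simp]: "wt c [] = 1"
  by (simp add: wt_def)

lemma wt_Cons [simp]: "wt c (a # u) = c * H a * wt c u"
  by (simp add: wt_def)

lemma wt_append [simp]: "wt c (u @ v) = wt c u * wt c v"
  by (simp add: wt_def)

lemma wt_mset: "mset u = mset v \<Longrightarrow> wt c u = wt c v"
  unfolding wt_def by (metis mset_map prod_mset_prod_list)

lemma wt_pos: "c > 0 \<Longrightarrow> u \<in> lists J \<Longrightarrow> wt c u > 0"
  by (induction u) (auto simp: H_pos)

lemma wt_power: "wt c u = c ^ length u * wt 1 u"
  by (induction u) auto

lemma wt_nonneg: "c \<ge> 0 \<Longrightarrow> u \<in> lists J \<Longrightarrow> wt c u \<ge> 0"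
  by (subst wt_power) (simp add: less_imp_le wt_pos)

lemma wt_mono: "0 \<le> c \<Longrightarrow> c \<le> d \<Longrightarrow> u \<in> lists J \<Longrightarrow> wt c u \<le> wt d u"
  by (subst (1 2) wt_power) (auto intro!: mult_right_mono power_mono less_imp_le[OF wt_pos])

lemma wt_strict_mono: "0 < c \<Longrightarrow> c < d \<Longrightarrow> u \<in> lists J \<Longrightarrow> u \<noteq> [] \<Longrightarrow> wt c u < wt d u"
  by (subst (1 2) wt_power) (auto intro!: mult_strict_right_mono power_strict_mono wt_pos)

text \<open>The total weight of the code is continuous where it is finite, so it takes the value 1 as soon
  as it takes a finite value that is at least 1.\<close>

lemma ex_total_weight_1_of_ge_1:
  assumes "c\<^sub>1 > 0"
    and fin: "(\<integral>\<^sup>+w. wt c\<^sub>1 w \<partial>count_space codeJ) < \<infinity>"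
    and ge: "1 \<le> (\<integral>\<^sup>+w. wt c\<^sub>1 w \<partial>count_space codeJ)"
  shows "\<exists>c>0. (\<integral>\<^sup>+w. wt c w \<partial>count_space codeJ) = 1"
proof -
  let ?M = "count_space codeJ"
  define f where "f c = (\<integral>w. wt c w \<partial>?M)" for c
  have J: "w \<in> lists J" if "w \<in> codeJ" for w using that by (simp add: codeJ_def)
  have int1: "integrable ?M (wt c\<^sub>1)"
    using fin assms(1) by (intro integrableI_nonneg) (auto simp: AE_count_space wt_nonneg J)
  have bound: "norm (wt c w) \<le> wt c\<^sub>1 w" if "c \<in> {0..c\<^sub>1}" "w \<in> codeJ" for c w
    using that by (simp add: wt_mono wt_nonneg J)
  have int: "integrable ?M (wt c)" if "c \<in> {0..c\<^sub>1}" for c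
    by (rule Bochner_Integration.integrable_bound[OF int1])
      (use bound[OF that] in \<open>auto simp: AE_count_space intro: order.trans[OF _ abs_ge_self]\<close>)
  have nn: "(\<integral>\<^sup>+w. wt c w \<partial>?M) = ennreal (f c)" if "c \<in> {0..c\<^sub>1}" for c
    unfolding f_def using that by (intro nn_integral_eq_integral int) (auto simp: AE_count_space wt_nonneg J)
  have "continuous_on {0..c\<^sub>1} f"
    unfolding continuous_on_sequentially
  proof (intro ballI allI impI)
    fix s :: "nat \<Rightarrow> real" and a assume a: "a \<in> {0..c\<^sub>1}" and s: "(\<forall>n. s n \<in> {0..c\<^sub>1}) \<and> s \<longlonglongrightarrow> a"
    have lim: "(\<lambda>i. wt (s i) w) \<longlonglongrightarrow> wt a w" for w
      using s by (subst (1 2) wt_power) (auto intro!: tendsto_intros)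
    have "(\<lambda>i. \<integral>w. wt (s i) w \<partial>?M) \<longlonglongrightarrow> (\<integral>w. wt a w \<partial>?M)"
      by (rule integral_dominated_convergence[OF _ _ int1]) (use s bound lim in \<open>auto simp: AE_count_space\<close>)
    then show "(f \<circ> s) \<longlonglongrightarrow> f a" by (simp add: f_def comp_def)
  qed
  moreover have "f 0 = 0"
  proof -
    have "wt 0 w = 0" if "w \<in> codeJ" for w using codeJ_D[OF that] by (cases w) auto
    then show ?thesis unfolding f_def by (intro integral_eq_zero_AE) (auto simp: AE_count_space)
  qed
  moreover have "1 \<le> f c\<^sub>1" using ge nn[of c\<^sub>1] assms(1) by simp
  ultimately obtain c where c: "0 \<le> c" "c \<le> c\<^sub>1" "f c = 1"
    using IVT'[of f 0 1 c\<^sub>1] assms(1) by auto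
  then have "c \<noteq> 0" using \<open>f 0 = 0\<close> by auto
  with c nn[of c] show ?thesis by (intro exI[of _ c]) auto
qed

lemma ex_total_weight_1_finite:
  assumes "finite codeJ"
  shows "\<exists>c>0. (\<integral>\<^sup>+w. wt c w \<partial>count_space codeJ) = 1"
proof -
  obtain w where w: "w \<in> codeJ" using codeJ_two_elements by blast
  define c where "c = max 1 (1 / wt 1 w)"
  have w1: "wt 1 w > 0" using codeJ_D[OF w] by (simp add: wt_pos)
  have "c \<le> c ^ length w" using codeJ_D[OF w] by (intro self_le_power) (auto simp: c_def)
  then have "c * wt 1 w \<le> wt c w" using w1 by (subst (2) wt_power) simp
  moreover have "1 \<le> c * wt 1 w" using w1 by (simp add: c_def max_def field_simps)
  ultimately have "1 \<le> wt c w" by simp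
  also have "\<dots> \<le> (\<Sum>v\<in>codeJ. wt c v)"
    using assms w by (intro member_le_sum) (auto simp: c_def codeJ_def intro!: wt_nonneg)
  finally have "ennreal 1 \<le> ennreal (\<Sum>v\<in>codeJ. wt c v)" by (rule ennreal_leI)
  also have "ennreal (\<Sum>v\<in>codeJ. wt c v) = (\<integral>\<^sup>+w. wt c w \<partial>count_space codeJ)"
    using assms by (subst nn_integral_count_space_finite)
      (auto simp: c_def codeJ_def intro!: wt_nonneg sum_ennreal[symmetric])
  finally have "1 \<le> (\<integral>\<^sup>+w. wt c w \<partial>count_space codeJ)" by simp
  moreover have "(\<integral>\<^sup>+w. wt c w \<partial>count_space codeJ) < \<infinity>"
    using assms by (simp add: nn_integral_count_space_finite)
  ultimately show ?thesis by (intro ex_total_weight_1_of_ge_1[of c]) (auto simp: c_def)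
qed

end

text \<open>If there are infinitely many code words over \<open>J\<close>, then \<open>om\<close> is a sequence over \<open>J\<close> that is not
  periodic, and the code words are the prefixes of \<open>om\<close> with the last letter lowered.\<close>

locale infinite_code = weighted_beta_shift +
  assumes infinite_codeJ: "infinite codeJ"
begin

lemma finite_bounded_codeJ: "finite {w\<in>codeJ. length w \<le> n}"
  by (rule finite_subset[OF _ finite_lists_length_le[OF finite_J, of n]]) (auto simp: codeJ_def)

lemma not_full_prefix_om:
  assumes "k > 0"
  shows "\<not> full (prefix k om)"
proof
  assume full: "full (prefix k om)"
  have "length w \<le> k" if "w \<in> code" for w
  proof (rule ccontr)
    assume long: "\<not> length w \<le> k"
    have "take k w = prefix k om"
      using that
    proof (cases rule: code_cases)
      case (lower n a)
      with long show ?thesis by (simp add: min_def)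
    next
      case period
      then have "take k w = take k (prefix (length w) om)" by simp
      with long show ?thesis by (simp add: min_def)
    qed
    with full long assms that show False unfolding code_def by force
  qed
  then have "codeJ \<subseteq> {w\<in>codeJ. length w \<le> k}" by (auto simp: codeJ_def)
  then show False using infinite_codeJ finite_bounded_codeJ finite_subset by blast
qed

lemma codeJ_cases:
  assumes "w \<in> codeJ"
  obtains n a where "w = prefix n om @ [a]" "a < om n" "a \<in> J" "\<And>i. i < n \<Longrightarrow> om i \<in> J"
proof -
  have "w \<in> code" using assms by (simp add: codeJ_def)
  then show ?thesis
  proof (cases rule: code_cases)
    case (lower n a)
    with assms show ?thesis by (intro that[of n a]) (auto simp: codeJ_def)
  next
    case period
    then have "full (prefix (length w) om)" using full_prefix_om_iff by blast
    with not_full_prefix_om[of "length w"] codeJ_D[OF assms] show ?thesis by simp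
  qed
qed

lemma om_in_J: "om m \<in> J"
proof (rule ccontr)
  assume m: "om m \<notin> J"
  have "length w \<le> Suc m" if w: "w \<in> codeJ" for w
  proof -
    obtain n a where "w = prefix n om @ [a]" "\<And>i. i < n \<Longrightarrow> om i \<in> J" using codeJ_cases[OF w] by metis
    with m show ?thesis by (metis Suc_leI length_append_singleton linorder_not_less minus_nat.diff_0 not_less_eq subsequence_length)
  qed
  then have "codeJ \<subseteq> {w\<in>codeJ. length w \<le> Suc m}" by auto
  then show False using infinite_codeJ finite_bounded_codeJ finite_subset by blast
qed

lemma prefix_om_in_J: "prefix n om \<in> lists J"
  using om_in_J by auto

lemma bij_betw_codeJ:
  "bij_betw (\<lambda>(n, a). prefix n om @ [a]) (SIGMA n:UNIV. {a\<in>J. a < om n}) codeJ"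
  unfolding bij_betw_def
proof
  show "inj_on (\<lambda>(n, a). prefix n om @ [a]) (SIGMA n:UNIV. {a\<in>J. a < om n})"
    by (rule inj_onI) (auto dest: arg_cong[where f=length])
  show "(\<lambda>(n, a). prefix n om @ [a]) ` (SIGMA n:UNIV. {a\<in>J. a < om n}) = codeJ"
    using snoc_in_code not_full_prefix_om om_in_J
    by (auto simp: codeJ_def image_iff elim!: codeJ_cases[unfolded codeJ_def, OF IntI])
qed

text \<open>The weight of the code words of length \<open>n + 1\<close>.\<close>

definition layer :: "real \<Rightarrow> nat \<Rightarrow> real" where
  "layer c n = wt c (prefix n om) * (\<Sum>a\<in>{a\<in>J. a < om n}. c * H a)"

lemma layer_nonneg: "c \<ge> 0 \<Longrightarrow> layer c n \<ge> 0"
  unfolding layer_def using prefix_om_in_J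
  by (intro mult_nonneg_nonneg wt_nonneg sum_nonneg) (auto intro: less_imp_le H_pos)

lemma layer_scale: "layer (s * c) n = s ^ Suc n * layer c n"
proof -
  have "wt (s * c) u = s ^ length u * wt c u" for u
    by (subst (1 2) wt_power) (simp add: power_mult_distrib)
  then show ?thesis by (simp add: layer_def sum_distrib_left mult_ac)
qed

lemma total_weight_eq_suminf:
  assumes "c \<ge> 0"
  shows "(\<integral>\<^sup>+w. wt c w \<partial>count_space codeJ) = (\<Sum>n. ennreal (layer c n))"
proof -
  let ?S = "SIGMA n:UNIV. {a\<in>J. a < om n}"
  let ?g = "\<lambda>(n, a). prefix n om @ [a]"
  have "(\<integral>\<^sup>+w. wt c w \<partial>count_space codeJ) = (\<integral>\<^sup>+z. wt c (?g z) \<partial>count_space ?S)"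
    by (rule nn_integral_bij_count_space[OF bij_betw_codeJ, symmetric])
  also have "\<dots> = (\<integral>\<^sup>+z. ennreal (wt c (?g z)) * indicator ?S z \<partial>count_space UNIV)"
    by (subst nn_integral_count_space_indicator) auto
  also have "\<dots> = (\<integral>\<^sup>+n. \<integral>\<^sup>+a. ennreal (wt c (?g (n, a))) * indicator ?S (n, a) \<partial>count_space UNIV \<partial>count_space UNIV)"
    by (rule nn_integral_fst_count_space[symmetric])
  also have "\<dots> = (\<Sum>n. \<integral>\<^sup>+a. ennreal (wt c (?g (n, a))) * indicator ?S (n, a) \<partial>count_space UNIV)"
    by (rule nn_integral_count_space_nat)
  also have "\<dots> = (\<Sum>n. ennreal (layer c n))"
  proof (rule suminf_cong)
    fix n
    have "(\<integral>\<^sup>+a. ennreal (wt c (?g (n, a))) * indicator ?S (n, a) \<partial>count_space UNIV) =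
        (\<integral>\<^sup>+a. ennreal (wt c (?g (n, a))) * indicator {a\<in>J. a < om n} a \<partial>count_space UNIV)"
      by (intro nn_integral_cong) (auto split: split_indicator)
    also have "\<dots> = (\<integral>\<^sup>+a. wt c (?g (n, a)) \<partial>count_space {a\<in>J. a < om n})"
      by (subst nn_integral_count_space_indicator) auto
    also have "\<dots> = (\<Sum>a\<in>{a\<in>J. a < om n}. ennreal (wt c (?g (n, a))))"
      by (rule nn_integral_count_space_finite) simp
    also have "\<dots> = ennreal (\<Sum>a\<in>{a\<in>J. a < om n}. wt c (?g (n, a)))"
      by (rule sum_ennreal) (use om_in_J assms in \<open>auto intro!: wt_nonneg mult_nonneg_nonneg simp: less_imp_le H_pos\<close>)
    also have "(\<Sum>a\<in>{a\<in>J. a < om n}. wt c (?g (n, a))) = layer c n"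
      by (simp add: layer_def sum_distrib_left)
    finally show "(\<integral>\<^sup>+a. ennreal (wt c (?g (n, a))) * indicator ?S (n, a) \<partial>count_space UNIV) = ennreal (layer c n)" .
  qed
  finally show ?thesis .
qed

text \<open>The letter to which the letters of a word are lowered below.\<close>

definition least_letter :: nat where "least_letter = Min J"

lemma J_nonempty: "J \<noteq> {}"
  using om_in_J by blast

lemma least_letter_in_J: "least_letter \<in> J"
  unfolding least_letter_def using J_nonempty by simp

lemma least_letter_le: "a \<in> J \<Longrightarrow> least_letter \<le> a"
  unfolding least_letter_def by simp

lemma least_letter_less_om_0: "least_letter < om 0"
proof (rule ccontr)
  assume "\<not> least_letter < om 0"
  then have om0: "om 0 = least_letter" using least_letter_le[OF om_in_J[of 0]] by simp
  have "om n = least_letter" for n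
  proof -
    have "lex_le (suffix n om) om" using om_in_X by (simp add: mem_X_iff)
    then have "om n \<le> om 0" unfolding lex_le_iff by (metis add_0_right not_less_zero suffix_nth)
    then show ?thesis using om0 least_letter_le[OF om_in_J[of n]] by simp
  qed
  then have "suffix 1 om = om" by (intro ext) simp
  then show False using not_full_prefix_om[OF zero_less_one] full_prefix_om_iff by blast
qed

text \<open>Lowering any set of letters of a point of \<open>XJ\<close> to the least letter of \<open>J\<close> gives a point of \<open>XJ\<close>
  again. \<open>lowered c y n\<close> is the total weight of all words that arise in this way from the first \<open>n\<close>
  letters of \<open>y\<close>, written as a product over the positions.\<close>

definition lowered :: "real \<Rightarrow> (nat \<Rightarrow> nat) \<Rightarrow> nat \<Rightarrow> real" where
  "lowered c y n = (\<Prod>i<n. c * H (y i) + (if least_letter < y i then c * H least_letter else 0))"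

lemma lowered_0 [simp]: "lowered c y 0 = 1"
  by (simp add: lowered_def)

lemma lowered_Suc:
  "lowered c y (Suc n) =
     (c * H (y 0) + (if least_letter < y 0 then c * H least_letter else 0)) * lowered c (suffix 1 y) n"
  unfolding lowered_def by (subst prod.lessThan_Suc_shift) simp

lemma lowered_nonneg:
  assumes "c \<ge> 0" "range y \<subseteq> J"
  shows "lowered c y n \<ge> 0"
proof -
  have "0 \<le> H (y i)" "0 \<le> H least_letter" for i
    using assms(2) by (auto intro!: less_imp_le[OF H_pos] least_letter_in_J)
  then show ?thesis unfolding lowered_def using assms(1) by (intro prod_nonneg) auto
qed

text \<open>Splitting according to the first lowered position among the first \<open>k\<close> ones.\<close>

lemma lowered_split:
  assumes "k \<le> n"
  shows "lowered c y n =
    (\<Sum>i<k. wt c (prefix i y) * (if least_letter < y i then c * H least_letter else 0) *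
      lowered c (suffix (Suc i) y) (n - Suc i)) + wt c (prefix k y) * lowered c (suffix k y) (n - k)"
  using assms
proof (induction k)
  case (Suc k)
  then have "n - k = Suc (n - Suc k)" by simp
  then have "lowered c (suffix k y) (n - k) =
      (c * H (y k) + (if least_letter < y k then c * H least_letter else 0)) * lowered c (suffix (Suc k) y) (n - Suc k)"
    using lowered_Suc[of c "suffix k y" "n - Suc k"] by simp
  then have step: "wt c (prefix k y) * lowered c (suffix k y) (n - k) =
      wt c (prefix k y) * (if least_letter < y k then c * H least_letter else 0) *
        lowered c (suffix (Suc k) y) (n - Suc k) +
      wt c (prefix (Suc k) y) * lowered c (suffix (Suc k) y) (n - Suc k)"
    by (simp only:) (simp add: distrib_left distrib_right mult.assoc)
  have "lowered c y n = (\<Sum>i<k. wt c (prefix i y) * (if least_letter < y i then c * H least_letter else 0) *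
      lowered c (suffix (Suc i) y) (n - Suc i)) + wt c (prefix k y) * lowered c (suffix k y) (n - k)"
    by (rule Suc.IH) (use Suc.prems in simp)
  then show ?case unfolding step by (simp only: sum.lessThan_Suc add.assoc)
qed simp

text \<open>The renewal argument. A word that starts with \<open>i\<close> letters of \<open>om\<close> and then has a smaller letter,
  lowered or not, begins with a code word of length \<open>i + 1\<close>; what follows is a word of the same
  kind. So a bound \<open>C\<close> for shorter words gives the bound \<open>F * C\<close> for these words, \<open>F\<close> being the total
  weight of the code, and only the unchanged prefix of \<open>om\<close> is left, whose weight is at most \<open>M\<close>. The
  constant \<open>C\<close> solves \<open>F * C + M = C\<close>.\<close>

lemma lowered_le:
  assumes c: "c > 0" and summable: "summable (layer c)" and F: "(\<Sum>n. layer c n) < 1"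
    and M: "\<And>n. wt c (prefix n om) \<le> M" and "y \<in> XJ"
  shows "lowered c y n \<le> M / (1 - (\<Sum>n. layer c n))"
  using \<open>y \<in> XJ\<close>
proof (induction n arbitrary: y rule: less_induct)
  case (less n)
  let ?F = "\<Sum>n. layer c n"
  define C where "C = M / (1 - ?F)"
  have M1: "M \<ge> 1" using M[of 0] by simp
  have C0: "C \<ge> 0" using M1 F by (simp add: C_def)
  have C_eq: "?F * C + M = C" using F by (simp add: C_def field_simps)
  have y: "y \<in> X" "range y \<subseteq> J" using less.prems by (auto simp: mem_XJ_iff)
  have partial: "(\<Sum>i<k. layer c i) \<le> ?F" for k
    using sum_le_suminf[OF summable, of "{..<k}"] layer_nonneg c by auto
  have IH: "lowered c (suffix (Suc i) y) (n - Suc i) \<le> C" if "i < n" for i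
  proof -
    have "suffix (Suc i) y \<in> XJ" using y by (auto simp: mem_XJ_iff suffix_in_X)
    moreover have "n - Suc i < n" using that by simp
    ultimately show ?thesis using less.IH unfolding C_def by blast
  qed
  have H0: "H a > 0" if "a \<in> J" for a using that by (rule H_pos)
  have layer_ge: "wt c (prefix i om) * (\<Sum>a\<in>A. c * H a) \<le> layer c i"
    if "A \<subseteq> {a\<in>J. a < om i}" for A i
    unfolding layer_def using that c H0 prefix_om_in_J
    by (intro mult_left_mono sum_mono2 wt_nonneg) (auto intro: less_imp_le)
  have head: "(\<Sum>i<k. wt c (prefix i y) * (if least_letter < y i then c * H least_letter else 0) *
      lowered c (suffix (Suc i) y) (n - Suc i)) \<le> (\<Sum>i<k. layer c i) * C"
    if "k \<le> n" and eq: "\<And>i. i < k \<Longrightarrow> y i = om i" for k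
    unfolding sum_distrib_right
  proof (intro sum_mono mult_mono)
    fix i assume "i \<in> {..<k}"
    then have i: "i < k" by simp
    then have "prefix i y = prefix i om" using eq by (auto intro: nth_equalityI)
    moreover have "least_letter \<in> J" by (rule least_letter_in_J)
    ultimately show "wt c (prefix i y) * (if least_letter < y i then c * H least_letter else 0) \<le> layer c i"
      using layer_ge[of "{least_letter}" i] layer_nonneg[of c i] eq[OF i] c by auto
    show "lowered c (suffix (Suc i) y) (n - Suc i) \<le> C" using IH i that by simp
    show "0 \<le> lowered c (suffix (Suc i) y) (n - Suc i)" using y c by (intro lowered_nonneg) auto
  qed (use c layer_nonneg in auto)
  show ?case
  proof (cases "\<forall>i<n. y i = om i")
    case True
    have "prefix n y = prefix n om" using True by (auto intro: nth_equalityI)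
    then have "lowered c y n \<le> (\<Sum>i<n. layer c i) * C + M"
      using lowered_split[of n n c y] head[of n] True M[of n] by simp
    also have "\<dots> \<le> ?F * C + M" using partial[of n] C0 by (intro add_right_mono mult_right_mono)
    finally have "lowered c y n \<le> C" using C_eq by linarith
    then show ?thesis by (simp only: C_def)
  next
    case False
    then have "y \<noteq> om" by auto
    then obtain k where k: "\<And>i. i < k \<Longrightarrow> y i = om i" "y k \<noteq> om k"
      using ex_first_difference[of y om] by blast
    have kn: "k < n" using False k by (metis linorder_not_less order.strict_trans2)
    have less_k: "y k < om k" using X_le_om[OF y(1)] k unfolding lex_le_iff by (metis nat_less_le)
    have pk: "prefix k y = prefix k om" using k by (auto intro: nth_equalityI)
    let ?l = "c * H (y k) + (if least_letter < y k then c * H least_letter else 0)"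
    have "wt c (prefix k om) * ?l \<le> layer c k"
      using layer_ge[of "{y k}" k] layer_ge[of "{least_letter, y k}" k] less_k least_letter_in_J
        subsetD[OF y(2), of "y k"] by (auto simp: add.commute)
    moreover have "0 \<le> lowered c (suffix (Suc k) y) (n - Suc k)" using y c by (intro lowered_nonneg) auto
    ultimately have "wt c (prefix k om) * ?l * lowered c (suffix (Suc k) y) (n - Suc k) \<le> layer c k * C"
      using IH[OF kn] c layer_nonneg[of c k] by (intro mult_mono) auto
    moreover have "lowered c (suffix k y) (n - k) = ?l * lowered c (suffix (Suc k) y) (n - Suc k)"
      using lowered_Suc[of c "suffix k y" "n - Suc k"] kn by (simp add: Suc_diff_Suc)
    ultimately have "wt c (prefix k y) * lowered c (suffix k y) (n - k) \<le> layer c k * C"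
      by (simp only: pk mult.assoc)
    then have "lowered c y n \<le> (\<Sum>i<k. layer c i) * C + layer c k * C"
      using lowered_split[OF less_imp_le[OF kn], of c y] head[OF less_imp_le[OF kn] k(1)] by linarith
    then have "lowered c y n \<le> (\<Sum>i<Suc k. layer c i) * C" by (simp add: distrib_right)
    also have "\<dots> \<le> ?F * C" using partial[of "Suc k"] C0 by (intro mult_right_mono)
    finally have "lowered c y n \<le> C" using C_eq M1 by linarith
    then show ?thesis by (simp only: C_def)
  qed
qed

end

context infinite_code
begin

text \<open>Taking geometric means of the bounds for single letters turns the bound on \<open>lowered\<close> into
  exponential decay of the weights of the prefixes of \<open>om\<close>.\<close>

lemma prefix_om_weight_decay:
  assumes c: "c > 0" and summable: "summable (layer c)" and F: "(\<Sum>n. layer c n) < 1"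
  shows "\<exists>K \<rho>. 0 < \<rho> \<and> \<rho> < 1 \<and> 0 \<le> K \<and> (\<forall>n. wt c (prefix n om) \<le> K * \<rho> ^ n)"
proof -
  let ?F = "\<Sum>n. layer c n"
  let ?x = "\<lambda>n. wt c (prefix n om)"
  define r where "r = c * H least_letter"
  define M where "M = 1 + (\<Sum>a\<in>J. H a) / H least_letter"
  have He: "H least_letter > 0" using H_pos least_letter_in_J by blast
  have r0: "r > 0" using c He by (simp add: r_def)
  have x_Suc: "?x (Suc n) = ?x n * (c * H (om n))" for n by simp
  have x0: "?x n > 0" for n using c prefix_om_in_J by (intro wt_pos)
  have layer_F: "layer c n \<le> ?F" for n
    using sum_le_suminf[OF summable, of "{n}"] layer_nonneg c by auto
  have x_r: "?x n * r \<le> layer c n" if "least_letter < om n" for n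
    unfolding layer_def r_def using that c x0[of n] least_letter_in_J
    by (intro mult_left_mono member_le_sum) (auto intro: less_imp_le[OF mult_pos_pos[OF c H_pos]])
  have r1: "r < 1" using x_r[OF least_letter_less_om_0] layer_F[of 0] F by simp
  have M1: "M \<ge> 1" unfolding M_def using He by (simp add: sum_nonneg less_imp_le H_pos)
  have H_le: "c * H a \<le> M * r" if "a \<in> J" for a
  proof -
    have "H a \<le> (\<Sum>a\<in>J. H a)" using that by (intro member_le_sum) (auto intro: less_imp_le[OF H_pos])
    also have "\<dots> \<le> M * H least_letter" using He by (simp add: M_def field_simps)
    finally show ?thesis using c by (simp add: r_def)
  qed
  have x_M: "?x n \<le> M" for n
  proof (induction n)
    case (Suc n)
    show ?case
    proof (cases "least_letter < om n")
      case True
      have "?x (Suc n) \<le> ?x n * (M * r)"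
        unfolding x_Suc using H_le[OF om_in_J[of n]] x0[of n] by (intro mult_left_mono) auto
      also have "\<dots> = M * (?x n * r)" by simp
      also have "\<dots> \<le> M * 1" using x_r[OF True] layer_F[of n] F M1 by (intro mult_left_mono) auto
      finally show ?thesis by simp
    next
      case False
      then have "om n = least_letter" using least_letter_le[OF om_in_J[of n]] by simp
      then have "?x (Suc n) \<le> ?x n * 1" unfolding x_Suc using r1 x0[of n]
        by (intro mult_left_mono) (auto simp: r_def)
      then show ?thesis using Suc by simp
    qed
  qed (use M1 in simp)
  define C where "C = M / (1 - ?F)"
  have om_XJ: "om \<in> XJ" using om_in_X om_in_J by (auto simp: mem_XJ_iff)
  have C: "lowered c om n \<le> C" for n
    unfolding C_def by (rule lowered_le[OF c summable F x_M om_XJ])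
  have C0: "C \<ge> 0" using M1 F by (simp add: C_def)
  have "1 < 1 + 1 / M" using M1 by simp
  (* The weight of a letter exceeds that of the least letter by at most the factor M, and the option
     of lowering it gains at least the factor 1 + 1 / M; t such gains outweigh the factor M. *)
  then obtain t where t: "M < (1 + 1 / M) ^ t" using real_arch_pow by blast
  define l where "l i = c * H (om i) + (if least_letter < om i then r else 0)" for i
  have letter: "(c * H (om i)) ^ Suc t \<le> r * l i ^ t" for i
  proof (cases "least_letter < om i")
    case True
    define g where "g = c * H (om i)"
    have g0: "g > 0" using c H_pos[OF om_in_J] by (simp add: g_def)
    have gM: "g \<le> M * r" using H_le om_in_J by (simp add: g_def)
    have "g * (1 + 1 / M) \<le> g + r" using gM M1 by (simp add: field_simps)
    then have "(g * (1 + 1 / M)) ^ t \<le> (g + r) ^ t" using g0 M1 by (intro power_mono) auto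
    moreover have "g ^ t * M \<le> (g * (1 + 1 / M)) ^ t"
      unfolding power_mult_distrib using t g0 by (intro mult_left_mono) auto
    ultimately have le: "g ^ t * M \<le> (g + r) ^ t" by simp
    have "g ^ Suc t \<le> (M * r) * g ^ t" using gM g0 by (simp add: mult_right_mono)
    also have "\<dots> = r * (g ^ t * M)" by simp
    also have "\<dots> \<le> r * (g + r) ^ t" using le r0 by (intro mult_left_mono) auto
    finally show ?thesis using True by (simp add: g_def l_def)
  next
    case False
    then have "om i = least_letter" using least_letter_le[OF om_in_J[of i]] by simp
    then show ?thesis by (simp add: l_def r_def)
  qed
  have power: "?x n ^ Suc t \<le> r ^ n * lowered c om n ^ t" for n
  proof -
    have "?x n = (\<Prod>i<n. c * H (om i))" by (induction n) (simp_all add: x_Suc)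
    then have "?x n ^ Suc t = (\<Prod>i<n. (c * H (om i)) ^ Suc t)" by (simp only: prod_power_distrib)
    also have "\<dots> \<le> (\<Prod>i<n. r * l i ^ t)"
      using letter c H_pos[OF om_in_J] by (intro prod_mono) (auto intro!: mult_nonneg_nonneg less_imp_le)
    also have "\<dots> = r ^ n * (\<Prod>i<n. l i) ^ t" by (simp add: prod.distrib prod_power_distrib)
    finally show ?thesis unfolding lowered_def l_def r_def .
  qed
  define \<rho> where "\<rho> = root (Suc t) r"
  define K where "K = root (Suc t) (C ^ t)"
  have "?x n \<le> K * \<rho> ^ n" for n
  proof -
    have "?x n ^ Suc t \<le> r ^ n * C ^ t"
      using power[of n] C[of n] r0 lowered_nonneg[of c om n] c om_in_J
      by (meson image_subsetI less_imp_le mult_left_mono order.trans power_mono zero_le_power)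
    then have "root (Suc t) (?x n ^ Suc t) \<le> root (Suc t) (r ^ n * C ^ t)"
      by (intro real_root_le_mono) auto
    also have "root (Suc t) (?x n ^ Suc t) = ?x n"
      using x0[of n] by (intro real_root_power_cancel) auto
    also have "root (Suc t) (r ^ n * C ^ t) = K * \<rho> ^ n"
      by (simp add: real_root_mult real_root_power K_def \<rho>_def)
    finally show ?thesis .
  qed
  moreover have "0 < \<rho>" "\<rho> < 1" using r0 r1 by (auto simp: \<rho>_def)
  moreover have "0 \<le> K" using C0 by (simp add: K_def)
  ultimately show ?thesis by blast
qed

lemma summable_layer_small: "\<exists>c>0. summable (layer c)"
proof -
  define K where "K = (\<Sum>a\<in>J. H a)"
  have H_le: "H a \<le> K" if "a \<in> J" for a
    unfolding K_def using that by (intro member_le_sum) (auto intro: less_imp_le[OF H_pos])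
  have K0: "K > 0" using H_le[OF least_letter_in_J] H_pos[OF least_letter_in_J] by linarith
  have layer1: "layer 1 n \<le> K ^ Suc n" for n
  proof -
    have wt1: "wt 1 (prefix n om) \<le> K ^ n"
    proof (induction n)
      case (Suc n)
      then have "wt 1 (prefix n om) * H (om n) \<le> K ^ n * K"
        using H_le[OF om_in_J[of n]] H_pos[OF om_in_J[of n]] K0 by (intro mult_mono) auto
      then show ?case by (simp add: mult.commute)
    qed simp
    have "(\<Sum>a\<in>{a\<in>J. a < om n}. 1 * H a) \<le> K"
      unfolding K_def by (auto intro!: sum_mono2 less_imp_le[OF H_pos])
    moreover have "0 \<le> (\<Sum>a\<in>{a\<in>J. a < om n}. 1 * H a)"
      by (auto intro!: sum_nonneg less_imp_le[OF H_pos])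
    ultimately have "layer 1 n \<le> K ^ n * K"
      unfolding layer_def using wt1 K0 by (intro mult_mono) auto
    then show ?thesis by (simp add: mult.commute)
  qed
  define c where "c = 1 / (2 * K)"
  have "summable (layer c)"
  proof (rule summable_comparison_test'[of "\<lambda>n. (1 / 2) ^ Suc n" 0])
    show "summable (\<lambda>n. (1 / 2 :: real) ^ Suc n)" by (simp add: summable_geometric)
    fix n
    have "layer c n = c ^ Suc n * layer 1 n" using layer_scale[of c 1 n] by simp
    also have "\<dots> \<le> c ^ Suc n * K ^ Suc n" using layer1 K0 by (intro mult_left_mono) (auto simp: c_def)
    also have "\<dots> = (1 / 2) ^ Suc n" using K0 by (subst power_mult_distrib[symmetric]) (simp add: c_def)
    finally show "norm (layer c n) \<le> (1 / 2) ^ Suc n" using layer_nonneg[of c n] K0 by (simp add: c_def)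
  qed
  moreover have "c > 0" using K0 by (simp add: c_def)
  ultimately show ?thesis by blast
qed

text \<open>Otherwise the series would be summable with sum less than 1 at the supremum \<open>R\<close> of the \<open>c\<close> where
  it is summable, and the decay of the weights would make it summable beyond \<open>R\<close>.\<close>

lemma ex_total_weight_ge_1: "\<exists>c>0. summable (layer c) \<and> (\<Sum>n. layer c n) \<ge> 1"
proof (rule ccontr)
  assume neg: "\<not> ?thesis"
  then have less1: "(\<Sum>n. layer c n) < 1" if "c > 0" "summable (layer c)" for c
    using that by (meson not_le)
  define \<Lambda> where "\<Lambda> = {c. c > 0 \<and> summable (layer c)}"
  have ne: "\<Lambda> \<noteq> {}" using summable_layer_small by (auto simp: \<Lambda>_def)
  have partial: "(\<Sum>i<n. layer c i) \<le> 1" if "c \<in> \<Lambda>" for c n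
    using sum_le_suminf[of "layer c" "{..<n}"] layer_nonneg[of c] less1[of c] that
    by (fastforce simp: \<Lambda>_def)
  have He: "H least_letter > 0" using H_pos least_letter_in_J by blast
  have bdd: "bdd_above \<Lambda>"
  proof (rule bdd_aboveI)
    fix c assume c: "c \<in> \<Lambda>"
    have "c * H least_letter \<le> layer c 0"
      unfolding layer_def using c least_letter_in_J least_letter_less_om_0
      by (auto simp: \<Lambda>_def intro!: member_le_sum[of least_letter _ "\<lambda>a. c * H a"] mult_nonneg_nonneg
        less_imp_le[OF H_pos])
    then have "c * H least_letter \<le> 1" using partial[OF c, of 1] by simp
    then show "c \<le> 1 / H least_letter" using He by (simp add: field_simps)
  qed
  define R where "R = Sup \<Lambda>"
  have upper: "c \<le> R" if "c \<in> \<Lambda>" for c unfolding R_def by (rule cSup_upper[OF that bdd])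
  have R0: "R > 0" using ne upper by (force simp: \<Lambda>_def)
  have below: "c \<in> \<Lambda>" if c: "0 < c" "c < R" for c
  proof -
    obtain d where d: "d \<in> \<Lambda>" "c < d" using less_cSupD[OF ne] c(2) by (auto simp: R_def)
    have scale: "layer c n = (c / d) ^ Suc n * layer d n" for n
      using layer_scale[of "c / d" d n] d that by simp
    have "summable (layer c)"
    proof (rule summable_comparison_test'[of "layer d" 0])
      show "summable (layer d)" using d by (simp add: \<Lambda>_def)
      fix n
      have "(c / d) ^ Suc n * layer d n \<le> 1 * layer d n"
        using d that layer_nonneg[of d n] by (intro mult_right_mono power_le_one) (auto simp: \<Lambda>_def)
      then show "norm (layer c n) \<le> layer d n" using layer_nonneg[of c n] that scale by simp
    qed
    with that show ?thesis by (simp add: \<Lambda>_def)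
  qed
  have partial_R: "(\<Sum>i<n. layer R i) \<le> 1" for n
  proof (rule tendsto_upperbound)
    have scale: "layer c i = c ^ Suc i * layer 1 i" for c i using layer_scale[of c 1 i] by simp
    have "((\<lambda>c. \<Sum>i<n. c ^ Suc i * layer 1 i) \<longlongrightarrow> (\<Sum>i<n. R ^ Suc i * layer 1 i)) (at_left R)"
      by (intro tendsto_intros)
    then show "((\<lambda>c. \<Sum>i<n. layer c i) \<longlongrightarrow> (\<Sum>i<n. layer R i)) (at_left R)"
      by (simp only: scale[symmetric])
    show "\<forall>\<^sub>F c in at_left R. (\<Sum>i<n. layer c i) \<le> 1"
      using eventually_at_left_real[OF R0] by eventually_elim (use below partial in auto)
  qed simp
  have R_summable: "summable (layer R)"
  proof (rule bounded_imp_summable[where B=1])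
    show "layer R n \<ge> 0" for n using layer_nonneg R0 by simp
    show "(\<Sum>k\<le>n. layer R k) \<le> 1" for n using partial_R[of "Suc n"] by (simp add: lessThan_Suc_atMost)
  qed
  obtain K \<rho> where \<rho>: "0 < \<rho>" "\<rho> < 1" "0 \<le> K" and decay: "\<And>n. wt R (prefix n om) \<le> K * \<rho> ^ n"
    using prefix_om_weight_decay[OF R0 R_summable less1[OF R0 R_summable]] by blast
  define L where "L = (\<Sum>a\<in>J. R * H a)"
  have L0: "L \<ge> 0" unfolding L_def using R0 by (auto intro!: sum_nonneg mult_nonneg_nonneg less_imp_le[OF H_pos])
  have layer_R: "layer R n \<le> K * \<rho> ^ n * L" for n
  proof -
    have "(\<Sum>a\<in>{a\<in>J. a < om n}. R * H a) \<le> L"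
      unfolding L_def using R0 by (auto intro!: sum_mono2 mult_nonneg_nonneg less_imp_le[OF H_pos])
    moreover have "0 \<le> (\<Sum>a\<in>{a\<in>J. a < om n}. R * H a)"
      using R0 by (auto intro!: sum_nonneg mult_nonneg_nonneg less_imp_le[OF H_pos])
    ultimately show ?thesis
      unfolding layer_def using decay[of n] \<rho> by (intro mult_mono) auto
  qed
  define s where "s = 2 / (1 + \<rho>)"
  have s: "s > 1" "s * \<rho> < 1" "s * \<rho> > 0" using \<rho> by (auto simp: s_def field_simps)
  have "summable (layer (s * R))"
  proof (rule summable_comparison_test'[of "\<lambda>n. (s * K * L) * (s * \<rho>) ^ n" 0])
    show "summable (\<lambda>n. (s * K * L) * (s * \<rho>) ^ n)"
      using s by (intro summable_mult summable_geometric) auto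
    fix n
    have "layer (s * R) n \<le> s ^ Suc n * (K * \<rho> ^ n * L)"
      unfolding layer_scale using layer_R[of n] s by (intro mult_left_mono) auto
    then show "norm (layer (s * R) n) \<le> (s * K * L) * (s * \<rho>) ^ n"
      using layer_nonneg[of "s * R" n] s R0 by (simp add: power_mult_distrib mult_ac)
  qed
  then have "s * R \<in> \<Lambda>" using s R0 by (simp add: \<Lambda>_def)
  then have "s * R \<le> 1 * R" using upper by simp
  then show False using s R0 by simp
qed

lemma ex_total_weight_1_infinite: "\<exists>c>0. (\<integral>\<^sup>+w. wt c w \<partial>count_space codeJ) = 1"
proof -
  obtain c where c: "c > 0" "summable (layer c)" "(\<Sum>n. layer c n) \<ge> 1"
    using ex_total_weight_ge_1 by blast
  have "(\<integral>\<^sup>+w. wt c w \<partial>count_space codeJ) = ennreal (\<Sum>n. layer c n)"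
    using c layer_nonneg[of c] by (simp add: total_weight_eq_suminf suminf_ennreal2)
  then show ?thesis using c by (intro ex_total_weight_1_of_ge_1[of c]) auto
qed

end

context weighted_beta_shift
begin

lemma ex_total_weight_1: "\<exists>c>0. (\<integral>\<^sup>+w. wt c w \<partial>count_space codeJ) = 1"
proof (cases "finite codeJ")
  case False
  then interpret infinite_code \<beta> J H by unfold_locales
  show ?thesis by (rule ex_total_weight_1_infinite)
qed (rule ex_total_weight_1_finite)

lemma total_weight_1_unique:
  assumes "0 < c" "(\<integral>\<^sup>+w. wt c w \<partial>count_space codeJ) = 1"
    and "0 < d" "(\<integral>\<^sup>+w. wt d w \<partial>count_space codeJ) = 1"
  shows "c = d"
proof -
  have not_less: "\<not> c < d" if cd: "0 < c" "0 < d" "(\<integral>\<^sup>+w. wt c w \<partial>count_space codeJ) = 1"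
    "(\<integral>\<^sup>+w. wt d w \<partial>count_space codeJ) = 1" for c d
  proof
    assume "c < d"
    obtain v where v: "v \<in> codeJ" using codeJ_two_elements by blast
    have le: "wt c w \<le> wt d w" "0 \<le> wt c w" if "w \<in> codeJ" for w
      using that \<open>c < d\<close> cd(1) by (auto simp: codeJ_def intro!: wt_mono wt_nonneg)
    have "wt c v < wt d v" using codeJ_D[OF v] wt_strict_mono \<open>c < d\<close> cd(1) by blast
    have "(\<integral>\<^sup>+w. wt d w \<partial>count_space codeJ)
        = (\<integral>\<^sup>+w. ennreal (wt c w) + ennreal (wt d w - wt c w) \<partial>count_space codeJ)"
      using le by (intro nn_integral_cong) (simp add: ennreal_plus[symmetric] del: ennreal_plus)
    also have "\<dots> = 1 + (\<integral>\<^sup>+w. ennreal (wt d w - wt c w) \<partial>count_space codeJ)"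
      using cd(3) by (simp add: nn_integral_add)
    finally have "1 + (\<integral>\<^sup>+w. ennreal (wt d w - wt c w) \<partial>count_space codeJ) = 1 + 0"
      using cd(4) by simp
    then have "(\<integral>\<^sup>+w. ennreal (wt d w - wt c w) \<partial>count_space codeJ) = 0"
      unfolding ennreal_add_left_cancel by simp
    then have "ennreal (wt d v - wt c v) = 0"
      using v by (simp add: nn_integral_0_iff_AE AE_count_space)
    then show False using \<open>wt c v < wt d v\<close> by (simp add: ennreal_eq_0_iff)
  qed
  show ?thesis using not_less[of c d] not_less[of d c] assms by auto
qed

end

section \<open>Borel sets of sequences\<close>

lemma measurable_coordinate [measurable]:
  "(\<lambda>x::nat \<Rightarrow> nat. x i) \<in> borel \<rightarrow>\<^sub>M count_space UNIV"
proof -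
  have "(\<lambda>x::nat \<Rightarrow> nat. x i) \<in> borel_measurable borel"
    by (intro borel_measurable_continuous_onI continuous_on_product_coordinates)
  then show ?thesis by (simp add: measurable_cong_sets[OF refl sets_borel_eq_count_space])
qed

lemma measurable_sequenceI:
  fixes f :: "'a \<Rightarrow> nat \<Rightarrow> nat"
  assumes "\<And>i. (\<lambda>x. f x i) \<in> M \<rightarrow>\<^sub>M count_space UNIV"
  shows "f \<in> M \<rightarrow>\<^sub>M borel"
proof -
  have "f \<in> M \<rightarrow>\<^sub>M (\<Pi>\<^sub>M i\<in>(UNIV::nat set). borel)"
    using assms by (intro measurable_PiM_single')
      (auto intro!: measurable_compose[OF assms] simp: space_PiM)
  then show ?thesis by (simp add: measurable_cong_sets[OF refl sets_PiM_equal_borel])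
qed

lemma measurable_suffix [measurable]: "suffix n \<in> (borel :: (nat \<Rightarrow> nat) measure) \<rightarrow>\<^sub>M borel"
  by (rule measurable_sequenceI) simp

lemma measurable_conc [measurable]: "(\<lambda>y. u \<frown> y) \<in> (borel :: (nat \<Rightarrow> nat) measure) \<rightarrow>\<^sub>M borel"
proof (rule measurable_sequenceI)
  fix i show "(\<lambda>y. (u \<frown> y) i) \<in> (borel :: (nat \<Rightarrow> nat) measure) \<rightarrow>\<^sub>M count_space UNIV"
    by (cases "i < length u") simp_all
qed

lemma measurable_prefix [measurable]:
  "(\<lambda>x. prefix n x) \<in> (borel :: (nat \<Rightarrow> nat) measure) \<rightarrow>\<^sub>M count_space UNIV"
proof (induction n)
  case (Suc n)
  have "(\<lambda>x. prefix n x @ [x n]) \<in> (borel :: (nat \<Rightarrow> nat) measure) \<rightarrow>\<^sub>M count_space UNIV"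
    by (rule measurable_compose_countable'[OF _ Suc countableI_type])
       (simp_all, measurable)
  then show ?case by simp
qed simp

lemma conc_image_eq: "(\<frown>) u ` B = {x. prefix (length u) x = u \<and> suffix (length u) x \<in> B}"
proof (intro set_eqI iffI)
  fix x assume "x \<in> {x. prefix (length u) x = u \<and> suffix (length u) x \<in> B}"
  then show "x \<in> (\<frown>) u ` B" by (intro image_eqI[of _ _ "suffix (length u) x"]) (auto, metis prefix_suffix)
qed auto

lemma conc_image_borel [measurable]:
  fixes B :: "(nat \<Rightarrow> nat) set"
  assumes [measurable]: "B \<in> sets borel"
  shows "(\<frown>) u ` B \<in> sets borel"
proof -
  have "{x \<in> space borel. prefix (length u) x = u \<and> suffix (length u) x \<in> B} \<in> sets borel" by measurable
  then show ?thesis by (simp add: conc_image_eq)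
qed

lemma singleton_borel [simp]: "{x :: nat \<Rightarrow> nat} \<in> sets borel"
proof -
  have "{y \<in> space borel. \<forall>i. y i = x i} \<in> sets borel" by measurable
  also have "{y \<in> space borel. \<forall>i. y i = x i} = {x}" by auto
  finally show ?thesis .
qed

lemma sets_borel_eq_cylinders:
  "sets (borel :: (nat \<Rightarrow> nat) measure) = sigma_sets UNIV (range (\<lambda>a. {x. prefix (length a) x = a}))"
    (is "_ = sigma_sets _ ?E")
proof
  have "{x. prefix (length a) x = a} \<in> sets borel" for a :: "nat list"
    using conc_image_borel[of UNIV a] by (simp add: conc_image_eq)
  then have "?E \<subseteq> sets borel" by blast
  from sets.sigma_sets_subset[OF this] show "sigma_sets UNIV ?E \<subseteq> sets borel"
    by (simp only: space_borel)
  have coordinate: "{x. x i \<in> A} \<in> sigma_sets UNIV ?E" for i :: nat and A :: "nat set"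
  proof -
    have "x \<in> (\<Union>a\<in>{a. length a = Suc i \<and> a ! i \<in> A}. {x. prefix (length a) x = a})" if "x i \<in> A" for x
      using that by (intro UN_I[of "prefix (Suc i) x"]) (auto simp: nth_append)
    moreover have "x i \<in> A" if "prefix (Suc i) x ! i \<in> A" for x using that by (simp add: nth_append)
    ultimately have "{x. x i \<in> A} = (\<Union>a\<in>{a. length a = Suc i \<and> a ! i \<in> A}. {x. prefix (length a) x = a})"
      by (auto simp del: subseq_to_Suc)
    also have "\<dots> \<in> sigma_sets UNIV ?E"
      by (intro sigma_sets_UNION) (blast intro: sigma_sets.Basic)+
    finally show ?thesis .
  qed
  have "sets (borel :: (nat \<Rightarrow> nat) measure) = sigma_sets UNIV {{f. f i \<in> A} | i A. A \<in> sets borel}"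
    unfolding sets_PiM_equal_borel[symmetric] sets_PiM_single by simp
  also have "\<dots> \<subseteq> sigma_sets UNIV ?E"
    by (rule sigma_sets_mono) (use coordinate in auto)
  finally show "sets (borel :: (nat \<Rightarrow> nat) measure) \<subseteq> sigma_sets UNIV ?E" .
qed

lemma measure_eqI_cylinders:
  fixes M N :: "(nat \<Rightarrow> nat) measure"
  assumes \<Omega>: "\<Omega> \<in> sets borel"
    and sets: "sets M = sets (restrict_space borel \<Omega>)" "sets N = sets (restrict_space borel \<Omega>)"
    and fin: "emeasure M \<Omega> \<noteq> \<infinity>"
    and eq: "\<And>a. emeasure M (\<Omega> \<inter> {x. prefix (length a) x = a}) = emeasure N (\<Omega> \<inter> {x. prefix (length a) x = a})"
  shows "M = N"
proof -
  let ?M = "distr M borel (\<lambda>x. x)" and ?N = "distr N borel (\<lambda>x. x)"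
  have space: "space M = \<Omega>" "space N = \<Omega>"
    using sets[THEN sets_eq_imp_space_eq] by (auto simp: space_restrict_space)
  have mM: "(\<lambda>x. x) \<in> M \<rightarrow>\<^sub>M borel" and mN: "(\<lambda>x. x) \<in> N \<rightarrow>\<^sub>M borel"
    unfolding measurable_cong_sets[OF sets(1) refl] measurable_cong_sets[OF sets(2) refl]
    by (simp_all add: measurable_restrict_space1)
  have eM: "emeasure ?M A = emeasure M (\<Omega> \<inter> A)" and eN: "emeasure ?N A = emeasure N (\<Omega> \<inter> A)"
    if "A \<in> sets borel" for A
    using that mM mN by (auto simp: emeasure_distr space Int_commute)
  let ?E = "insert {} (range (\<lambda>a. {x::nat \<Rightarrow> nat. prefix (length a) x = a}))"
  have E_sets: "?E \<subseteq> sets borel" unfolding sets_borel_eq_cylinders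
    by (auto intro: sigma_sets.Basic sigma_sets.Empty)
  have "?M = ?N"
  proof (rule measure_eqI_generator_eq[of ?E UNIV _ _ "\<lambda>_. {x. prefix (length ([] :: nat list)) x = []}"])
    show "Int_stable ?E"
    proof (rule Int_stableI)
      have *: "{x. prefix (length a) x = a} \<inter> {x. prefix (length b) x = b} \<in> ?E"
        if "length a \<le> length b" for a b :: "nat list"
      proof (cases "take (length a) b = a")
        case True
        have "prefix (length a) x = a" if "prefix (length b) x = b" for x
          using that True \<open>length a \<le> length b\<close>
          by (metis min.absorb1 min.commute subsequence_take add_0)
        then have "{x. prefix (length a) x = a} \<inter> {x. prefix (length b) x = b} = {x. prefix (length b) x = b}"
          by auto
        then show ?thesis by blast
      next
        case False
        have "take (length a) b = a" if "prefix (length a) x = a" "prefix (length b) x = b" for x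
          using that \<open>length a \<le> length b\<close> by (metis min.absorb1 subsequence_take add_0)
        with False have "{x. prefix (length a) x = a} \<inter> {x. prefix (length b) x = b} = {}" by auto
        then show ?thesis by blast
      qed
      fix A B assume "A \<in> ?E" "B \<in> ?E"
      then consider "A = {} \<or> B = {}" | a b where "A = {x. prefix (length a) x = a}" "B = {x. prefix (length b) x = b}"
        by auto
      then show "A \<inter> B \<in> ?E"
      proof cases
        case (2 a b)
        then show ?thesis using *[of a b] *[of b a] by (metis Int_commute nat_le_linear)
      qed auto
    qed
    show "sets ?M = sigma_sets UNIV ?E" "sets ?N = sigma_sets UNIV ?E"
      unfolding sets_distr using sets.sigma_sets_subset[OF E_sets] sets_borel_eq_cylinders
      by (auto intro: sigma_sets_mono'[THEN subsetD, rotated])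
    show "emeasure ?M A = emeasure ?N A" if "A \<in> ?E" for A
      using that E_sets eq by (subst eM eN, blast)+ auto
    show "emeasure ?M {x. prefix (length ([] :: nat list)) x = []} \<noteq> \<infinity>" for i
      using fin by (subst eM) auto
    show "range (\<lambda>_::nat. {x::nat \<Rightarrow> nat. prefix (length ([] :: nat list)) x = []}) \<subseteq> ?E"
      by (rule image_subsetI, rule insertI2, rule range_eqI[where x="[]"], rule refl)
  qed auto
  show "M = N"
  proof (rule measure_eqI)
    show "sets M = sets N" using sets by simp
    fix A assume "A \<in> sets M"
    then have "A \<in> sets borel" "\<Omega> \<inter> A = A" using sets(1) \<Omega> by (auto simp: sets_restrict_space)
    then show "emeasure M A = emeasure N A" using \<open>?M = ?N\<close> eM[of A] eN[of A] by simp
  qed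
qed

section \<open>Uniqueness of the conformal measure\<close>

context beta_shift_space
begin

lemma X_borel [measurable]: "X \<in> sets borel"
proof -
  have "{y \<in> space borel. (\<forall>n. y n \<le> nat \<lfloor>\<beta>\<rfloor>) \<and> (\<forall>k n. (\<forall>i<n. y (k + i) = om i) \<longrightarrow> y (k + n) \<le> om n)} \<in> sets borel"
    by measurable
  also have "{y \<in> space borel. (\<forall>n. y n \<le> nat \<lfloor>\<beta>\<rfloor>) \<and> (\<forall>k n. (\<forall>i<n. y (k + i) = om i) \<longrightarrow> y (k + n) \<le> om n)} = X"
    by (auto simp: mem_X_iff lex_le_iff)
  finally show ?thesis .
qed

lemma X0_borel [measurable]: "X0 \<in> sets borel"
proof -
  have "{y \<in> space borel. y \<in> X \<and> (\<forall>n. \<not> (\<forall>i. y (n + i) = om i))} \<in> sets borel"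
    by measurable
  also have "{y \<in> space borel. y \<in> X \<and> (\<forall>n. \<not> (\<forall>i. y (n + i) = om i))} = X0"
    by (auto simp: mem_X0_iff fun_eq_iff)
  finally show ?thesis .
qed

end

context weighted_beta_shift
begin

lemma XJ_borel [measurable]: "XJ \<in> sets borel"
proof -
  have "{y \<in> space borel. y \<in> X \<and> (\<forall>n. y n \<in> J)} \<in> sets borel"
    by measurable
  also have "{y \<in> space borel. y \<in> X \<and> (\<forall>n. y n \<in> J)} = XJ"
    by (auto simp: beta_shift_on_def)
  finally show ?thesis .
qed

lemma X0J_eq: "X0J = X0 \<inter> XJ"
  using X0_subset_X by (auto simp: mem_XJ_iff mem_X0J_iff)

lemma X0J_borel [measurable]: "X0J \<in> sets borel"
  by (simp add: X0J_eq)

lemma X0J_suffix: "x \<in> X0J \<Longrightarrow> suffix n x \<in> X0J"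
  by (auto simp: mem_X0J_iff suffix_in_X0)

lemma conc_in_X0J: "full u \<Longrightarrow> u \<in> lists J \<Longrightarrow> y \<in> X0J \<Longrightarrow> u \<frown> y \<in> X0J"
  by (auto simp: mem_X0J_iff conc_in_X0)

lemma full_conc_image_subset: "full u \<Longrightarrow> u \<in> lists J \<Longrightarrow> B \<subseteq> XJ \<Longrightarrow> (\<frown>) u ` B \<subseteq> XJ"
  by (auto intro: conc_in_XJ simp del: in_lists_conv_set)

lemma codeJ_conc_disjoint: "disjoint_family_on (\<lambda>w. (\<frown>) w ` B w) codeJ"
proof -
  have "v = w" if "v \<in> codeJ" "w \<in> codeJ" "x \<in> (\<frown>) v ` B v" "x \<in> (\<frown>) w ` B w" for v w x
  proof -
    from that(3,4) obtain y z where "x = v \<frown> y" "x = w \<frown> z" by blast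
    then show ?thesis using code_prefix_free[of v w y z] that(1,2) by (simp add: codeJ_def)
  qed
  then show ?thesis unfolding disjoint_family_on_def by blast
qed

lemma XJ_minus_om_subset: "XJ - {om} \<subseteq> (\<Union>w\<in>codeJ. (\<frown>) w ` XJ)"
proof
  fix x assume x: "x \<in> XJ - {om}"
  then obtain w y where "w \<in> code" "y \<in> X" "x = w \<frown> y"
    using ex_code_prefix by (metis Diff_iff mem_XJ_iff singletonI)
  moreover from this x have "w \<in> codeJ" "y \<in> XJ"
    using conc_in_XJ_D[of w y] by (simp_all add: codeJ_def)
  ultimately show "x \<in> (\<Union>w\<in>codeJ. (\<frown>) w ` XJ)" by blast
qed

text \<open>The full words over \<open>J\<close> that extend \<open>a\<close>, possibly trivially, and have no shorter full prefix that
  does: every point of \<open>X0J\<close> in the cylinder of \<open>a\<close> lies in the cylinder of exactly one of them.\<close>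

definition full_ext :: "nat list \<Rightarrow> nat list set" where
  "full_ext a = {u. full u \<and> u \<in> lists J \<and> length a \<le> length u \<and> take (length a) u = a \<and>
     (\<forall>k. length a \<le> k \<and> k < length u \<longrightarrow> \<not> full (take k u))}"

lemma full_ext_disjoint:
  assumes "u \<in> full_ext a" "v \<in> full_ext a" "u \<frown> x = v \<frown> y"
  shows "u = v"
proof -
  have *: "u = v" if "u \<in> full_ext a" "v \<in> full_ext a" "u \<frown> x = v \<frown> y" "length u \<le> length v" for u v x y
  proof -
    have u: "u = take (length u) v"
      using that(3,4) prefix_conc_length[of u x] by (metis prefix_conc_fst)
    then have "full (take (length u) v)" using that(1) by (simp add: full_ext_def)
    then have "\<not> length u < length v" using that(1,2) unfolding full_ext_def by blast
    then show ?thesis using u that(4) by simp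
  qed
  show ?thesis using *[OF assms] *[OF assms(2,1) assms(3)[symmetric]] by (metis nat_le_linear)
qed

lemma ex_full_ext:
  assumes "x \<in> X0J" "prefix (length a) x = a"
  obtains u y where "u \<in> full_ext a" "y \<in> XJ" "x = u \<frown> y"
proof -
  have x: "x \<in> X0" "range x \<subseteq> J" using assms(1) by (auto simp: mem_X0J_iff)
  define m where "m = (LEAST m. length a \<le> m \<and> full (prefix m x))"
  have m: "length a \<le> m \<and> full (prefix m x)"
    unfolding m_def using X0_long_full_prefix[OF x(1), of "length a"] by (metis (mono_tags, lifting) LeastI)
  have "\<not> full (take k (prefix m x))" if "length a \<le> k" "k < length (prefix m x)" for k
    using not_less_Least[of k "\<lambda>m. length a \<le> m \<and> full (prefix m x)"] that
    by (simp add: m_def[symmetric] min_def)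
  moreover have "take (length a) (prefix m x) = a" using m assms(2) by (simp add: min_def)
  ultimately have "prefix m x \<in> full_ext a" using m subsetD[OF x(2)] by (auto simp: full_ext_def)
  moreover have "suffix m x \<in> XJ" using X0J_suffix[OF assms(1)] X0J_subset_XJ by blast
  ultimately show ?thesis using that[of "prefix m x" "suffix m x"] by simp
qed

end

text \<open>A conformal measure with constant \<open>c\<close>.\<close>

locale conformal_measure = weighted_beta_shift +
  fixes c :: real and \<mu> :: "(nat \<Rightarrow> nat) measure"
  assumes c_pos: "c > 0" and conformal: "conformal \<beta> J H c \<mu>"
begin

sublocale prob_space \<mu>
  using conformal by (simp add: conformal_def)

lemma sets_mu: "sets \<mu> = sets (restrict_space borel XJ)"
  using conformal by (simp add: conformal_def)

lemma sets_mu_iff: "B \<in> sets \<mu> \<longleftrightarrow> B \<in> sets borel \<and> B \<subseteq> XJ"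
  by (auto simp: sets_mu sets_restrict_space_iff)

lemma space_mu [simp]: "space \<mu> = XJ"
  using sets_eq_imp_space_eq[OF sets_mu] by (simp add: space_restrict_space)

lemma XJ_sets_mu [simp]: "XJ \<in> sets \<mu>"
  by (simp add: sets_mu_iff)

lemma emeasure_XJ [simp]: "emeasure \<mu> XJ = 1"
  using emeasure_space_1 by simp

lemma conc_image_subset_XJ_D:
  assumes "B \<noteq> {}" "(\<frown>) u ` B \<subseteq> XJ"
  shows "u \<in> lists J"
proof -
  obtain y where "y \<in> B" using assms(1) by blast
  then have "u \<frown> y \<in> XJ" using assms(2) by blast
  then show ?thesis using conc_in_XJ_D by blast
qed

lemma emeasure_letter_conc:
  assumes B: "B \<in> sets \<mu>" and sub: "(\<frown>) [j] ` B \<subseteq> XJ"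
  shows "emeasure \<mu> ((\<frown>) [j] ` B) = ennreal (c * H j) * emeasure \<mu> B"
proof (cases "B = {}")
  case False
  then have j: "j \<in> J" using conc_image_subset_XJ_D[OF _ sub] by simp
  let ?B = "(\<frown>) [j] ` B"
  have Bs: "?B \<in> sets \<mu>" using B sub by (simp add: sets_mu_iff conc_image_borel)
  have cH: "c * H j > 0" using c_pos H_pos[OF j] by simp
  have "shift ([j] \<frown> y) = y" for y by (simp add: shift_def conc_def)
  then have "shift ` ?B = B" by (simp add: image_image)
  moreover have "\<forall>x\<in>?B. x 0 = j" by auto
  moreover have "(\<forall>x\<in>?B. x 0 = j) \<longrightarrow>
      emeasure \<mu> (shift ` ?B) = (\<integral>\<^sup>+x\<in>?B. ennreal (1 / (c * H (x 0))) \<partial>\<mu>)"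
    using conformal Bs unfolding conformal_def by blast
  ultimately have "emeasure \<mu> B = (\<integral>\<^sup>+x\<in>?B. ennreal (1 / (c * H (x 0))) \<partial>\<mu>)" by simp
  also have "\<dots> = (\<integral>\<^sup>+x. ennreal (1 / (c * H j)) * indicator ?B x \<partial>\<mu>)"
    by (intro nn_integral_cong) (auto split: split_indicator)
  also have "\<dots> = ennreal (1 / (c * H j)) * emeasure \<mu> ?B"
    using Bs by (rule nn_integral_cmult_indicator)
  finally have "ennreal (c * H j) * emeasure \<mu> B = ennreal (c * H j) * ennreal (1 / (c * H j)) * emeasure \<mu> ?B"
    by (simp add: mult.assoc)
  also have "ennreal (c * H j) * ennreal (1 / (c * H j)) = 1"
    using cH by (subst ennreal_mult[symmetric]) auto
  finally show ?thesis by simp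
qed simp

lemma emeasure_conc:
  assumes B: "B \<in> sets \<mu>" and sub: "(\<frown>) u ` B \<subseteq> XJ"
  shows "emeasure \<mu> ((\<frown>) u ` B) = ennreal (wt c u) * emeasure \<mu> B"
proof (cases "B = {}")
  case False
  then have "u \<in> lists J" using conc_image_subset_XJ_D[OF _ sub] by simp
  then show ?thesis using sub
  proof (induction u)
    case (Cons j u)
    have eq: "(\<frown>) (j # u) ` B = (\<frown>) [j] ` ((\<frown>) u ` B)" by (simp add: image_image)
    have sub': "(\<frown>) u ` B \<subseteq> XJ"
      using Cons.prems conc_in_XJ_D[of "[j]"] unfolding eq by blast
    then have "(\<frown>) u ` B \<in> sets \<mu>" using B by (simp add: sets_mu_iff conc_image_borel)
    then have "emeasure \<mu> ((\<frown>) (j # u) ` B) = ennreal (c * H j) * emeasure \<mu> ((\<frown>) u ` B)"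
      unfolding eq by (rule emeasure_letter_conc) (use Cons.prems eq in simp)
    also have "emeasure \<mu> ((\<frown>) u ` B) = ennreal (wt c u) * emeasure \<mu> B"
      using Cons.IH[OF sub'] .
    finally show ?case using Cons.hyps c_pos H_pos wt_pos[of c u]
      by (simp add: ennreal_mult mult.assoc less_imp_le)
  qed simp
qed simp

lemma emeasure_full_conc:
  assumes "full u" "u \<in> lists J" "B \<in> sets \<mu>"
  shows "emeasure \<mu> ((\<frown>) u ` B) = ennreal (wt c u) * emeasure \<mu> B"
  using assms by (intro emeasure_conc full_conc_image_subset) (auto simp: sets_mu_iff)

lemma emeasure_full_cylinder:
  "full u \<Longrightarrow> u \<in> lists J \<Longrightarrow> emeasure \<mu> ((\<frown>) u ` XJ) = ennreal (wt c u)"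
  using emeasure_full_conc[of u XJ] by simp

lemma full_conc_sets: "full u \<Longrightarrow> u \<in> lists J \<Longrightarrow> B \<in> sets \<mu> \<Longrightarrow> (\<frown>) u ` B \<in> sets \<mu>"
  using full_conc_image_subset[of u B] by (simp add: sets_mu_iff conc_image_borel)

lemma emeasure_UN_code:
  assumes "B \<in> sets \<mu>"
  shows "emeasure \<mu> (\<Union>w\<in>codeJ. (\<frown>) w ` B) = (\<integral>\<^sup>+w. wt c w \<partial>count_space codeJ) * emeasure \<mu> B"
proof -
  have sets: "(\<frown>) w ` B \<in> sets \<mu>" if "w \<in> codeJ" for w
    using full_conc_sets[of w B] codeJ_D[OF that] assms by blast
  have "emeasure \<mu> (\<Union>w\<in>codeJ. (\<frown>) w ` B) = (\<integral>\<^sup>+w. emeasure \<mu> ((\<frown>) w ` B) \<partial>count_space codeJ)"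
    using sets codeJ_conc_disjoint[of "\<lambda>_. B"] by (intro emeasure_UN_countable) auto
  also have "\<dots> = (\<integral>\<^sup>+w. wt c w * emeasure \<mu> B \<partial>count_space codeJ)"
    using codeJ_D assms by (intro nn_integral_cong emeasure_full_conc) auto
  also have "\<dots> = (\<integral>\<^sup>+w. wt c w \<partial>count_space codeJ) * emeasure \<mu> B"
    by (rule nn_integral_multc) simp
  finally show ?thesis .
qed

lemma singleton_sets_mu: "x \<in> XJ \<Longrightarrow> {x} \<in> sets \<mu>"
  by (simp add: sets_mu_iff)

text \<open>If \<open>om\<close> is purely periodic, it is fixed by prepending a code word of weight less than 1.
  Otherwise an atom at \<open>om\<close> gives one at \<open>suffix 1 om\<close>, which lies in \<open>X0J\<close>; since \<open>X0J\<close> is the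
  disjoint union of its copies under the code words, the total weight of the code is then 1, which
  leaves no mass for \<open>om\<close>.\<close>

lemma emeasure_om: "emeasure \<mu> (XJ \<inter> {om}) = 0"
proof (rule ccontr)
  assume atom: "emeasure \<mu> (XJ \<inter> {om}) \<noteq> 0"
  then have om: "om \<in> XJ" by (cases "om \<in> XJ") auto
  then have XJ_om: "XJ \<inter> {om} = {om}" by auto
  show False
  proof (cases "\<exists>n>0. full (prefix n om)")
    case True
    then obtain n where n: "n > 0" "full (prefix n om)" by blast
    then obtain w v where wv: "prefix n om = w @ v" "w \<in> code"
      using full_code_prefix[of "prefix n om"] by (metis not_gr_zero subsequence_empty le_zero_eq)
    then have w_eq: "w = prefix (length w) om"
      by (metis append_eq_conv_conj add_0 append_take_drop_id length_append min.absorb1 le_add1 minus_nat.diff_0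
          subsequence_length subsequence_take)
    have om_eq: "w \<frown> om = om"
      using full_prefix_om_iff[of "length w"] w_eq code_full[OF wv(2)] by (metis prefix_suffix)
    have w: "w \<in> codeJ" using om wv(2) w_eq by (auto simp: codeJ_def mem_XJ_iff) (metis image_eqI in_set_conv_nth rangeI subsequence_nth subsetD add_0 minus_nat.diff_0 subsequence_length)
    obtain w' where w': "w' \<in> codeJ" "w' \<noteq> w" using codeJ_two_elements by metis
    have pos: "wt c w > 0" "wt c w' > 0" using w w' c_pos by (auto simp: codeJ_def intro!: wt_pos)
    have "(\<frown>) w ` XJ \<inter> (\<frown>) w' ` XJ = {}"
      using disjoint_family_onD[OF codeJ_conc_disjoint[of "\<lambda>_. XJ"] w w'(1)] w'(2) by simp
    then have "emeasure \<mu> ((\<frown>) w ` XJ) + emeasure \<mu> ((\<frown>) w' ` XJ) = emeasure \<mu> ((\<frown>) w ` XJ \<union> (\<frown>) w' ` XJ)"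
      using codeJ_D[OF w] codeJ_D[OF w'(1)] by (intro plus_emeasure full_conc_sets) auto
    also have "\<dots> \<le> 1" by (rule emeasure_le_1)
    finally have "ennreal (wt c w) + ennreal (wt c w') \<le> 1"
      using codeJ_D[OF w] codeJ_D[OF w'(1)] emeasure_full_cylinder by simp
    then have "wt c w + wt c w' \<le> 1" using pos by (simp add: ennreal_plus[symmetric] del: ennreal_plus)
    then have less: "wt c w < 1" using pos by simp
    have "(\<frown>) w ` {om} = {om}" using om_eq by simp
    then have "emeasure \<mu> {om} = ennreal (wt c w) * emeasure \<mu> {om}"
      using emeasure_full_conc[of w "{om}"] codeJ_D[OF w] singleton_sets_mu[OF om] by simp
    then have "ennreal (measure \<mu> {om}) = ennreal (wt c w * measure \<mu> {om})"
      using pos by (simp add: emeasure_eq_measure ennreal_mult)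
    then have "measure \<mu> {om} = wt c w * measure \<mu> {om}" using pos by simp
    then have "measure \<mu> {om} = 0" using less by simp
    then show False using atom by (simp add: XJ_om emeasure_eq_measure)
  next
    case False
    let ?s = "\<integral>\<^sup>+w. wt c w \<partial>count_space codeJ"
    have no_return: "suffix n om \<noteq> om" if "n > 0" for n using False that full_prefix_om_iff by blast
    have "suffix 1 om \<in> X0J"
      using om no_return by (auto simp: mem_X0J_iff mem_XJ_iff mem_X0_iff suffix_in_X)
    then have sub: "{suffix 1 om} \<subseteq> X0J" by simp
    have s_sets: "{suffix 1 om} \<in> sets \<mu>" "X0J \<in> sets \<mu>"
      using sub X0J_subset_XJ by (auto simp: sets_mu_iff)
    have "(\<frown>) [om 0] ` {suffix 1 om} = {om}" using prefix_suffix[of om 1] by simp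
    then have "emeasure \<mu> {om} = ennreal (c * H (om 0)) * emeasure \<mu> {suffix 1 om}"
      using emeasure_letter_conc[OF s_sets(1), of "om 0"] om by simp
    then have "emeasure \<mu> {suffix 1 om} \<noteq> 0" using atom XJ_om by auto
    then have nz: "emeasure \<mu> X0J \<noteq> 0" using emeasure_mono[OF sub s_sets(2)] by auto
    have "X0J = (\<Union>w\<in>codeJ. (\<frown>) w ` X0J)"
      using codeJ_D conc_in_X0J by (blast elim: X0J_code_prefix)
    then have "emeasure \<mu> X0J = ?s * emeasure \<mu> X0J" using emeasure_UN_code[OF s_sets(2)] by simp
    then have "emeasure \<mu> X0J / emeasure \<mu> X0J = ?s * emeasure \<mu> X0J / emeasure \<mu> X0J" by simp
    moreover have "?s * emeasure \<mu> X0J / emeasure \<mu> X0J = ?s * (emeasure \<mu> X0J / emeasure \<mu> X0J)"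
      by (simp add: ennreal_times_divide)
    moreover have "emeasure \<mu> X0J / emeasure \<mu> X0J = 1"
      using nz emeasure_finite by (intro ennreal_divide_self) (auto simp: less_top[symmetric])
    ultimately have s: "?s = 1" by simp
    have disj: "om \<notin> (\<frown>) w ` XJ" if "w \<in> codeJ" for w
    proof
      assume "om \<in> (\<frown>) w ` XJ"
      then have "w = prefix (length w) om" by (metis (no_types, lifting) imageE prefix_conc_length)
      then show False using False codeJ_D[OF that] by (metis length_greater_0_conv)
    qed
    have U_sets: "(\<Union>w\<in>codeJ. (\<frown>) w ` XJ) \<in> sets \<mu>"
      using codeJ_D full_conc_sets by (intro sets.countable_UN'') auto
    have "1 + emeasure \<mu> {om} = emeasure \<mu> (\<Union>w\<in>codeJ. (\<frown>) w ` XJ) + emeasure \<mu> {om}"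
      using s emeasure_UN_code[of XJ] by simp
    also have "\<dots> = emeasure \<mu> ((\<Union>w\<in>codeJ. (\<frown>) w ` XJ) \<union> {om})"
      using disj U_sets singleton_sets_mu[OF om] by (intro plus_emeasure) auto
    also have "\<dots> \<le> 1 + 0" using emeasure_le_1 by simp
    finally have "emeasure \<mu> {om} \<le> 0" unfolding ennreal_add_left_cancel_le by simp
    then show False using atom XJ_om by simp
  qed
qed

lemma total_weight: "(\<integral>\<^sup>+w. wt c w \<partial>count_space codeJ) = 1"
proof -
  have U_sets: "(\<Union>w\<in>codeJ. (\<frown>) w ` XJ) \<in> sets \<mu>"
    using codeJ_D full_conc_sets by (intro sets.countable_UN'') auto
  have om_sets: "XJ \<inter> {om} \<in> sets \<mu>" using sets.Int[OF XJ_borel singleton_borel] by (simp add: sets_mu_iff)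
  have "XJ = (\<Union>w\<in>codeJ. (\<frown>) w ` XJ) \<union> (XJ \<inter> {om})"
    using XJ_minus_om_subset codeJ_D conc_in_XJ by blast
  then have "emeasure \<mu> XJ = emeasure \<mu> ((\<Union>w\<in>codeJ. (\<frown>) w ` XJ) \<union> (XJ \<inter> {om}))" by simp
  also have "\<dots> = emeasure \<mu> (\<Union>w\<in>codeJ. (\<frown>) w ` XJ)"
    by (rule emeasure_Un_null_set) (use U_sets om_sets emeasure_om in auto)
  finally show ?thesis using emeasure_UN_code[of XJ] by simp
qed

lemma emeasure_XJ_minus_X0J: "emeasure \<mu> (XJ - X0J) = 0"
proof -
  let ?f = "\<lambda>u. XJ \<inter> (\<frown>) u ` {om}"
  have "XJ - X0J \<subseteq> (\<Union>u. ?f u)"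
  proof
    fix x assume x: "x \<in> XJ - X0J"
    then obtain n where "suffix n x = om" by (auto simp: mem_XJ_iff mem_X0J_iff mem_X0_iff)
    then have "x = prefix n x \<frown> om" by (metis prefix_suffix)
    with x show "x \<in> (\<Union>u. ?f u)" by blast
  qed
  moreover have "?f u \<in> null_sets \<mu>" for u
  proof (cases "u \<frown> om \<in> XJ")
    case True
    then have om: "om \<in> XJ" using conc_in_XJ_D by blast
    then have "emeasure \<mu> ((\<frown>) u ` {om}) = ennreal (wt c u) * emeasure \<mu> {om}"
      using True by (intro emeasure_conc) (auto simp: singleton_sets_mu)
    also have "emeasure \<mu> {om} = 0" using emeasure_om om by simp
    finally show ?thesis using True by (auto simp: null_sets_def sets_mu_iff)
  qed auto
  then have "(\<Union>u. ?f u) \<in> null_sets \<mu>" by (intro null_sets_UN) auto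
  moreover have "XJ - X0J \<in> sets \<mu>" by (simp add: sets_mu_iff)
  ultimately have "XJ - X0J \<in> null_sets \<mu>" by (meson null_sets_subset)
  then show ?thesis by auto
qed

lemma emeasure_Int_X0J:
  assumes "B \<in> sets \<mu>"
  shows "emeasure \<mu> (B \<inter> X0J) = emeasure \<mu> B"
proof -
  have n: "B - X0J \<in> null_sets \<mu>"
    using assms emeasure_XJ_minus_X0J emeasure_mono[of "B - X0J" "XJ - X0J" \<mu>]
    by (auto simp: null_sets_def sets_mu_iff)
  have "B = (B \<inter> X0J) \<union> (B - X0J)" by auto
  then show ?thesis using emeasure_Un_null_set[OF _ n, of "B \<inter> X0J"] assms
    by (metis X0J_borel inf.coboundedI1 sets.Int sets_mu_iff)
qed

text \<open>A Borel set splits according to the first code word. This is the invariance equation of the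
  iterated function system of the maps \<open>y \<mapsto> w \<frown> y\<close>, \<open>w \<in> codeJ\<close>.\<close>

lemma emeasure_code_split:
  assumes B: "B \<in> sets \<mu>"
  shows "emeasure \<mu> B = (\<integral>\<^sup>+w. wt c w * emeasure \<mu> {y\<in>XJ. w \<frown> y \<in> B} \<partial>count_space codeJ)"
proof -
  let ?B = "\<lambda>w. {y\<in>XJ. w \<frown> y \<in> B}"
  have B_borel [measurable]: "B \<in> sets borel" using B by (simp add: sets_mu_iff)
  have sets: "?B w \<in> sets \<mu>" for w
  proof -
    have "{y\<in>space borel. y \<in> XJ \<and> w \<frown> y \<in> B} \<in> sets borel" by measurable
    then show ?thesis by (auto simp: sets_mu_iff)
  qed
  have conc_sets: "(\<frown>) w ` ?B w \<in> sets \<mu>" if "w \<in> codeJ" for w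
    using full_conc_sets[of w] codeJ_D[OF that] sets by blast
  note disj = codeJ_conc_disjoint[of ?B]
  have U_sets: "(\<Union>w\<in>codeJ. (\<frown>) w ` ?B w) \<in> sets \<mu>"
    using conc_sets by (intro sets.countable_UN'') auto
  have "(\<Union>w\<in>codeJ. (\<frown>) w ` ?B w) \<union> (B \<inter> {om}) = B"
    using XJ_minus_om_subset B by (fastforce simp: sets_mu_iff)
  moreover have "B \<inter> {om} \<in> null_sets \<mu>"
  proof (rule null_sets_subset[of "XJ \<inter> {om}"])
    show "XJ \<inter> {om} \<in> null_sets \<mu>"
      using emeasure_om by (auto simp: null_sets_def sets_mu_iff intro: sets.Int)
    show "B \<inter> {om} \<in> sets \<mu>" using B by (auto simp: sets_mu_iff intro: sets.Int)
  qed (use B in \<open>auto simp: sets_mu_iff\<close>)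
  ultimately have "emeasure \<mu> B = emeasure \<mu> (\<Union>w\<in>codeJ. (\<frown>) w ` ?B w)"
    using emeasure_Un_null_set[OF U_sets, of "B \<inter> {om}"] by (simp only:)
  also have "\<dots> = (\<integral>\<^sup>+w. emeasure \<mu> ((\<frown>) w ` ?B w) \<partial>count_space codeJ)"
    using conc_sets disj by (intro emeasure_UN_countable) auto
  also have "\<dots> = (\<integral>\<^sup>+w. wt c w * emeasure \<mu> (?B w) \<partial>count_space codeJ)"
    using codeJ_D sets by (intro nn_integral_cong emeasure_full_conc) auto
  finally show ?thesis .
qed

text \<open>Cylinders of arbitrary words split, up to \<open>\<Gamma>\<close>, into cylinders of full words.\<close>

lemma emeasure_cylinder:
  fixes a :: "nat list"
  assumes "sets N = sets \<mu>" "emeasure N (XJ - X0J) = 0"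
  shows "emeasure N (XJ \<inter> {x. prefix (length a) x = a}) =
    (\<integral>\<^sup>+u. emeasure N ((\<frown>) u ` XJ) \<partial>count_space (full_ext a))"
proof -
  let ?C = "XJ \<inter> {x. prefix (length a) x = a}"
  have sets: "(\<frown>) u ` XJ \<in> sets N" if "u \<in> full_ext a" for u
    using that full_conc_sets[of u XJ] assms(1) by (auto simp: full_ext_def)
  have disj: "disjoint_family_on (\<lambda>u. (\<frown>) u ` XJ) (full_ext a)"
  proof -
    have "v = w" if "v \<in> full_ext a" "w \<in> full_ext a" "x \<in> (\<frown>) v ` XJ" "x \<in> (\<frown>) w ` XJ" for v w x
    proof -
      from that(3,4) obtain y z where "x = v \<frown> y" "x = w \<frown> z" by blast
      then show ?thesis using full_ext_disjoint[of v a w y z] that(1,2) by simp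
    qed
    then show ?thesis unfolding disjoint_family_on_def by blast
  qed
  have C_sets: "?C \<in> sets N"
    using conc_image_borel[of UNIV a] assms(1) by (auto simp: sets_mu_iff conc_image_eq)
  have U_sets: "(\<Union>u\<in>full_ext a. (\<frown>) u ` XJ) \<in> sets N"
    using sets by (intro sets.countable_UN'') auto
  have U_sub: "(\<Union>u\<in>full_ext a. (\<frown>) u ` XJ) \<subseteq> ?C"
  proof
    fix x assume "x \<in> (\<Union>u\<in>full_ext a. (\<frown>) u ` XJ)"
    then obtain u y where u: "u \<in> full_ext a" "y \<in> XJ" "x = u \<frown> y" by blast
    then have "prefix (length a) x = take (length a) u"
      unfolding u(3) by (intro prefix_conc_fst) (simp add: full_ext_def)
    then show "x \<in> ?C" using u conc_in_XJ[of u y] by (auto simp: full_ext_def)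
  qed
  have "?C \<inter> X0J \<subseteq> (\<Union>u\<in>full_ext a. (\<frown>) u ` XJ)"
  proof
    fix x assume "x \<in> ?C \<inter> X0J"
    then have "x \<in> X0J" "prefix (length a) x = a" by auto
    then obtain u y where "u \<in> full_ext a" "y \<in> XJ" "x = u \<frown> y" by (rule ex_full_ext)
    then show "x \<in> (\<Union>u\<in>full_ext a. (\<frown>) u ` XJ)" by blast
  qed
  then have "?C - (\<Union>u\<in>full_ext a. (\<frown>) u ` XJ) \<subseteq> XJ - X0J" by auto
  moreover have "XJ - X0J \<in> sets N" using assms(1) by (simp add: sets_mu_iff)
  ultimately have "?C - (\<Union>u\<in>full_ext a. (\<frown>) u ` XJ) \<in> null_sets N"
    using assms(2) C_sets U_sets by (meson null_setsI null_sets_subset sets.Diff)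
  then have "emeasure N ?C = emeasure N (\<Union>u\<in>full_ext a. (\<frown>) u ` XJ)"
    using emeasure_Un_null_set[OF U_sets] U_sub by (metis Un_Diff_cancel Un_absorb1)
  also have "\<dots> = (\<integral>\<^sup>+u. emeasure N ((\<frown>) u ` XJ) \<partial>count_space (full_ext a))"
    using sets disj by (intro emeasure_UN_countable) auto
  finally show ?thesis .
qed

text \<open>A finite measure that does not charge \<open>\<Gamma>\<close> is determined by the cylinders of full words.\<close>

lemma measure_eqI_full_cylinders:
  assumes sets: "sets M = sets \<mu>" "sets N = sets \<mu>"
    and null: "emeasure M (XJ - X0J) = 0" "emeasure N (XJ - X0J) = 0"
    and fin: "emeasure M XJ \<noteq> \<infinity>"
    and eq: "\<And>u. full u \<Longrightarrow> u \<in> lists J \<Longrightarrow> emeasure M ((\<frown>) u ` XJ) = emeasure N ((\<frown>) u ` XJ)"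
  shows "M = N"
proof (rule measure_eqI_cylinders[OF XJ_borel _ _ fin])
  fix a :: "nat list"
  show "emeasure M (XJ \<inter> {x. prefix (length a) x = a}) = emeasure N (XJ \<inter> {x. prefix (length a) x = a})"
    unfolding emeasure_cylinder[OF sets(1) null(1)] emeasure_cylinder[OF sets(2) null(2)]
    using eq by (intro nn_integral_cong) (auto simp: full_ext_def)
qed (use sets sets_mu in auto)

end

lemma (in weighted_beta_shift) conformal_unique:
  assumes "0 < c" "conformal \<beta> J H c \<mu>" "0 < d" "conformal \<beta> J H d \<nu>"
  shows "c = d \<and> \<mu> = \<nu>"
proof -
  interpret M: conformal_measure \<beta> J H c \<mu> using assms by unfold_locales
  interpret N: conformal_measure \<beta> J H d \<nu> using assms by unfold_locales
  have cd: "c = d" by (rule total_weight_1_unique[OF assms(1) M.total_weight assms(3) N.total_weight])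
  have "\<mu> = \<nu>"
    using M.emeasure_XJ_minus_X0J N.emeasure_XJ_minus_X0J cd
    by (intro M.measure_eqI_full_cylinders) (auto simp: M.sets_mu N.sets_mu M.emeasure_full_cylinder N.emeasure_full_cylinder)
  with cd show ?thesis by blast
qed

section \<open>Existence of the conformal measure\<close>

text \<open>The concatenation of a sequence of nonempty words.\<close>

definition flatten :: "(nat \<Rightarrow> nat list) \<Rightarrow> nat \<Rightarrow> nat" where
  "flatten ws n = concat (prefix (Suc n) ws) ! n"

lemma length_concat_prefix:
  assumes "\<And>i. ws i \<noteq> []"
  shows "n \<le> length (concat (prefix n ws))"
proof (induction n)
  case (Suc n)
  then show ?case using assms[of n] by (cases "ws n") auto
qed simp

lemma flatten_nth:
  assumes "\<And>i. ws i \<noteq> []" "n < m"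
  shows "flatten ws n = concat (prefix m ws) ! n"
proof -
  have "prefix m ws = prefix (Suc n) ws @ (ws [Suc n \<rightarrow> m])"
    using subsequence_append[of ws "Suc n" "m - Suc n"] assms(2) by simp
  moreover have "n < length (concat (prefix (Suc n) ws))"
    using length_concat_prefix[of ws "Suc n"] assms(1) by simp
  ultimately show ?thesis unfolding flatten_def by (simp only: concat_append nth_append if_True)
qed

lemma prefix_flatten:
  assumes "\<And>i. ws i \<noteq> []"
  shows "prefix n (flatten ws) = take n (concat (prefix n ws))"
proof (rule nth_equalityI)
  show "length (prefix n (flatten ws)) = length (take n (concat (prefix n ws)))"
    using length_concat_prefix[of ws n] assms by simp
  fix i assume "i < length (prefix n (flatten ws))"
  then show "prefix n (flatten ws) ! i = take n (concat (prefix n ws)) ! i"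
    using flatten_nth[of ws i n] assms by simp
qed

lemma flatten_case_nat:
  assumes "w \<noteq> []" "\<And>i. ws i \<noteq> []"
  shows "flatten (case_nat w ws) = w \<frown> flatten ws"
proof
  fix n
  have ne: "case_nat w ws i \<noteq> []" for i using assms by (cases i) auto
  have eq: "prefix (Suc m) (case_nat w ws) = w # prefix m ws" for m
    by (rule nth_equalityI) (auto simp: nth_Cons split: nat.split simp del: subseq_to_Suc)
  show "flatten (case_nat w ws) n = (w \<frown> flatten ws) n"
  proof (cases "n < length w")
    case True
    then show ?thesis unfolding flatten_def eq by (simp add: nth_append)
  next
    case False
    have "n - length w < n" using False assms(1) by (cases w) auto
    then have "flatten ws (n - length w) = concat (prefix n ws) ! (n - length w)"
      using flatten_nth[of ws "n - length w" n] assms(2) by simp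
    then show ?thesis using False by (simp add: flatten_def eq nth_append del: subseq_to_Suc)
  qed
qed

text \<open>\<open>X\<close> is closed: membership can be tested on finite prefixes.\<close>

lemma (in beta_shift_space) X_closed:
  assumes "\<And>n. \<exists>z\<in>X. prefix n z = prefix n y"
  shows "y \<in> X"
proof -
  have approx: "\<exists>z\<in>X. \<forall>i<n. z i = y i" for n
  proof -
    obtain z where z: "z \<in> X" "prefix n z = prefix n y" using assms by blast
    have "z i = y i" if "i < n" for i
      using arg_cong[OF z(2), of "\<lambda>u. u ! i"] that by simp
    with z(1) show ?thesis by blast
  qed
  have "y n \<le> nat \<lfloor>\<beta>\<rfloor>" for n
  proof -
    obtain z where z: "z \<in> X" "\<forall>i<Suc n. z i = y i" using approx by blast
    then have "z n \<le> nat \<lfloor>\<beta>\<rfloor>" unfolding mem_X_iff by blast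
    then show ?thesis using z(2) by simp
  qed
  moreover have "y (k + n) \<le> om n" if eq: "\<forall>i<n. y (k + i) = om i" for k n
  proof -
    obtain z where z: "z \<in> X" "\<forall>i<Suc (k + n). z i = y i" using approx by blast
    have "\<forall>i<n. suffix k z i = om i" using eq z(2) by simp
    then have "suffix k z n \<le> om n" using z(1) unfolding mem_X_iff lex_le_iff by blast
    then show ?thesis using z(2) by simp
  qed
  ultimately show ?thesis unfolding mem_X_iff lex_le_iff by simp
qed

text \<open>Independent code words, drawn with probabilities equal to their weights, are concatenated.\<close>

locale normalised_weights = weighted_beta_shift +
  fixes c :: real
  assumes c_pos: "c > 0"
    and total_weight: "(\<integral>\<^sup>+w. wt c w \<partial>count_space codeJ) = 1"
begin

text \<open>The distribution of a random code word.\<close>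

definition code_pmf :: "nat list pmf" where
  "code_pmf = embed_pmf (\<lambda>w. if w \<in> codeJ then wt c w else 0)"

lemma wt_codeJ_pos: "w \<in> codeJ \<Longrightarrow> wt c w > 0"
  using c_pos by (auto simp: codeJ_def intro!: wt_pos)

lemma pmf_code_pmf: "pmf code_pmf w = (if w \<in> codeJ then wt c w else 0)"
  unfolding code_pmf_def
proof (rule pmf_embed_pmf)
  have "(\<integral>\<^sup>+w. ennreal (if w \<in> codeJ then wt c w else 0) \<partial>count_space UNIV)
      = (\<integral>\<^sup>+w. ennreal (wt c w) * indicator codeJ w \<partial>count_space UNIV)"
    by (intro nn_integral_cong) (auto split: split_indicator)
  also have "\<dots> = (\<integral>\<^sup>+w. wt c w \<partial>count_space codeJ)"
    by (subst nn_integral_count_space_indicator) auto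
  finally show "(\<integral>\<^sup>+w. ennreal (if w \<in> codeJ then wt c w else 0) \<partial>count_space UNIV) = 1"
    by (simp add: total_weight)
qed (auto intro: less_imp_le wt_codeJ_pos)

lemma set_code_pmf: "set_pmf code_pmf = codeJ"
  by (auto simp: set_pmf_eq pmf_code_pmf dest: wt_codeJ_pos)

lemma nn_integral_code_pmf:
  fixes f :: "nat list \<Rightarrow> ennreal"
  shows "(\<integral>\<^sup>+w. f w \<partial>measure_pmf code_pmf) = (\<integral>\<^sup>+w. wt c w * f w \<partial>count_space codeJ)"
proof -
  have "(\<integral>\<^sup>+w. f w \<partial>measure_pmf code_pmf) = (\<integral>\<^sup>+w. ennreal (pmf code_pmf w) * f w \<partial>count_space UNIV)"
    by (rule nn_integral_measure_pmf)
  also have "\<dots> = (\<integral>\<^sup>+w. (wt c w * f w) * indicator codeJ w \<partial>count_space UNIV)"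
    by (intro nn_integral_cong) (auto simp: pmf_code_pmf split: split_indicator)
  also have "\<dots> = (\<integral>\<^sup>+w. wt c w * f w \<partial>count_space codeJ)"
    by (subst nn_integral_count_space_indicator) auto
  finally show ?thesis .
qed

text \<open>Two distinct code words have total weight at most 1, so all weights are bounded away from 1.\<close>

lemma wt_codeJ_bound: "\<exists>\<kappa><1. 0 \<le> \<kappa> \<and> (\<forall>w\<in>codeJ. wt c w \<le> \<kappa>)"
proof -
  obtain u v where uv: "u \<in> codeJ" "v \<in> codeJ" "u \<noteq> v" using codeJ_two_elements by blast
  have sum_le: "wt c w + wt c w' \<le> 1" if "w \<in> codeJ" "w' \<in> codeJ" "w \<noteq> w'" for w w'
  proof -
    have "measure_pmf.prob code_pmf {w, w'} = pmf code_pmf w + pmf code_pmf w'"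
      using that by (subst measure_measure_pmf_finite) auto
    then show ?thesis using measure_pmf.prob_le_1[of code_pmf "{w, w'}"] that by (simp add: pmf_code_pmf)
  qed
  define m where "m = min (wt c u) (wt c v)"
  have m: "0 < m" using wt_codeJ_pos uv by (simp add: m_def)
  have "wt c w \<le> 1 - m" if "w \<in> codeJ" for w
    using sum_le[OF that uv(1)] sum_le[OF that uv(2)] uv(3) by (cases "w = u") (auto simp: m_def)
  moreover have "0 \<le> 1 - m" using calculation[OF uv(1)] wt_codeJ_pos[OF uv(1)] by simp
  ultimately show ?thesis using m by (intro exI[of _ "1 - m"]) auto
qed

sublocale words: product_prob_space "\<lambda>_. measure_pmf code_pmf" "UNIV :: nat set"
  by unfold_locales

sublocale words: sequence_space "measure_pmf code_pmf"
  by unfold_locales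

abbreviation words_space :: "(nat \<Rightarrow> nat list) measure" where
  "words_space \<equiv> \<Pi>\<^sub>M i\<in>UNIV. measure_pmf code_pmf"

lemma measurable_word: "(\<lambda>ws. ws i) \<in> words_space \<rightarrow>\<^sub>M count_space UNIV"
proof -
  have "(\<lambda>ws. ws i) \<in> words_space \<rightarrow>\<^sub>M measure_pmf code_pmf"
    by (rule measurable_component_singleton) simp
  then show ?thesis by (simp add: measurable_pmf_measure2)
qed

lemma measurable_words_prefix: "(\<lambda>ws. prefix n ws) \<in> words_space \<rightarrow>\<^sub>M count_space UNIV"
proof (induction n)
  case (Suc n)
  have "(\<lambda>ws. prefix n ws @ [ws n]) \<in> words_space \<rightarrow>\<^sub>M count_space UNIV"
    by (rule measurable_compose_countable'[OF _ Suc countableI_type])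
       (rule measurable_compose[OF measurable_word], simp)
  then show ?case by simp
qed simp

lemma measurable_flatten [measurable]: "flatten \<in> words_space \<rightarrow>\<^sub>M borel"
proof (rule measurable_sequenceI)
  fix n
  show "(\<lambda>ws. flatten ws n) \<in> words_space \<rightarrow>\<^sub>M count_space UNIV"
    unfolding flatten_def by (rule measurable_compose[OF measurable_words_prefix]) simp
qed

lemma AE_words: "AE ws in words_space. \<forall>i. ws i \<in> codeJ"
  unfolding AE_all_countable
proof
  fix i
  have "AE w in measure_pmf code_pmf. w \<in> codeJ" by (simp add: AE_measure_pmf_iff set_code_pmf)
  then show "AE ws in words_space. ws i \<in> codeJ"
    by (intro AE_PiM_component) (auto intro: measure_pmf.prob_space_axioms)
qed

lemma flatten_in_XJ:
  assumes ws: "\<And>i. ws i \<in> codeJ"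
  shows "flatten ws \<in> XJ"
proof -
  have ne: "ws i \<noteq> []" for i using codeJ_D[OF ws] by blast
  have full: "full (concat (prefix n ws))" for n
    by (induction n) (use codeJ_D[OF ws] full_append in auto)
  have J: "concat (prefix n ws) \<in> lists J" for n
    by (induction n) (use codeJ_D[OF ws] in auto)
  have "flatten ws \<in> X"
  proof (rule X_closed)
    fix n
    have "concat (prefix n ws) \<frown> om \<in> X" using full full_concD om_in_X by blast
    moreover have "prefix n (concat (prefix n ws) \<frown> om) = prefix n (flatten ws)"
      using length_concat_prefix[of ws n] ne prefix_flatten[of ws n] by simp
    ultimately show "\<exists>z\<in>X. prefix n z = prefix n (flatten ws)" by blast
  qed
  moreover have "flatten ws n \<in> J" for n
    using J[of "Suc n"] length_concat_prefix[of ws "Suc n"] ne unfolding flatten_def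
    by (meson Suc_le_lessD in_lists_conv_set nth_mem)
  ultimately show ?thesis by (auto simp: mem_XJ_iff)
qed

text \<open>The law of the concatenation, as a measure on the space of all sequences.\<close>

definition code_law :: "(nat \<Rightarrow> nat) measure" where
  "code_law = distr words_space borel flatten"

lemma sets_code_law [simp, measurable_cong]: "sets code_law = sets borel"
  by (simp add: code_law_def)

lemma space_code_law [simp]: "space code_law = UNIV"
  by (simp add: code_law_def)

lemma prob_space_code_law: "prob_space code_law"
  unfolding code_law_def by (intro words.prob_space_distr) measurable

lemma AE_code_law_XJ: "AE x in code_law. x \<in> XJ"
  unfolding code_law_def
  by (subst AE_distr_iff) (use AE_words flatten_in_XJ in \<open>auto elim: eventually_mono\<close>)

text \<open>The first code word is independent of the remaining ones, which have the same joint law as all of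
  them.\<close>

lemma emeasure_code_law_split:
  assumes B [measurable]: "B \<in> sets borel"
  shows "emeasure code_law B = (\<integral>\<^sup>+w. wt c w * emeasure code_law {y. w \<frown> y \<in> B} \<partial>count_space codeJ)"
proof -
  have case_m [measurable]: "(\<lambda>(w, ws). case_nat w ws) \<in> measure_pmf code_pmf \<Otimes>\<^sub>M words_space \<rightarrow>\<^sub>M words_space"
    unfolding split_beta' by (intro measurable_case_nat' measurable_fst measurable_snd)
  have law: "emeasure code_law A = (\<integral>\<^sup>+ws. indicator A (flatten ws) \<partial>words_space)" if "A \<in> sets borel" for A
    unfolding code_law_def using that by (subst nn_integral_indicator[symmetric], simp, subst nn_integral_distr) auto
  have "emeasure code_law B = (\<integral>\<^sup>+ws. indicator B (flatten ws) \<partial>words_space)"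
    by (rule law[OF B])
  also have "\<dots> = (\<integral>\<^sup>+ws. indicator B (flatten ws) \<partial>distr (measure_pmf code_pmf \<Otimes>\<^sub>M words_space) words_space (\<lambda>(w, ws). case_nat w ws))"
    by (subst words.PiM_iter) simp
  also have "\<dots> = (\<integral>\<^sup>+z. indicator B (flatten (case z of (w, ws) \<Rightarrow> case_nat w ws)) \<partial>(measure_pmf code_pmf \<Otimes>\<^sub>M words_space))"
    by (rule nn_integral_distr) measurable
  also have "\<dots> = (\<integral>\<^sup>+w. \<integral>\<^sup>+ws. indicator B (flatten (case_nat w ws)) \<partial>words_space \<partial>measure_pmf code_pmf)"
    by (subst sigma_finite_measure.nn_integral_fst[OF prob_space_imp_sigma_finite[OF words.prob_space_axioms], symmetric])
      auto
  also have "\<dots> = (\<integral>\<^sup>+w. wt c w * (\<integral>\<^sup>+ws. indicator B (flatten (case_nat w ws)) \<partial>words_space) \<partial>count_space codeJ)"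
    by (rule nn_integral_code_pmf)
  also have "\<dots> = (\<integral>\<^sup>+w. wt c w * emeasure code_law {y. w \<frown> y \<in> B} \<partial>count_space codeJ)"
  proof (intro nn_integral_cong arg_cong2[where f="(*)"] refl)
    fix w assume "w \<in> space (count_space codeJ)"
    then have w: "w \<noteq> []" using codeJ_D by auto
    have "{y \<in> space borel. w \<frown> y \<in> B} \<in> sets borel" by measurable
    then have E [measurable]: "{y. w \<frown> y \<in> B} \<in> sets borel" by simp
    have "(\<integral>\<^sup>+ws. indicator B (flatten (case_nat w ws)) \<partial>words_space)
        = (\<integral>\<^sup>+ws. indicator {y. w \<frown> y \<in> B} (flatten ws) \<partial>words_space)"
    proof (rule nn_integral_cong_AE)
      show "AE ws in words_space. (indicator B (flatten (case_nat w ws)) :: ennreal) =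
          indicator {y. w \<frown> y \<in> B} (flatten ws)"
        using AE_words
      proof eventually_elim
        case (elim ws)
        then have "flatten (case_nat w ws) = w \<frown> flatten ws"
          using w codeJ_D by (intro flatten_case_nat) auto
        then show ?case by (simp split: split_indicator)
      qed
    qed
    also have "\<dots> = emeasure code_law {y. w \<frown> y \<in> B}"
      by (rule law[symmetric, OF E])
    finally show "(\<integral>\<^sup>+ws. indicator B (flatten (case_nat w ws)) \<partial>words_space) = emeasure code_law {y. w \<frown> y \<in> B}" .
  qed
  finally show ?thesis .
qed

lemma emeasure_code_law_code_conc:
  assumes w: "w \<in> codeJ" and B: "B \<in> sets borel"
  shows "emeasure code_law ((\<frown>) w ` B) = wt c w * emeasure code_law B"
proof -
  have other: "{y. w' \<frown> y \<in> (\<frown>) w ` B} = {}" if "w' \<in> codeJ" "w' \<noteq> w" for w'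
  proof -
    have False if "w' \<frown> y = w \<frown> z" for y z
      using code_prefix_free[of w' w y z] that \<open>w' \<in> codeJ\<close> \<open>w' \<noteq> w\<close> w by (simp add: codeJ_def)
    then show ?thesis by blast
  qed
  have "emeasure code_law ((\<frown>) w ` B) =
      (\<integral>\<^sup>+w'. wt c w' * emeasure code_law {y. w' \<frown> y \<in> (\<frown>) w ` B} \<partial>count_space codeJ)"
    using B by (intro emeasure_code_law_split conc_image_borel)
  also have "\<dots> = (\<Sum>w'\<in>{w}. wt c w' * emeasure code_law {y. w' \<frown> y \<in> (\<frown>) w ` B})"
    by (rule nn_integral_count_space') (use w other in auto)
  also have "\<dots> = wt c w * emeasure code_law B" by (simp add: image_iff)
  finally show ?thesis .
qed

lemma emeasure_code_law_full_conc:
  assumes "full u" "u \<in> lists J" "B \<in> sets borel"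
  shows "emeasure code_law ((\<frown>) u ` B) = wt c u * emeasure code_law B"
  using assms(1,2)
proof (induction u rule: full_induct)
  case (append w v)
  have w: "w \<in> codeJ" and v: "v \<in> lists J" using append by (auto simp: codeJ_def)
  have "(\<frown>) (w @ v) ` B = (\<frown>) w ` (\<frown>) v ` B" by (simp add: image_image)
  then have "emeasure code_law ((\<frown>) (w @ v) ` B) = wt c w * (wt c v * emeasure code_law B)"
    using append.IH[OF v] emeasure_code_law_code_conc[OF w conc_image_borel[OF assms(3)]] by simp
  then show ?case using wt_codeJ_pos[OF w] wt_pos[OF c_pos v] by (simp add: ennreal_mult mult.assoc)
qed simp

text \<open>A point is prefixed by at most one code word, so its mass is at most the \<open>n\<close>-th power of the
  largest weight for every \<open>n\<close>.\<close>

lemma emeasure_code_law_singleton: "emeasure code_law {x} = 0"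
proof -
  interpret L: prob_space code_law by (rule prob_space_code_law)
  obtain \<kappa> where \<kappa>: "0 \<le> \<kappa>" "\<kappa> < 1" and wt_le: "\<And>w. w \<in> codeJ \<Longrightarrow> wt c w \<le> \<kappa>"
    using wt_codeJ_bound by blast
  have le: "emeasure code_law {x} \<le> ennreal (\<kappa> ^ n)" for n x
  proof (induction n arbitrary: x)
    case 0
    show ?case using L.emeasure_le_1 by simp
  next
    case (Suc n)
    show ?case
    proof (cases "\<exists>w\<in>codeJ. \<exists>y. x = w \<frown> y")
      case True
      then obtain w y where w: "w \<in> codeJ" "x = w \<frown> y" by blast
      have "emeasure code_law {x} = wt c w * emeasure code_law {y}"
        using emeasure_code_law_code_conc[OF w(1), of "{y}"] w(2) by simp
      also have "\<dots> \<le> ennreal \<kappa> * ennreal (\<kappa> ^ n)"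
        using Suc wt_le[OF w(1)] by (intro mult_mono ennreal_leI) auto
      also have "\<dots> = ennreal (\<kappa> ^ Suc n)" using \<kappa>(1) by (simp add: ennreal_mult)
      finally show ?thesis .
    next
      case False
      then have empty: "{y. w \<frown> y \<in> {x}} = {}" if "w \<in> codeJ" for w using that by auto
      have "emeasure code_law {x} = (\<integral>\<^sup>+w. wt c w * emeasure code_law {y. w \<frown> y \<in> {x}} \<partial>count_space codeJ)"
        by (rule emeasure_code_law_split) simp
      also have "\<dots> = (\<integral>\<^sup>+w. 0 \<partial>count_space codeJ)"
        by (rule nn_integral_cong) (simp only: empty space_count_space emeasure_empty mult_zero_right)
      finally show ?thesis by simp
    qed
  qed
  have le': "measure code_law {x} \<le> \<kappa> ^ n" for n
    using le[of x n] \<kappa>(1) by (simp add: L.emeasure_eq_measure)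
  have "measure code_law {x} = 0"
  proof (rule ccontr)
    assume "measure code_law {x} \<noteq> 0"
    then have "measure code_law {x} > 0" by (simp add: zero_less_measure_iff)
    then obtain n where "\<kappa> ^ n < measure code_law {x}" using real_arch_pow_inv \<kappa>(2) by blast
    with le'[of n] show False by simp
  qed
  then show ?thesis by (simp add: L.emeasure_eq_measure)
qed

text \<open>The law of the concatenation as a measure on \<open>XJ\<close>.\<close>

definition conformal_law :: "(nat \<Rightarrow> nat) measure" where
  "conformal_law = restrict_space code_law XJ"

lemma emeasure_conformal_law: "B \<subseteq> XJ \<Longrightarrow> emeasure conformal_law B = emeasure code_law B"
  unfolding conformal_law_def by (rule emeasure_restrict_space) auto

text \<open>Removing the first letter of a code word leaves a full word. So the two sides of the
  conformality identity can be compared on each cylinder of a code word; what is left is at most the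
  point \<open>suffix 1 om\<close>, which carries no mass.\<close>

lemma emeasure_code_law_letter:
  assumes B: "B \<in> sets borel" "B \<subseteq> XJ" and j: "\<And>x. x \<in> B \<Longrightarrow> x 0 = j" "j \<in> J"
  shows "emeasure code_law B = ennreal (c * H j) * emeasure code_law {y. [j] \<frown> y \<in> B}"
proof -
  let ?D = "{y. [j] \<frown> y \<in> B}"
  let ?E = "\<lambda>w. {y. w \<frown> y \<in> B}"
  let ?U = "\<Union>w\<in>codeJ. (\<frown>) (tl w) ` ?E w"
  note [measurable] = B(1)
  have E_borel [measurable]: "?E w \<in> sets borel" for w
  proof -
    have "{y \<in> space borel. w \<frown> y \<in> B} \<in> sets borel" by measurable
    then show ?thesis by simp
  qed
  have hd: "w = j # tl w" if "w \<in> codeJ" "w \<frown> y \<in> B" for w y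
  proof -
    have "(w \<frown> y) 0 = j" using j(1) that(2) by blast
    then show ?thesis using codeJ_D[OF that(1)] by (cases w) auto
  qed
  have disj: "disjoint_family_on (\<lambda>w. (\<frown>) (tl w) ` ?E w) codeJ"
  proof -
    have "v = w" if v: "v \<in> codeJ" "v \<frown> y \<in> B" and w: "w \<in> codeJ" "w \<frown> z \<in> B"
      and eq: "tl v \<frown> y = tl w \<frown> z" for v w y z
    proof -
      have "v \<frown> y = [j] \<frown> (tl v \<frown> y)" using hd[OF v] by (metis append_Cons append_Nil conc_conc)
      moreover have "w \<frown> z = [j] \<frown> (tl w \<frown> z)" using hd[OF w] by (metis append_Cons append_Nil conc_conc)
      ultimately have "v \<frown> y = w \<frown> z" using eq by simp
      then show ?thesis using code_prefix_free[of v w y z] v(1) w(1) by (simp add: codeJ_def)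
    qed
    then show ?thesis unfolding disjoint_family_on_def by blast
  qed
  have U_borel: "?U \<in> sets borel"
    using conc_image_borel E_borel by (intro sets.countable_UN'') auto
  have U_sub: "?U \<subseteq> ?D"
  proof
    fix x assume "x \<in> ?U"
    then obtain w y where w: "w \<in> codeJ" "w \<frown> y \<in> B" "x = tl w \<frown> y" by blast
    have "[j] \<frown> x = w \<frown> y" using hd[OF w(1,2)] w(3) by (metis append_Cons append_Nil conc_conc)
    then show "x \<in> ?D" using w(2) by simp
  qed
  have D_sub: "?D \<subseteq> ?U \<union> {suffix 1 om}"
  proof
    fix y assume y: "y \<in> ?D"
    show "y \<in> ?U \<union> {suffix 1 om}"
    proof (cases "[j] \<frown> y = om")
      case True
      then have "y = suffix 1 om" by (metis One_nat_def length_Cons list.size(3) suffix_conc_length)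
      then show ?thesis by simp
    next
      case False
      then have "[j] \<frown> y \<in> XJ - {om}" using y B(2) by auto
      then obtain w z where w: "w \<in> codeJ" "[j] \<frown> y = w \<frown> z" using XJ_minus_om_subset by blast
      then have wB: "w \<frown> z \<in> B" using y by simp
      have "[j] \<frown> y = [j] \<frown> (tl w \<frown> z)"
        using w(2) hd[OF w(1) wB] by (metis append_Cons append_Nil conc_conc)
      then have "y = tl w \<frown> z" by (simp del: conc_conc)
      then show ?thesis using w(1) wB by blast
    qed
  qed
  have "{suffix 1 om} \<in> null_sets code_law"
    using emeasure_code_law_singleton by auto
  then have "emeasure code_law (?U \<union> {suffix 1 om}) = emeasure code_law ?U"
    using U_borel by (intro emeasure_Un_null_set) auto
  then have "emeasure code_law ?D = emeasure code_law ?U"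
    using emeasure_mono[OF D_sub, of code_law] emeasure_mono[OF U_sub, of code_law]
      sets.Un[OF U_borel singleton_borel] E_borel[of "[j]"]
    by (intro antisym) (simp_all only: sets_code_law)
  also have "\<dots> = (\<integral>\<^sup>+w. emeasure code_law ((\<frown>) (tl w) ` ?E w) \<partial>count_space codeJ)"
    using disj conc_image_borel E_borel by (intro emeasure_UN_countable) auto
  finally have "ennreal (c * H j) * emeasure code_law ?D =
      (\<integral>\<^sup>+w. ennreal (c * H j) * emeasure code_law ((\<frown>) (tl w) ` ?E w) \<partial>count_space codeJ)"
    by (simp add: nn_integral_cmult)
  also have "\<dots> = (\<integral>\<^sup>+w. wt c w * emeasure code_law (?E w) \<partial>count_space codeJ)"
  proof (rule nn_integral_cong)
    fix w assume "w \<in> space (count_space codeJ)"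
    then have w: "w \<in> codeJ" by simp
    show "ennreal (c * H j) * emeasure code_law ((\<frown>) (tl w) ` ?E w) = wt c w * emeasure code_law (?E w)"
    proof (cases "?E w = {}")
      case False
      then have wj: "w = j # tl w" using hd[OF w] by blast
      have full: "full (tl w)" using codeJ_D[OF w] full_appendD[of "[j]" "tl w"] wj by simp
      have J: "tl w \<in> lists J" using codeJ_D[OF w] wj by (metis Cons_in_lists_iff)
      have "ennreal (c * H j) * emeasure code_law ((\<frown>) (tl w) ` ?E w) =
          ennreal (c * H j) * (ennreal (wt c (tl w)) * emeasure code_law (?E w))"
        using emeasure_code_law_full_conc[OF full J E_borel] by simp
      also have "\<dots> = ennreal (c * H j * wt c (tl w)) * emeasure code_law (?E w)"
        using c_pos H_pos[OF j(2)] wt_pos[OF c_pos J] by (simp add: ennreal_mult mult.assoc)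
      also have "c * H j * wt c (tl w) = wt c w" using wt_Cons[of c j "tl w"] wj by simp
      finally show ?thesis .
    qed simp
  qed
  also have "\<dots> = emeasure code_law B" by (rule emeasure_code_law_split[symmetric]) (rule B(1))
  finally show ?thesis by simp
qed

lemma conformal_conformal_law: "conformal \<beta> J H c conformal_law"
  unfolding conformal_def
proof (intro conjI allI ballI impI)
  interpret L: prob_space code_law by (rule prob_space_code_law)
  show sets: "sets conformal_law = sets (restrict_space borel XJ)"
    unfolding conformal_law_def by (rule sets_restrict_space_cong) simp
  have "emeasure code_law XJ = 1"
    using AE_code_law_XJ by (intro L.emeasure_eq_1_AE) auto
  then show "prob_space conformal_law"
    unfolding conformal_law_def by (intro prob_space_restrict_space) auto
  fix j B assume "B \<in> sets conformal_law" and j: "\<forall>x\<in>B. x 0 = j"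
  then have Bs: "B \<in> sets conformal_law" and B: "B \<in> sets borel" "B \<subseteq> XJ"
    by (auto simp: sets sets_restrict_space_iff)
  show "emeasure conformal_law (shift ` B) =
      (\<integral>\<^sup>+x\<in>B. ennreal (1 / (c * H (x 0))) \<partial>conformal_law)"
  proof (cases "j \<in> J")
    case False
    have "x 0 \<in> J" if "x \<in> B" for x using subsetD[OF B(2) that] by (auto simp: mem_XJ_iff)
    with False j have "B = {}" by auto
    then show ?thesis by simp
  next
    case True
    have cH: "c * H j > 0" using c_pos H_pos[OF True] by simp
    have shift_eq: "shift x = suffix 1 x" for x by (simp add: shift_def suffix_def)
    have "shift ` B = {y. [j] \<frown> y \<in> B}"
    proof (intro set_eqI iffI)
      fix y assume "y \<in> shift ` B"
      then obtain x where x: "x \<in> B" "y = suffix 1 x" by (auto simp: shift_eq)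
      then have "[j] \<frown> y = x" using j prefix_suffix[of x 1] by simp
      then show "y \<in> {y. [j] \<frown> y \<in> B}" using x(1) by simp
    next
      fix y assume "y \<in> {y. [j] \<frown> y \<in> B}"
      moreover have "y = shift ([j] \<frown> y)" by (simp add: shift_def)
      ultimately show "y \<in> shift ` B" by blast
    qed
    moreover have "shift ` B \<subseteq> XJ"
    proof
      fix y assume "y \<in> shift ` B"
      then obtain x where "x \<in> XJ" "y = suffix 1 x" using B(2) by (auto simp: shift_eq)
      then show "y \<in> XJ" by (auto simp: mem_XJ_iff suffix_in_X)
    qed
    ultimately have D: "emeasure conformal_law (shift ` B) = emeasure code_law {y. [j] \<frown> y \<in> B}"
      by (simp add: emeasure_conformal_law)
    have "(\<integral>\<^sup>+x\<in>B. ennreal (1 / (c * H (x 0))) \<partial>conformal_law) =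
        (\<integral>\<^sup>+x. ennreal (1 / (c * H j)) * indicator B x \<partial>conformal_law)"
      using j by (intro nn_integral_cong) (auto split: split_indicator)
    also have "\<dots> = ennreal (1 / (c * H j)) * emeasure code_law B"
      using Bs B by (simp add: nn_integral_cmult_indicator emeasure_conformal_law)
    also have "\<dots> = (ennreal (1 / (c * H j)) * ennreal (c * H j)) * emeasure code_law {y. [j] \<frown> y \<in> B}"
      using emeasure_code_law_letter[OF B _ True] j by (simp add: mult.assoc)
    also have "ennreal (1 / (c * H j)) * ennreal (c * H j) = 1"
      using cH by (subst ennreal_mult[symmetric]) auto
    finally show ?thesis using D by simp
  qed
qed

end

lemma (in weighted_beta_shift) ex_conformal: "\<exists>c \<mu>. c > 0 \<and> conformal \<beta> J H c \<mu>"
proof -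
  obtain c where c: "c > 0" "(\<integral>\<^sup>+w. wt c w \<partial>count_space codeJ) = 1"
    using ex_total_weight_1 by blast
  interpret normalised_weights \<beta> J H c using c by unfold_locales
  show ?thesis using c conformal_conformal_law by blast
qed

section \<open>The product property\<close>

context beta_shift_space
begin

lemma cylinder_eq: "cylinder \<beta> u = {x\<in>X. prefix (length u) x = u}"
proof -
  have "(\<forall>i<length u. x i = u ! i) \<longleftrightarrow> prefix (length u) x = u" for x
  proof
    show "prefix (length u) x = u" if "\<forall>i<length u. x i = u ! i"
      using that by (intro nth_equalityI) auto
    show "\<forall>i<length u. x i = u ! i" if "prefix (length u) x = u"
      using arg_cong[OF that, of "\<lambda>v. v ! i" for i] by (metis add_0 diff_zero subsequence_nth)
  qed
  then show ?thesis by (simp add: cylinder_def)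
qed

lemma shift_cylinder_eq_X_iff: "(shift ^^ length u) ` cylinder \<beta> u = X \<longleftrightarrow> full u"
proof
  assume eq: "(shift ^^ length u) ` cylinder \<beta> u = X"
  show "full u" unfolding full_def
  proof
    fix y assume "y \<in> X"
    then obtain x where x: "x \<in> cylinder \<beta> u" "y = suffix (length u) x"
      using eq by (auto simp: shift_funpow)
    then have "u \<frown> y = x" using prefix_suffix[of x "length u"] by (simp add: cylinder_eq)
    then show "u \<frown> y \<in> X" using x(1) by (simp add: cylinder_eq)
  qed
next
  assume full: "full u"
  show "(shift ^^ length u) ` cylinder \<beta> u = X"
  proof
    show "(shift ^^ length u) ` cylinder \<beta> u \<subseteq> X"
      by (auto simp: shift_funpow cylinder_eq suffix_in_X)
    show "X \<subseteq> (shift ^^ length u) ` cylinder \<beta> u"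
    proof
      fix y assume "y \<in> X"
      then have "u \<frown> y \<in> cylinder \<beta> u" using full_concD[OF full] by (simp add: cylinder_eq)
      moreover have "y = (shift ^^ length u) (u \<frown> y)" by (simp add: shift_funpow)
      ultimately show "y \<in> (shift ^^ length u) ` cylinder \<beta> u" by blast
    qed
  qed
qed

text \<open>So \<^const>\<open>psi\<close> is the length of the shortest nonempty full prefix, that is, of the first code
  word.\<close>

lemma psi_eq: "psi \<beta> x = (LEAST N. 1 \<le> N \<and> full (prefix N x))"
proof -
  have "map x [0..<N] = prefix N x" for N by (simp add: subsequence_def)
  then show ?thesis using shift_cylinder_eq_X_iff[of "prefix N x" for N] by (simp add: psi_def)
qed

lemma psi_code_conc:
  assumes "w \<in> code"
  shows "psi \<beta> (w \<frown> y) = length w"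
  unfolding psi_eq
proof (rule Least_equality)
  show "1 \<le> length w \<and> full (prefix (length w) (w \<frown> y))"
    using code_full[OF assms] code_nonempty[OF assms]
    by (simp only: prefix_conc_length) (simp add: Suc_le_eq)
  fix N assume N: "1 \<le> N \<and> full (prefix N (w \<frown> y))"
  show "length w \<le> N"
  proof (rule ccontr)
    assume "\<not> length w \<le> N"
    with N have "full (take N w)" by simp
    with N \<open>\<not> length w \<le> N\<close> assms show False by (simp add: code_def)
  qed
qed

lemma induced_shift_code_conc: "w \<in> code \<Longrightarrow> induced_shift \<beta> (w \<frown> y) = y"
  by (simp add: induced_shift_def psi_code_conc shift_funpow)

lemma alpha_tilde_code:
  assumes "A \<in> alpha_tilde \<beta>"
  shows "\<exists>w\<in>code. A = (\<frown>) w ` X0"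
proof -
  from assms obtain a n where a: "a \<in> alpha \<beta> n" "A = a \<inter> X0" "a \<inter> X0 \<noteq> {}"
    and psi: "\<forall>x\<in>a \<inter> X0. psi \<beta> x = n"
    unfolding alpha_tilde_def by blast
  obtain u where u: "a = cylinder \<beta> u" "length u = n" using a(1) by (auto simp: alpha_def)
  obtain x where x: "x \<in> a" "x \<in> X0" using a(3) by blast
  obtain w y where w: "w \<in> code" "x = w \<frown> y" using X0_code_prefix[OF x(2)] by metis
  have "n = length w" using psi x psi_code_conc[OF w(1), of y] w(2) by auto
  then have "length u = length w" using u(2) by simp
  moreover have "prefix (length u) x = u" using x(1) unfolding u(1) cylinder_eq by simp
  ultimately have "u = w" unfolding w(2) by (simp only: prefix_conc_length)
  have "A = (\<frown>) w ` X0"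
  proof
    show "A \<subseteq> (\<frown>) w ` X0"
      using suffix_in_X0 unfolding a(2) u(1) \<open>u = w\<close> cylinder_eq conc_image_eq by auto
    show "(\<frown>) w ` X0 \<subseteq> A"
      using conc_in_X0[OF code_full[OF w(1)]] X0_subset_X unfolding a(2) u(1) \<open>u = w\<close> cylinder_eq by auto
  qed
  with w(1) show ?thesis by blast
qed

text \<open>Prescribing the elements of \<open>alpha_tilde\<close> visited by the first iterates of the induced shift means
  prescribing the first code words.\<close>

lemma induced_shift_cylinder:
  assumes "ws \<in> lists code"
  shows "x \<in> X0 \<and> (\<forall>j<length ws. (induced_shift \<beta> ^^ j) x \<in> (\<frown>) (ws ! j) ` X0) \<longleftrightarrow>
    x \<in> (\<frown>) (concat ws) ` X0"
  using assms
proof (induction ws arbitrary: x)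
  case (Cons w ws)
  have w: "w \<in> code" using Cons.hyps by simp
  have full: "full w" using w by (rule code_full)
  show ?case
  proof
    assume x: "x \<in> X0 \<and> (\<forall>j<length (w # ws). (induced_shift \<beta> ^^ j) x \<in> (\<frown>) ((w # ws) ! j) ` X0)"
    then have "(induced_shift \<beta> ^^ 0) x \<in> (\<frown>) ((w # ws) ! 0) ` X0" by blast
    then obtain y where y: "x = w \<frown> y" "y \<in> X0" by auto
    have "(induced_shift \<beta> ^^ j) y \<in> (\<frown>) (ws ! j) ` X0" if "j < length ws" for j
      using conjunct2[OF x, rule_format, of "Suc j"] that y(1)
      by (simp add: funpow_swap1 induced_shift_code_conc[OF w])
    then have "y \<in> (\<frown>) (concat ws) ` X0" using Cons.IH[of y] y(2) by blast
    then show "x \<in> (\<frown>) (concat (w # ws)) ` X0" using y(1) by auto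
  next
    assume "x \<in> (\<frown>) (concat (w # ws)) ` X0"
    then obtain z where z: "z \<in> X0" "x = w \<frown> (concat ws \<frown> z)" by auto
    define y where "y = concat ws \<frown> z"
    have "y \<in> (\<frown>) (concat ws) ` X0" using z(1) by (simp add: y_def)
    then have y: "y \<in> X0" "\<And>j. j < length ws \<Longrightarrow> (induced_shift \<beta> ^^ j) y \<in> (\<frown>) (ws ! j) ` X0"
      using Cons.IH[of y] by blast+
    have x: "x = w \<frown> y" using z(2) by (simp add: y_def)
    have "(induced_shift \<beta> ^^ j) x \<in> (\<frown>) ((w # ws) ! j) ` X0" if "j < length (w # ws)" for j
    proof (cases j)
      case 0
      then show ?thesis using x y(1) by simp
    next
      case (Suc i)
      then show ?thesis using x y(2)[of i] that
        by (simp add: funpow_swap1 induced_shift_code_conc[OF w])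
    qed
    then show "x \<in> X0 \<and> (\<forall>j<length (w # ws). (induced_shift \<beta> ^^ j) x \<in> (\<frown>) ((w # ws) ! j) ` X0)"
      using conc_in_X0[OF full y(1)] x by blast
  qed
qed simp

end

context conformal_measure
begin

text \<open>The measure viewed as a measure on the whole \<open>\<beta>\<close>-shift.\<close>

abbreviation \<nu> :: "(nat \<Rightarrow> nat) measure" where "\<nu> \<equiv> on_beta_shift \<beta> \<mu>"

lemma sets_nu_iff: "B \<in> sets \<nu> \<longleftrightarrow> B \<in> sets borel \<and> B \<subseteq> X"
  by (auto simp: on_beta_shift_def sets_restrict_space_iff)

lemma space_nu [simp]: "space \<nu> = X"
  by (simp add: on_beta_shift_def space_restrict_space)

lemma measurable_id_nu: "(\<lambda>x. x) \<in> \<mu> \<rightarrow>\<^sub>M restrict_space borel X"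
  by (rule measurable_restrict_space2)
    (auto simp: mem_XJ_iff measurable_cong_sets[OF sets_mu refl] intro: measurable_restrict_space1)

lemma emeasure_nu: "B \<in> sets \<nu> \<Longrightarrow> emeasure \<nu> B = emeasure \<mu> (B \<inter> XJ)"
  using emeasure_distr[OF measurable_id_nu, of B]
  by (simp add: on_beta_shift_def vimage_def Collect_conj_eq)

lemma emeasure_nu_full_conc:
  assumes "full u"
  shows "emeasure \<nu> ((\<frown>) u ` X0) = (if u \<in> lists J then ennreal (wt c u) else 0)"
proof -
  have sets: "(\<frown>) u ` X0 \<in> sets \<nu>"
    using conc_in_X0[OF assms] X0_subset_X X0_borel by (auto simp: sets_nu_iff intro: conc_image_borel)
  show ?thesis
  proof (cases "u \<in> lists J")
    case True
    have "(\<frown>) u ` X0 \<inter> XJ = (\<frown>) u ` X0J"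
      using conc_in_XJ_D conc_in_XJ[OF assms True] X0_subset_X by (auto simp: X0J_eq)
    moreover have "X0J \<in> sets \<mu>" using X0J_subset_XJ by (simp add: sets_mu_iff)
    moreover have "emeasure \<mu> X0J = 1"
      using emeasure_Int_X0J[of XJ] X0J_subset_XJ by (simp add: inf.absorb2)
    ultimately show ?thesis
      using emeasure_nu[OF sets] emeasure_full_conc[OF assms True, of X0J] True by simp
  next
    case False
    then have "(\<frown>) u ` X0 \<inter> XJ = {}" using conc_in_XJ_D by blast
    then show ?thesis using emeasure_nu[OF sets] False by simp
  qed
qed

lemma product_measure_nu: "product_measure \<beta> \<nu>"
  unfolding product_measure_def
proof (intro conjI allI impI)
  show "prob_space \<nu>"
    unfolding on_beta_shift_def by (rule prob_space_distr[OF measurable_id_nu])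
  show "emeasure \<nu> X0 = 1" using emeasure_nu_full_conc[of "[]"] by simp
  fix n :: nat and A :: "nat \<Rightarrow> (nat \<Rightarrow> nat) set"
  assume "\<forall>j\<le>n. A j \<in> alpha_tilde \<beta>"
  then have "\<forall>j. \<exists>w. j \<le> n \<longrightarrow> w \<in> code \<and> A j = (\<frown>) w ` X0" using alpha_tilde_code by blast
  then obtain w where w: "\<And>j. j \<le> n \<Longrightarrow> w j \<in> code" "\<And>j. j \<le> n \<Longrightarrow> A j = (\<frown>) (w j) ` X0"
    by metis
  define ws where "ws = map w [0..<Suc n]"
  have nth: "ws ! j = w j" if "j \<le> n" for j using that by (simp add: ws_def del: upt_Suc)
  have length: "length ws = Suc n" by (simp add: ws_def)
  have ws: "ws \<in> lists code" using w(1) by (auto simp: ws_def)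
  have "(\<Inter>j\<le>n. {x \<in> X0. (induced_shift \<beta> ^^ j) x \<in> A j}) =
      {x. x \<in> X0 \<and> (\<forall>j<length ws. (induced_shift \<beta> ^^ j) x \<in> (\<frown>) (ws ! j) ` X0)}"
    using w(2) nth length by (auto simp: less_Suc_eq_le)
  also have "\<dots> = (\<frown>) (concat ws) ` X0"
    unfolding induced_shift_cylinder[OF ws] by simp
  finally have cyl: "(\<Inter>j\<le>n. {x \<in> X0. (induced_shift \<beta> ^^ j) x \<in> A j}) = (\<frown>) (concat ws) ` X0" .
  define v where "v u = (if u \<in> lists J then ennreal (wt c u) else 0)" for u
  have v_append: "v (s @ t) = v s * v t" for s t
    using wt_nonneg[of c s] wt_nonneg[of c t] c_pos by (auto simp: v_def ennreal_mult less_imp_le)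
  have "full (concat (map w [0..<m])) \<and> v (concat (map w [0..<m])) = (\<Prod>j<m. v (w j))" if "m \<le> Suc n" for m
    using that
  proof (induction m)
    case (Suc m)
    then have IH: "full (concat (map w [0..<m]))" "v (concat (map w [0..<m])) = (\<Prod>j<m. v (w j))"
      by auto
    have "full (w m)" using w(1)[of m] Suc.prems code_full by simp
    then show ?case using full_append[OF IH(1)] v_append IH(2) by simp
  qed (simp add: v_def)
  from this[of "Suc n"] have "full (concat ws)" "v (concat ws) = (\<Prod>j\<le>n. v (w j))"
    by (auto simp: ws_def lessThan_Suc_atMost simp del: upt_Suc)
  moreover have "emeasure \<nu> (A j) = v (w j)" if "j \<le> n" for j
    using emeasure_nu_full_conc[OF code_full[OF w(1)[OF that]]] w(2)[OF that] by (simp add: v_def)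
  ultimately show "emeasure \<nu> (\<Inter>j\<le>n. {x \<in> X0. (induced_shift \<beta> ^^ j) x \<in> A j}) = (\<Prod>j\<le>n. emeasure \<nu> (A j))"
    unfolding cyl using emeasure_nu_full_conc[of "concat ws"] by (simp add: v_def)
qed

end

section \<open>Invariance under finite permutations of coordinates\<close>

lemma prefix_comp_permutes:
  assumes "p permutes {..<n}"
  shows "mset (prefix n (x \<circ> p)) = mset (prefix n x)"
proof -
  have "prefix n (x \<circ> p) = permute_list p (prefix n x)"
    using permutes_in_image[OF assms]
    by (intro nth_equalityI) (auto simp: permute_list_def)
  then show ?thesis using assms by simp
qed

lemma exchange_relI:
  assumes "mset u = mset v" "u \<frown> y \<in> A" "v \<frown> y \<in> A"
  shows "(u \<frown> y, v \<frown> y) \<in> exchange_rel A"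
proof -
  obtain p where p: "p permutes {..<length u}" "permute_list p u = v"
    using mset_eq_permutation[OF assms(1)[symmetric]] by blast
  have len: "length v = length u" using assms(1) mset_eq_length by metis
  have "v \<frown> y = (u \<frown> y) \<circ> p"
  proof
    fix i
    show "(v \<frown> y) i = ((u \<frown> y) \<circ> p) i"
    proof (cases "i < length u")
      case True
      then have "p i < length u" using permutes_in_image[OF p(1), of i] by simp
      then show ?thesis using True len permute_list_nth[OF p(1), of i] p(2) by simp
    next
      case False
      then show ?thesis using len permutes_not_in[OF p(1), of i] by simp
    qed
  qed
  then show ?thesis using assms p(1) unfolding exchange_rel_def by blast
qed

lemma trans_exchange_rel: "trans (exchange_rel A)"
proof (rule transI)
  fix x y z assume "(x, y) \<in> exchange_rel A" "(y, z) \<in> exchange_rel A"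
  then obtain p F q G where pq: "finite F" "p permutes F" "y = x \<circ> p" "finite G" "q permutes G" "z = y \<circ> q"
    and xz: "x \<in> A" "z \<in> A"
    unfolding exchange_rel_def by blast
  have "p permutes F \<union> G" "q permutes F \<union> G"
    using pq by (auto intro: permutes_subset)
  then have "p \<circ> q permutes F \<union> G" by (intro permutes_compose)
  moreover have "z = x \<circ> (p \<circ> q)" using pq by (simp add: comp_assoc)
  moreover have "finite (F \<union> G)" using pq by simp
  ultimately show "(x, z) \<in> exchange_rel A" using xz unfolding exchange_rel_def by blast
qed

context conformal_measure
begin

lemma emeasure_nu_mset_eq:
  assumes D: "D \<in> sets borel" and "mset u = mset v" and u: "(\<frown>) u ` D \<subseteq> X" and v: "(\<frown>) v ` D \<subseteq> X"
  shows "emeasure \<nu> ((\<frown>) u ` D) = emeasure \<nu> ((\<frown>) v ` D)"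
proof -
  have mass: "emeasure \<nu> ((\<frown>) w ` D) = (if w \<in> lists J then wt c w * emeasure \<mu> (D \<inter> XJ) else 0)"
    if w: "(\<frown>) w ` D \<subseteq> X" for w
  proof -
    have sets: "(\<frown>) w ` D \<in> sets \<nu>" using D w by (simp add: sets_nu_iff conc_image_borel)
    show ?thesis
    proof (cases "w \<in> lists J")
      case True
      have "(\<frown>) w ` D \<inter> XJ = (\<frown>) w ` (D \<inter> XJ)"
      proof
        show "(\<frown>) w ` D \<inter> XJ \<subseteq> (\<frown>) w ` (D \<inter> XJ)" using conc_in_XJ_D by blast
        show "(\<frown>) w ` (D \<inter> XJ) \<subseteq> (\<frown>) w ` D \<inter> XJ"
        proof
          fix x assume "x \<in> (\<frown>) w ` (D \<inter> XJ)"
          then obtain y where y: "y \<in> D" "y \<in> XJ" "x = w \<frown> y" by blast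
          then have "x \<in> X" using w by blast
          moreover have "range x \<subseteq> J" using y True by (auto simp: mem_XJ_iff)
          ultimately show "x \<in> (\<frown>) w ` D \<inter> XJ" using y by (simp add: mem_XJ_iff)
        qed
      qed
      moreover from this have "(\<frown>) w ` (D \<inter> XJ) \<subseteq> XJ" by blast
      moreover have "D \<inter> XJ \<in> sets \<mu>" using D by (simp add: sets_mu_iff sets.Int)
      ultimately show ?thesis using emeasure_nu[OF sets] emeasure_conc[of "D \<inter> XJ" w] True by simp
    next
      case False
      then have "(\<frown>) w ` D \<inter> XJ = {}" using conc_in_XJ_D by blast
      then show ?thesis using emeasure_nu[OF sets] False by simp
    qed
  qed
  have "u \<in> lists J \<longleftrightarrow> v \<in> lists J" using assms(2) by (metis in_lists_conv_set set_mset_mset)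
  then show ?thesis using mass[OF u] mass[OF v] wt_mset[OF assms(2), of c] by simp
qed

text \<open>The points where the map leaves all coordinates from \<open>n\<close> on in place form an increasing sequence
  of sets that exhausts the domain; each of them splits according to the first \<open>n\<close> coordinates of
  the point and of its image.\<close>

lemma rel_invariant_nu: "rel_invariant \<nu> (exchange_rel X)"
  unfolding rel_invariant_def
proof (intro ballI allI impI, elim conjE)
  fix A B C \<kappa>
  assume A: "A \<in> sets \<nu>" and B: "B \<in> sets \<nu>" and bij: "bij_betw \<kappa> A B"
    and \<kappa>: "\<kappa> \<in> restrict_space \<nu> A \<rightarrow>\<^sub>M restrict_space \<nu> B"
    and rel: "\<forall>x\<in>A. (x, \<kappa> x) \<in> exchange_rel X"
    and C: "C \<in> sets \<nu>" "C \<subseteq> A"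
  let ?L = "restrict_space \<nu> A"
  have space_L: "space ?L = A" using A by (auto simp: space_restrict_space sets_nu_iff)
  have sets_L: "D \<in> sets \<nu>" if "D \<in> sets ?L" for D
    using that A sets.Int_space_eq2[OF A] by (simp add: sets_restrict_space_iff)
  have id_L: "(\<lambda>x. x) \<in> ?L \<rightarrow>\<^sub>M borel"
    by (intro measurable_restrict_space1)
      (auto simp: on_beta_shift_def intro!: measurable_restrict_space1)
  have \<kappa>_nu: "\<kappa> \<in> ?L \<rightarrow>\<^sub>M \<nu>"
    using \<kappa> B by (simp add: measurable_restrict_space2_iff)
  have "\<kappa> \<in> ?L \<rightarrow>\<^sub>M borel"
  proof -
    have "(\<lambda>x. x) \<in> \<nu> \<rightarrow>\<^sub>M borel" by (auto simp: on_beta_shift_def intro!: measurable_restrict_space1)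
    from measurable_compose[OF \<kappa>_nu this] show ?thesis by simp
  qed
  note coord [measurable] = measurable_compose[OF id_L measurable_coordinate]
    measurable_compose[OF this measurable_coordinate]
  note pref [measurable] = measurable_compose[OF id_L measurable_prefix]
    measurable_compose[OF \<open>\<kappa> \<in> ?L \<rightarrow>\<^sub>M borel\<close> measurable_prefix]
  have inj: "inj_on \<kappa> A" using bij by (simp add: bij_betw_def)
  have \<kappa>_X: "\<kappa> x \<in> X" if "x \<in> A" for x using rel that by (auto simp: exchange_rel_def)
  let ?I = "\<lambda>n. {z :: nat list \<times> nat list. length (fst z) = n \<and> length (snd z) = n \<and> mset (fst z) = mset (snd z)}"
  define G where "G n z = {x\<in>C. prefix n x = fst z \<and> prefix n (\<kappa> x) = snd z \<and> (\<forall>i. \<kappa> x (n + i) = x (n + i))}" for n z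
  define C' where "C' n = (\<Union>z\<in>?I n. G n z)" for n
  have G_sets: "G n z \<in> sets \<nu>" for n z
  proof -
    have "{x\<in>space ?L. prefix n x = fst z \<and> prefix n (\<kappa> x) = snd z \<and> (\<forall>i. \<kappa> x (n + i) = x (n + i))} \<in> sets ?L"
      by measurable
    then have "{x\<in>A. prefix n x = fst z \<and> prefix n (\<kappa> x) = snd z \<and> (\<forall>i. \<kappa> x (n + i) = x (n + i))} \<inter> C \<in> sets \<nu>"
      using sets_L C(1) unfolding space_L by blast
    also have "{x\<in>A. prefix n x = fst z \<and> prefix n (\<kappa> x) = snd z \<and> (\<forall>i. \<kappa> x (n + i) = x (n + i))} \<inter> C = G n z"
      using C(2) by (auto simp: G_def)
    finally show ?thesis .
  qed
  (* On each piece the map exchanges one initial word for a rearrangement of it. *)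
  have piece: "\<kappa> ` G n z \<in> sets \<nu> \<and> emeasure \<nu> (\<kappa> ` G n z) = emeasure \<nu> (G n z)" if z: "z \<in> ?I n" for n z
  proof -
    obtain u v where uv: "z = (u, v)" "length u = n" "length v = n" "mset u = mset v" using z by (cases z) auto
    let ?D = "{y. u \<frown> y \<in> G n z}"
    have G_borel [measurable]: "G n z \<in> sets borel" using G_sets by (simp add: sets_nu_iff)
    have D: "?D \<in> sets borel"
      using measurable_sets[OF measurable_conc[of u] G_borel] by (simp add: vimage_def)
    have u_eq: "u \<frown> suffix n x = x" if "x \<in> G n z" for x
      using that uv prefix_suffix[of x n] by (auto simp: G_def)
    have v_eq: "v \<frown> suffix n x = \<kappa> x" if "x \<in> G n z" for x
    proof -
      have "suffix n x = suffix n (\<kappa> x)" using that by (auto simp: fun_eq_iff G_def)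
      then show ?thesis using that uv prefix_suffix[of "\<kappa> x" n] by (auto simp: G_def)
    qed
    have G_eq: "G n z = (\<frown>) u ` ?D"
    proof
      show "G n z \<subseteq> (\<frown>) u ` ?D"
      proof
        fix x assume "x \<in> G n z"
        then show "x \<in> (\<frown>) u ` ?D" using u_eq by (intro image_eqI[of _ _ "suffix n x"]) auto
      qed
    qed auto
    have v_eq': "v \<frown> y = \<kappa> (u \<frown> y)" if "y \<in> ?D" for y
      using v_eq[of "u \<frown> y"] that uv(2) by (simp add: suffix_conc_length[of u, unfolded uv(2)])
    have "\<kappa> ` G n z = \<kappa> ` (\<frown>) u ` ?D" using G_eq by (rule arg_cong)
    also have "\<dots> = (\<frown>) v ` ?D" unfolding image_image using v_eq' by (intro image_cong) auto
    finally have \<kappa>G_eq: "\<kappa> ` G n z = (\<frown>) v ` ?D" .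
    have "\<kappa> ` G n z \<subseteq> X" using \<kappa>_X C(2) by (auto simp: G_def)
    moreover have "G n z \<subseteq> X" using G_sets[of n z] unfolding sets_nu_iff by blast
    ultimately have "emeasure \<nu> ((\<frown>) u ` ?D) = emeasure \<nu> ((\<frown>) v ` ?D)"
      using emeasure_nu_mset_eq[OF D uv(4)] G_eq \<kappa>G_eq by simp
    moreover have "\<kappa> ` G n z \<in> sets \<nu>"
      using conc_image_borel[OF D, of v] \<kappa>G_eq \<open>\<kappa> ` G n z \<subseteq> X\<close> by (simp only: sets_nu_iff)
    ultimately show ?thesis using G_eq \<kappa>G_eq by simp
  qed
  have countable_I: "countable (?I n)" for n by (rule countableI_type)
  have disj: "disjoint_family_on (G n) (?I n)" for n
    unfolding disjoint_family_on_def by (auto simp: prod_eq_iff G_def)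
  have disj': "disjoint_family_on (\<lambda>z. \<kappa> ` G n z) (?I n)" for n
    unfolding disjoint_family_on_def
  proof (intro ballI impI)
    fix y z assume yz: "y \<in> ?I n" "z \<in> ?I n" "y \<noteq> z"
    have "\<kappa> ` G n y \<inter> \<kappa> ` G n z = \<kappa> ` (G n y \<inter> G n z)"
      by (rule inj_on_image_Int[OF inj, symmetric]) (use C(2) in \<open>auto simp: G_def\<close>)
    also have "G n y \<inter> G n z = {}" by (rule disjoint_family_onD[OF disj yz])
    finally show "\<kappa> ` G n y \<inter> \<kappa> ` G n z = {}" by simp
  qed
  have C_sets: "C' n \<in> sets \<nu>" for n
    unfolding C'_def using G_sets countable_I by (intro sets.countable_UN'') auto
  have \<kappa>C_eq: "\<kappa> ` C' n = (\<Union>z\<in>?I n. \<kappa> ` G n z)" for n unfolding C'_def by (rule image_UN)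
  have \<kappa>C_sets: "\<kappa> ` C' n \<in> sets \<nu>" for n
    unfolding \<kappa>C_eq using piece countable_I by (intro sets.countable_UN'') auto
  have eq: "emeasure \<nu> (\<kappa> ` C' n) = emeasure \<nu> (C' n)" for n
  proof -
    have "emeasure \<nu> (\<kappa> ` C' n) = (\<integral>\<^sup>+z. emeasure \<nu> (\<kappa> ` G n z) \<partial>count_space (?I n))"
      unfolding \<kappa>C_eq using piece disj' countable_I by (intro emeasure_UN_countable) auto
    also have "\<dots> = (\<integral>\<^sup>+z. emeasure \<nu> (G n z) \<partial>count_space (?I n))"
      using piece by (intro nn_integral_cong) auto
    also have "\<dots> = emeasure \<nu> (C' n)"
      unfolding C'_def using G_sets disj countable_I by (intro emeasure_UN_countable[symmetric]) auto
    finally show ?thesis .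
  qed
  have C_eq: "C' n = {x\<in>C. mset (prefix n x) = mset (prefix n (\<kappa> x)) \<and> (\<forall>i. \<kappa> x (n + i) = x (n + i))}" for n
    by (auto simp: C'_def G_def)
  have incr: "incseq C'"
  proof (rule incseq_SucI)
    fix n
    show "C' n \<subseteq> C' (Suc n)"
    proof
      fix x assume "x \<in> C' n"
      then have x: "x \<in> C" "mset (prefix n x) = mset (prefix n (\<kappa> x))" "\<And>i. \<kappa> x (n + i) = x (n + i)"
        unfolding C_eq by auto
      have "\<kappa> x n = x n" using x(3)[of 0] by simp
      moreover have "\<kappa> x (Suc n + i) = x (Suc n + i)" for i using x(3)[of "Suc i"] by simp
      ultimately show "x \<in> C' (Suc n)" unfolding C_eq using x by simp
    qed
  qed
  have cover: "(\<Union>n. C' n) = C"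
  proof
    show "(\<Union>n. C' n) \<subseteq> C" by (auto simp: C_eq)
    show "C \<subseteq> (\<Union>n. C' n)"
    proof
      fix x assume x: "x \<in> C"
      then have "(x, \<kappa> x) \<in> exchange_rel X" using rel C(2) by blast
      then obtain p F where p: "finite F" "p permutes F" "\<kappa> x = x \<circ> p"
        unfolding exchange_rel_def by blast
      obtain n where n: "F \<subseteq> {..<n}" using finite_nat_bounded[OF p(1)] by blast
      then have pn: "p permutes {..<n}" using permutes_subset[OF p(2)] by blast
      then have "p (n + i) = n + i" for i using permutes_not_in[OF pn, of "n + i"] by simp
      then have "x \<in> C' n" unfolding C_eq using x p(3) prefix_comp_permutes[OF pn, of x] by simp
      then show "x \<in> (\<Union>n. C' n)" by blast
    qed
  qed
  have incr': "incseq (\<lambda>n. \<kappa> ` C' n)" using incr by (auto simp: incseq_def)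
  have "emeasure \<nu> (\<kappa> ` C) = emeasure \<nu> (\<Union>n. \<kappa> ` C' n)"
    by (subst image_UN[symmetric]) (simp only: cover)
  also have "\<dots> = (SUP n. emeasure \<nu> (\<kappa> ` C' n))"
    using \<kappa>C_sets incr' by (intro SUP_emeasure_incseq[symmetric]) auto
  also have "\<dots> = (SUP n. emeasure \<nu> (C' n))" by (simp only: eq)
  also have "\<dots> = emeasure \<nu> (\<Union>n. C' n)"
    using C_sets incr by (intro SUP_emeasure_incseq) auto
  also have "\<dots> = emeasure \<nu> C" by (simp only: cover)
  finally show "emeasure \<nu> (\<kappa> ` C) = emeasure \<nu> C" .
qed

end

section \<open>Ergodicity\<close>

text \<open>The Choquet--Deny theorem for commuting moves: a bounded function that is harmonic for a random
  walk whose moves commute is constant along the walk. If a move \<open>a\<close> could increase \<open>r\<close>, then the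
  increment would be a harmonic function with a positive supremum; near the supremum, it would stay
  large under many repetitions of the same move \<open>a\<close>, and \<open>r\<close> would be unbounded.\<close>

lemma harmonic_commuting_le:
  fixes P :: "'a pmf" and move :: "'s \<Rightarrow> 'a \<Rightarrow> 's" and r :: "'s \<Rightarrow> real"
  assumes closed: "\<And>s a. s \<in> G \<Longrightarrow> a \<in> set_pmf P \<Longrightarrow> move s a \<in> G"
    and bounds: "\<And>s. s \<in> G \<Longrightarrow> 0 \<le> r s \<and> r s \<le> 1"
    and harmonic: "\<And>s. s \<in> G \<Longrightarrow> r s = measure_pmf.expectation P (\<lambda>a. r (move s a))"
    and commute: "\<And>s a b. s \<in> G \<Longrightarrow> a \<in> set_pmf P \<Longrightarrow> b \<in> set_pmf P \<Longrightarrow>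
      r (move (move s a) b) = r (move (move s b) a)"
    and s0: "s\<^sub>0 \<in> G" and a: "a \<in> set_pmf P"
  shows "r (move s\<^sub>0 a) \<le> r s\<^sub>0"
proof (rule ccontr)
  assume "\<not> r (move s\<^sub>0 a) \<le> r s\<^sub>0"
  define g where "g s = r (move s a) - r s" for s
  have g_s0: "g s\<^sub>0 > 0" using \<open>\<not> r (move s\<^sub>0 a) \<le> r s\<^sub>0\<close> by (simp add: g_def)
  have g_le_1: "g s \<le> 1" and g_ge: "-1 \<le> g s" if "s \<in> G" for s
    using bounds[OF that] bounds[OF closed[OF that a]] by (auto simp: g_def)
  define M where "M = Sup (g ` G)"
  have bdd: "bdd_above (g ` G)" using g_le_1 by (auto intro!: bdd_aboveI)
  have g_M: "g s \<le> M" if "s \<in> G" for s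
    unfolding M_def using that by (intro cSup_upper bdd) auto
  have M0: "M > 0" using g_M[OF s0] g_s0 by linarith
  have integrable: "integrable (measure_pmf P) f" if "\<And>b. b \<in> set_pmf P \<Longrightarrow> \<bar>f b\<bar> \<le> B" for f :: "'a \<Rightarrow> real" and B
    using that by (intro measure_pmf.integrable_const_bound[where B=B]) (auto simp: AE_measure_pmf_iff)
  define p where "p = pmf P a"
  have p: "0 < p" "p \<le> 1" using a by (auto simp: p_def pmf_positive pmf_le_1)
  (* The move a increases the distance of g to its supremum at most by the factor 1 / p. *)
  have step: "p * (M - g (move s a)) \<le> M - g s" if s: "s \<in> G" for s
  proof -
    have int1: "integrable (measure_pmf P) (\<lambda>b. r (move (move s b) a))"
      using bounds closed s a by (intro integrable[of _ 1]) (auto simp: abs_le_iff intro: order.trans[of _ 0])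
    have int2: "integrable (measure_pmf P) (\<lambda>b. r (move s b))"
      using bounds closed s by (intro integrable[of _ 1]) (auto simp: abs_le_iff intro: order.trans[of _ 0])
    have "r (move s a) = measure_pmf.expectation P (\<lambda>b. r (move (move s a) b))"
      by (rule harmonic[OF closed[OF s a]])
    also have "\<dots> = measure_pmf.expectation P (\<lambda>b. r (move (move s b) a))"
      using commute[OF s a] by (intro integral_cong_AE) (auto simp: AE_measure_pmf_iff)
    finally have g_eq: "g s = measure_pmf.expectation P (\<lambda>b. g (move s b))"
      using harmonic[OF s] int1 int2 by (simp add: g_def)
    have int_g: "integrable (measure_pmf P) (\<lambda>b. g (move s b))"
      using g_le_1 g_ge closed s by (intro integrable[of _ 1]) (auto simp: abs_le_iff minus_le_iff)
    have "p * (M - g (move s a)) = measure_pmf.expectation P (\<lambda>b. indicator {a} b * (M - g (move s b)))"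
      by (subst integral_measure_pmf[of "{a}"]) (auto simp: p_def indicator_def)
    also have "\<dots> \<le> measure_pmf.expectation P (\<lambda>b. M - g (move s b))"
    proof (rule integral_mono_AE)
      show "integrable (measure_pmf P) (\<lambda>b. indicator {a} b * (M - g (move s b)))"
        using M0 g_M g_ge closed s
        by (intro integrable[of _ "M + 1"]) (fastforce simp: indicator_def abs_le_iff)
      show "integrable (measure_pmf P) (\<lambda>b. M - g (move s b))" using int_g by simp
      show "AE b in measure_pmf P. indicator {a} b * (M - g (move s b)) \<le> M - g (move s b)"
        using g_M closed s by (auto simp: AE_measure_pmf_iff indicator_def)
    qed
    also have "\<dots> = M - g s" using int_g g_eq by simp
    finally show ?thesis .
  qed
  (* K increments of at least M / 2 exceed the range of r. *)
  obtain K :: nat where K: "2 / M < real K" using reals_Archimedean2 by blast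
  have "M - p ^ K * (M / 2) < M" using p M0 by simp
  then obtain s where s: "s \<in> G" "M - p ^ K * (M / 2) < g s"
    using less_cSupD[of "g ` G" "M - p ^ K * (M / 2)"] s0 unfolding M_def by auto
  define t where "t k = ((\<lambda>s. move s a) ^^ k) s" for k
  have t: "t k \<in> G" "p ^ k * (M - g (t k)) \<le> M - g s" for k
  proof (induction k)
    case (Suc k)
    have Suc_t: "t (Suc k) = move (t k) a" by (simp add: t_def)
    case 1 show ?case using Suc closed a Suc_t by simp
    case 2
    have "p ^ Suc k * (M - g (t (Suc k))) = p ^ k * (p * (M - g (move (t k) a)))" by (simp add: Suc_t)
    also have "\<dots> \<le> p ^ k * (M - g (t k))" using step[OF Suc(1)] p by (intro mult_left_mono) auto
    finally show ?case using Suc(2) by simp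
  qed (use s in \<open>auto simp: t_def\<close>)
  have large: "M / 2 \<le> g (t k)" if "k < K" for k
  proof -
    have "p ^ k * (M - g (t k)) \<le> p ^ K * (M / 2)" using t(2)[of k] s(2) by linarith
    also have "\<dots> \<le> p ^ k * (M / 2)"
      using that p M0 by (intro mult_right_mono power_decreasing) auto
    finally have "M - g (t k) \<le> M / 2" using p by simp
    then show ?thesis by simp
  qed
  have "r (t K) - r s = (\<Sum>k<K. g (t k))"
  proof -
    have "(\<Sum>k<K. g (t k)) = (\<Sum>k<K. r (t (Suc k)) - r (t k))" by (simp add: g_def t_def)
    also have "\<dots> = r (t K) - r (t 0)" by (rule sum_lessThan_telescope)
    finally show ?thesis by (simp add: t_def)
  qed
  also have "(\<Sum>k<K. g (t k)) \<ge> (\<Sum>k<K. M / 2)" using large by (intro sum_mono) auto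
  finally have "real K * (M / 2) \<le> r (t K) - r s" by simp
  moreover have "1 < real K * (M / 2)" using K M0 by (simp add: field_simps)
  moreover have "r (t K) - r s \<le> 1" using bounds[OF t(1)[of K]] bounds[OF s(1)] by simp
  ultimately show False by simp
qed

lemma harmonic_commuting_const:
  fixes P :: "'a pmf" and move :: "'s \<Rightarrow> 'a \<Rightarrow> 's" and r :: "'s \<Rightarrow> real"
  assumes closed: "\<And>s a. s \<in> G \<Longrightarrow> a \<in> set_pmf P \<Longrightarrow> move s a \<in> G"
    and bounds: "\<And>s. s \<in> G \<Longrightarrow> 0 \<le> r s \<and> r s \<le> 1"
    and harmonic: "\<And>s. s \<in> G \<Longrightarrow> r s = measure_pmf.expectation P (\<lambda>a. r (move s a))"
    and commute: "\<And>s a b. s \<in> G \<Longrightarrow> a \<in> set_pmf P \<Longrightarrow> b \<in> set_pmf P \<Longrightarrow>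
      r (move (move s a) b) = r (move (move s b) a)"
    and s: "s \<in> G" and a: "a \<in> set_pmf P"
  shows "r (move s a) = r s"
proof (rule antisym)
  show "r (move s a) \<le> r s"
    by (rule harmonic_commuting_le[OF closed bounds harmonic commute s a])
  have "1 - r (move s a) \<le> 1 - r s"
  proof (rule harmonic_commuting_le[where r="\<lambda>s. 1 - r s" and move=move, OF closed _ _ _ s a])
    fix s assume s: "s \<in> G"
    have "integrable (measure_pmf P) (\<lambda>a. r (move s a))"
      using bounds closed s
      by (intro measure_pmf.integrable_const_bound[where B=1]) (auto simp: AE_measure_pmf_iff)
    then show "1 - r s = measure_pmf.expectation P (\<lambda>a. 1 - r (move s a))"
      using harmonic[OF s] by simp
  qed (use bounds commute in auto)
  then show "r s \<le> r (move s a)" by simp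
qed

context conformal_measure
begin

lemma rel_ergodic_nu: "rel_ergodic \<nu> (exchange_rel X)"
  unfolding rel_ergodic_def
proof (intro allI impI)
  fix \<K> assume \<K>: "\<K> \<subseteq> space \<nu> // exchange_rel X" and U_sets: "\<Union>\<K> \<in> sets \<nu>"
  interpret weights: normalised_weights \<beta> J H c
    using c_pos total_weight by unfold_locales
  define U where "U = \<Union>\<K>"
  have U_borel [measurable]: "U \<in> sets borel" using U_sets by (simp add: sets_nu_iff U_def)
  have saturated: "y \<in> U" if x: "x \<in> U" and xy: "(x, y) \<in> exchange_rel X" for x y
  proof -
    obtain k where "k \<in> \<K>" "x \<in> k" using x by (auto simp: U_def)
    moreover from this obtain z where "k = exchange_rel X `` {z}" using \<K> by (auto simp: quotient_def)
    ultimately have "y \<in> k" using xy trans_exchange_rel by (auto dest: transD)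
    with \<open>k \<in> \<K>\<close> show ?thesis by (auto simp: U_def)
  qed
  define U' where "U' u = {y\<in>XJ. u \<frown> y \<in> U}" for u
  have U'_sets: "U' u \<in> sets \<mu>" for u
  proof -
    have "{y\<in>space borel. y \<in> XJ \<and> u \<frown> y \<in> U} \<in> sets borel" by measurable
    then show ?thesis by (auto simp: U'_def sets_mu_iff)
  qed
  define r where "r u = measure \<mu> (U' u)" for u
  define G where "G = {u. full u \<and> u \<in> lists J}"
  have swap: "U' u = U' v" if "u \<in> G" "v \<in> G" "mset u = mset v" for u v
  proof -
    have sub: "U' u \<subseteq> U' v" if uv: "u \<in> G" "v \<in> G" "mset u = mset v" for u v
    proof
      fix y assume y: "y \<in> U' u"
      then have "y \<in> X" by (simp add: U'_def mem_XJ_iff)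
      then have "(u \<frown> y, v \<frown> y) \<in> exchange_rel X"
        using uv full_concD by (intro exchange_relI) (auto simp: G_def)
      then show "y \<in> U' v" using y saturated by (auto simp: U'_def)
    qed
    show ?thesis using sub[OF that] sub[OF that(2,1) that(3)[symmetric]] by (rule equalityI)
  qed
  have append_G: "u @ v \<in> G" if "u \<in> G" "v \<in> G" for u v
    using that full_append by (auto simp: G_def)
  have code_G: "w \<in> G" if "w \<in> codeJ" for w using codeJ_D[OF that] by (simp add: G_def)
  have harmonic: "r u = measure_pmf.expectation weights.code_pmf (\<lambda>w. r (u @ w))" if u: "u \<in> G" for u
  proof -
    have eq: "{y\<in>XJ. w \<frown> y \<in> U' u} = U' (u @ w)" if "w \<in> codeJ" for w
      using conc_in_XJ[of w] codeJ_D[OF that] by (auto simp: U'_def)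
    have "ennreal (r u) = (\<integral>\<^sup>+w. wt c w * emeasure \<mu> {y\<in>XJ. w \<frown> y \<in> U' u} \<partial>count_space codeJ)"
      using emeasure_code_split[OF U'_sets[of u]] by (simp add: r_def emeasure_eq_measure)
    also have "\<dots> = (\<integral>\<^sup>+w. wt c w * ennreal (r (u @ w)) \<partial>count_space codeJ)"
      using eq by (intro nn_integral_cong) (simp add: r_def emeasure_eq_measure)
    also have "\<dots> = (\<integral>\<^sup>+w. ennreal (r (u @ w)) \<partial>measure_pmf weights.code_pmf)"
      by (rule weights.nn_integral_code_pmf[symmetric])
    also have "\<dots> = ennreal (measure_pmf.expectation weights.code_pmf (\<lambda>w. r (u @ w)))"
      by (intro nn_integral_eq_integral measure_pmf.integrable_const_bound[where B=1])
        (auto simp: r_def)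
    finally show ?thesis
      by (subst (asm) ennreal_inj) (auto simp: r_def intro: integral_nonneg_AE)
  qed
  have r_code: "r (u @ w) = r u" if "u \<in> G" "w \<in> codeJ" for u w
  proof (rule harmonic_commuting_const[where P=weights.code_pmf and move="(@)" and G=G])
    fix s v w assume vw: "s \<in> G" "v \<in> set_pmf weights.code_pmf" "w \<in> set_pmf weights.code_pmf"
    have "U' ((s @ v) @ w) = U' ((s @ w) @ v)"
      using vw append_G code_G by (intro swap) (auto simp: weights.set_code_pmf)
    then show "r ((s @ v) @ w) = r ((s @ w) @ v)" by (simp add: r_def)
  next
    show "r s = measure_pmf.expectation weights.code_pmf (\<lambda>w. r (s @ w))" if "s \<in> G" for s
      by (rule harmonic[OF that])
    show "0 \<le> r s \<and> r s \<le> 1" for s by (simp add: r_def)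
  qed (use that append_G code_G in \<open>auto simp: weights.set_code_pmf\<close>)
  have r_const: "r u = r []" if "u \<in> G" for u
  proof -
    have "u \<in> lists J \<Longrightarrow> \<forall>s\<in>G. r (s @ u) = r s" if "full u" for u
      using that
    proof (induction u rule: full_induct)
      case (append w v)
      then have "w \<in> codeJ" by (simp add: codeJ_def)
      have "r (s @ w @ v) = r s" if "s \<in> G" for s
      proof -
        have "\<forall>s\<in>G. r (s @ v) = r s" using append by simp
        then have "r ((s @ w) @ v) = r (s @ w)" using append_G[OF that code_G[OF \<open>w \<in> codeJ\<close>]] by blast
        then show ?thesis using r_code[OF that \<open>w \<in> codeJ\<close>] by simp
      qed
      then show ?case by simp
    qed simp
    then have "\<forall>s\<in>G. r (s @ u) = r s" using that by (auto simp only: G_def)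
    moreover have "[] \<in> G" by (simp add: G_def)
    ultimately have "r ([] @ u) = r []" by blast
    then show ?thesis by simp
  qed
  let ?U = "U' []"
  have U_eq: "?U = U \<inter> XJ" by (auto simp: U'_def)
  (* So U is independent of every cylinder of a full word, hence of every Borel set, in particular
     of itself. *)
  have "density \<mu> (indicator ?U) = scale_measure (emeasure \<mu> ?U) \<mu>"
  proof (rule measure_eqI_full_cylinders)
    have null: "XJ - X0J \<in> sets \<mu>" "emeasure \<mu> (XJ - X0J) = 0"
      using emeasure_XJ_minus_X0J by (auto simp: sets_mu_iff)
    show "emeasure (density \<mu> (indicator ?U)) (XJ - X0J) = 0"
      using emeasure_mono[of "?U \<inter> (XJ - X0J)" "XJ - X0J" \<mu>] null U'_sets[of "[]"]
      by (subst emeasure_restricted) auto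
    show "emeasure (scale_measure (emeasure \<mu> ?U) \<mu>) (XJ - X0J) = 0"
      using null by simp
    show "emeasure (density \<mu> (indicator ?U)) XJ \<noteq> \<infinity>"
      using U'_sets[of "[]"] by (subst emeasure_restricted) (auto simp: less_top[symmetric])
    fix u assume u: "full u" "u \<in> lists J"
    have "?U \<inter> (\<frown>) u ` XJ = (\<frown>) u ` U' u"
      using conc_in_XJ[OF u] by (auto simp: U'_def)
    then have "emeasure \<mu> (?U \<inter> (\<frown>) u ` XJ) = wt c u * ennreal (r u)"
      using emeasure_full_conc[OF u U'_sets[of u]] by (simp add: r_def emeasure_eq_measure)
    also have "\<dots> = emeasure \<mu> ?U * emeasure \<mu> ((\<frown>) u ` XJ)"
      using r_const[of u] u emeasure_full_cylinder[OF u]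
      by (simp add: G_def r_def emeasure_eq_measure mult.commute)
    finally show "emeasure (density \<mu> (indicator ?U)) ((\<frown>) u ` XJ) =
        emeasure (scale_measure (emeasure \<mu> ?U) \<mu>) ((\<frown>) u ` XJ)"
      using U'_sets[of "[]"] full_conc_sets[OF u XJ_sets_mu] by (simp add: emeasure_restricted)
  qed simp_all
  then have "emeasure (density \<mu> (indicator ?U)) ?U = emeasure (scale_measure (emeasure \<mu> ?U) \<mu>) ?U"
    by simp
  then have "emeasure \<mu> ?U = emeasure \<mu> ?U * emeasure \<mu> ?U"
    using U'_sets[of "[]"] by (simp add: emeasure_restricted)
  then have "measure \<mu> ?U = measure \<mu> ?U * measure \<mu> ?U"
    by (simp add: emeasure_eq_measure ennreal_mult[symmetric])
  then have zero_one: "measure \<mu> ?U = 0 \<or> measure \<mu> ?U = 1" by simp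
  have nu_U: "emeasure \<nu> U = ennreal (measure \<mu> ?U)"
    using emeasure_nu[of U] U_sets by (simp add: U_def[symmetric] U_eq emeasure_eq_measure)
  have "X - U \<in> sets \<nu>" by (simp add: sets_nu_iff sets.Diff)
  then have "emeasure \<nu> (X - U) = emeasure \<mu> ((X - U) \<inter> XJ)" by (rule emeasure_nu)
  also have "(X - U) \<inter> XJ = space \<mu> - ?U" by (auto simp: U_eq mem_XJ_iff)
  also have "emeasure \<mu> (space \<mu> - ?U) = ennreal (1 - measure \<mu> ?U)"
    using prob_compl[OF U'_sets[of "[]"]] by (simp add: emeasure_eq_measure)
  finally show "emeasure \<nu> (\<Union>\<K>) = 0 \<or> emeasure \<nu> (space \<nu> - \<Union>\<K>) = 0"
    using nu_U zero_one unfolding U_def[symmetric] by auto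
qed

end

theorem proposition8p0:
  fixes \<beta> :: real and J :: "nat set" and H :: "nat \<Rightarrow> real"
  assumes "\<beta> > 1" and "\<beta> \<notin> \<int>"
    and "J \<subseteq> {0..nat \<lfloor>\<beta>\<rfloor>}" and "card J > 1"
    and "infinite (beta_shift0_on \<beta> J)"
    and "\<And>j. j \<in> J \<Longrightarrow> H j > 0"
  shows "\<exists>c \<mu>. c > 0 \<and> conformal \<beta> J H c \<mu> \<and>
           (\<forall>c' \<mu>'. c' > 0 \<and> conformal \<beta> J H c' \<mu>' \<longrightarrow> c' = c \<and> \<mu>' = \<mu>) \<and>
           product_measure \<beta> (on_beta_shift \<beta> \<mu>) \<and>
           rel_invariant (on_beta_shift \<beta> \<mu>) (exchange_rel (beta_shift \<beta>)) \<and>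
           rel_ergodic (on_beta_shift \<beta> \<mu>) (exchange_rel (beta_shift \<beta>))"
proof -
  interpret weighted_beta_shift \<beta> J H
    using assms by unfold_locales auto
  obtain c \<mu> where c: "c > 0" "conformal \<beta> J H c \<mu>" using ex_conformal by blast
  interpret conformal_measure \<beta> J H c \<mu> using c by unfold_locales
  show ?thesis
    using c conformal_unique product_measure_nu rel_invariant_nu rel_ergodic_nu
    by (intro exI[of _ c] exI[of _ \<mu>]) blast
qed

end
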